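(* Let $X_0=(q_0,p_0)\in H^2$ and let $a_0$ belong to the unit sphere of $\mathcal H_{sp}$. For $h\in(0,1)$ let $u_h(t)=e^{-\frac{it}{h}H(h)}(\Psi_{X_0,h}\otimes a_0)$ and let $(q(t),p(t),\omega(t))$ be the weak solution of the Hamiltonian system with initial data $(q_0,p_0,\pi_{a_0})$. Then $$\Big|\big\langle 2h(\mathcal N\otimes I)u_h(t),u_h(t)\big\rangle-\big(|q(t)|^2+|p(t)|^2\big)\Big|\le C(t)\,h^{1/2},\qquad t\in\mathbb R,$$ where $C(t)$ is independent of $h\in(0,1)$ and bounded on all compact subsets of $\mathbb R$.
   Context: Photon space. $H$ is the real Hilbert space of $f=(f_1,f_2,f_3):\mathbb R^3\to\mathbb R^3$ with $f_j\in L^2(\mathbb R^3)$ real valued and $k\cdot f(k)=0$ a.e., with $|f|^2=\sum_j\int|f_j(k)|^2dk$ and scalar product $\cdot$; $H_{\mathbb C}$ is its complexification; $\mathcal H_{ph}=\mathcal F_s(H_{\mathbb C})$ is the symmetric Fock space. $M$ is multiplication by $|k|$ in $H$. $\mathcal N=d\Gamma(I)$ is the number operator. $\Phi_S(f)=2^{-1/2}(a(f)+a^*(f))$ is the Segal field ($a^*(f)$ creation operator, linear in $f\in H_{\mathbb C}$). $H_{ph}=h\,d\Gamma(M)$. Coherent states: $\Psi_{(a,b),h}=\sum_{n\ge0}\frac{e^{-(|a|^2+|b|^2)/4h}}{(2h)^{n/2}\sqrt{n!}}(a+ib)^{\otimes n}$ for $(a,b)\in H^2$. Fields. $\chi\in\mathcal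 S(\mathbb R)$ is a fixed real-valued function vanishing near $0$; $(e_1,e_2,e_3)$ is the canonical basis of $\mathbb R^3$; $\wedge$ is the cross product. For $x\in\mathbb R^3$, $m=1,2,3$, $$a_m(x)(k)=\frac{\chi(|k|)|k|^{1/2}}{(2\pi)^{3/2}}\sin(k\cdot x)\frac{k\wedge e_m}{|k|},\qquad b_m(x)(k)=\frac{\chi(|k|)|k|^{1/2}}{(2\pi)^{3/2}}\cos(k\cdot x)\frac{k\wedge e_m}{|k|},$$ $B_m(x,q,p)=a_m(x)\cdot q+b_m(x)\cdot p$ for $(q,p)\in H^2$, and $B_m(x)=\sqrt h\,\Phi_S(a_m(x)+ib_m(x))$. Spins. $x_1,\dots,x_N\in\mathbb R^3$ and $\beta\in\mathbb R^3$ are fixed; $\mathcal H_{sp}=(\mathbb C^2)^{\otimes N}$; $\sigma_m^{[\lambda]}$ is the Pauli matrix $\sigma_m$ acting on the $\lambda$-th factor. $H(h)=H_{ph}\otimes I+h\sum_{\lambda=1}^N\sum_{j=1}^3(\beta_j+B_j(x_\lambda))\otimes\sigma_j^{[\lambda]}$, self-adjoint with domain $D(H_{ph})\otimes\mathcal H_{sp}$. Classical system. $\mathcal G$ is the Lie algebra of $SU(2^N)=SU(\mathcal H_{sp})$, $\mathcal G^\star$ its dual; for a unit vector $a$, $\langle\pi_a,Y\rangle=i^{-1}\langle Ya,a\rangle$. The Hamiltonian system is $q'=Mp+h\sum_{\lambda,m}b_m(x_\lambda)\langle\omega,i\sigma_m^{[\lambda]}\rangle$, $p'=-Mq-h\sum_{\lambda,m}a_m(x_\lambda)\langle\omega,i\sigma_m^{[\lambda]}\rangle$,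 $\frac{d}{dt}\langle\omega,Y\rangle=\sum_{\lambda,m}(\beta_m+B_m(x_\lambda,q,p))\langle\omega,[i\sigma_m^{[\lambda]},Y]\rangle$ for all $Y\in\mathcal G$. With $R_t(q,p)=(q_t,p_t)$, $q_t(k)=\cos(t|k|)q(k)+\sin(t|k|)p(k)$, $p_t(k)=-\sin(t|k|)q(k)+\cos(t|k|)p(k)$, a weak solution is a continuous map $t\mapsto(X(t),\omega(t))$, $X=(q,p)$, from $\mathbb R$ to $H\times H\times\mathcal G^\star$ satisfying $X(t)=R_t(X(0))+\int_0^tR_{t-s}(Q(s),P(s))ds$, with $Q(s)=h\sum_{\lambda,m}b_m(x_\lambda)\langle\omega(s),i\sigma_m^{[\lambda]}\rangle$, $P(s)=-h\sum_{\lambda,m}a_m(x_\lambda)\langle\omega(s),i\sigma_m^{[\lambda]}\rangle$, and the time-integrated form of the third equation. There is a unique weak solution on $\mathbb R$ for each initial datum. *)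

theory Defs
  imports "HOL-Analysis.Analysis"
begin

section \<open>Square integrable functions\<close>

definition sq_integrable :: "'a measure \<Rightarrow> ('a \<Rightarrow> 'b::euclidean_space) \<Rightarrow> bool" where
  "sq_integrable M f \<longleftrightarrow> f \<in> borel_measurable M \<and> integrable M (\<lambda>x. (norm (f x))\<^sup>2)"

lemma norm_add_sq_le: "(norm (a + b))\<^sup>2 \<le> 2 * (norm a)\<^sup>2 + 2 * (norm (b :: 'b::real_normed_vector))\<^sup>2"
proof -
  have "(norm (a + b))\<^sup>2 \<le> (norm a + norm b)\<^sup>2"
    by (intro power_mono norm_triangle_ineq) simp
  also have "\<dots> \<le> 2 * (norm a)\<^sup>2 + 2 * (norm b)\<^sup>2"
    using sum_squares_bound[of "norm a" "norm b"] by (simp add: power2_sum)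
  finally show ?thesis .
qed

lemma norm_mult_le_sq: "norm a * norm b \<le> (norm a)\<^sup>2 + (norm b)\<^sup>2"
proof -
  have "0 \<le> norm a * norm b" by simp
  then show ?thesis using sum_squares_bound[of "norm a" "norm b"] by linarith
qed

lemma sq_integrable_zero: "sq_integrable M (\<lambda>x. 0)"
  by (simp add: sq_integrable_def)

lemma sq_integrable_add:
  assumes "sq_integrable M f" "sq_integrable M g"
  shows "sq_integrable M (\<lambda>x. f x + g x)"
proof -
  have [measurable]: "f \<in> borel_measurable M" "g \<in> borel_measurable M"
    and i: "integrable M (\<lambda>x. (norm (f x))\<^sup>2)" "integrable M (\<lambda>x. (norm (g x))\<^sup>2)"
    using assms by (auto simp: sq_integrable_def)
  have "integrable M (\<lambda>x. (norm (f x + g x))\<^sup>2)"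
    by (rule Bochner_Integration.integrable_bound[of M "\<lambda>x. 2 * (norm (f x))\<^sup>2 + 2 * (norm (g x))\<^sup>2"])
       (use i norm_add_sq_le in \<open>auto\<close>)
  then show ?thesis by (auto simp: sq_integrable_def)
qed

lemma sq_integrable_scaleR_bounded:
  assumes f: "sq_integrable M f" and [measurable]: "g \<in> borel_measurable M" and b: "\<And>x. \<bar>g x\<bar> \<le> B"
  shows "sq_integrable M (\<lambda>x. g x *\<^sub>R f x)"
proof -
  have [measurable]: "f \<in> borel_measurable M"
    and i: "integrable M (\<lambda>x. (norm (f x))\<^sup>2)"
    using f by (auto simp: sq_integrable_def)
  have "integrable M (\<lambda>x. (norm (g x *\<^sub>R f x))\<^sup>2)"
  proof (rule Bochner_Integration.integrable_bound[of M "\<lambda>x. B\<^sup>2 * (norm (f x))\<^sup>2"])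
    show "AE x in M. norm ((norm (g x *\<^sub>R f x))\<^sup>2) \<le> norm (B\<^sup>2 * (norm (f x))\<^sup>2)"
    proof (rule AE_I2)
      fix x
      have "(g x)\<^sup>2 \<le> B\<^sup>2"
        using b[of x] by (metis abs_ge_zero abs_of_nonneg abs_le_square_iff order_trans)
      then show "norm ((norm (g x *\<^sub>R f x))\<^sup>2) \<le> norm (B\<^sup>2 * (norm (f x))\<^sup>2)"
        by (simp add: power_mult_distrib mult_right_mono)
    qed
  qed (use i in auto)
  then show ?thesis by (auto simp: sq_integrable_def)
qed

lemma sq_integrable_mult:
  assumes f: "sq_integrable M f"
  shows "sq_integrable M (\<lambda>x. (c::complex) * f x)"
  using assms by (auto simp: sq_integrable_def norm_mult power_mult_distrib)

lemma sq_integrable_inner: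
  assumes "sq_integrable M f" "sq_integrable M g"
  shows "integrable M (\<lambda>x. f x \<bullet> g x)"
proof -
  have [measurable]: "f \<in> borel_measurable M" "g \<in> borel_measurable M"
    and i: "integrable M (\<lambda>x. (norm (f x))\<^sup>2)" "integrable M (\<lambda>x. (norm (g x))\<^sup>2)"
    using assms by (auto simp: sq_integrable_def)
  show ?thesis
    by (rule Bochner_Integration.integrable_bound[of M "\<lambda>x. (norm (f x))\<^sup>2 + (norm (g x))\<^sup>2"])
      (use i in \<open>auto intro!: order_trans[OF Cauchy_Schwarz_ineq2 norm_mult_le_sq]\<close>)
qed

lemma borel_measurable_cnj [measurable (raw)]:
  "f \<in> borel_measurable M \<Longrightarrow> (\<lambda>x. cnj (f x)) \<in> borel_measurable M"
  by (rule measurable_compose[OF _ borel_measurable_continuous_onI]) (auto intro: continuous_intros)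

lemma sq_integrable_cprod:
  assumes "sq_integrable M f" "sq_integrable M g"
  shows "integrable M (\<lambda>x. f x * cnj (g x))"
    and "cmod (\<integral>x. f x * cnj (g x) \<partial>M) \<le> (\<integral>x. (cmod (f x))\<^sup>2 \<partial>M) + (\<integral>x. (cmod (g x))\<^sup>2 \<partial>M)"
proof -
  have [measurable]: "f \<in> borel_measurable M" "g \<in> borel_measurable M"
    and i: "integrable M (\<lambda>x. (norm (f x))\<^sup>2)" "integrable M (\<lambda>x. (norm (g x))\<^sup>2)"
    using assms by (auto simp: sq_integrable_def)
  show *: "integrable M (\<lambda>x. f x * cnj (g x))"
    by (rule Bochner_Integration.integrable_bound[of M "\<lambda>x. (norm (f x))\<^sup>2 + (norm (g x))\<^sup>2"])
      (use i norm_mult_le_sq in \<open>auto simp: norm_mult\<close>)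
  have "cmod (\<integral>x. f x * cnj (g x) \<partial>M) \<le> (\<integral>x. cmod (f x * cnj (g x)) \<partial>M)"
    by (rule integral_norm_bound)
  also have "\<dots> \<le> (\<integral>x. (cmod (f x))\<^sup>2 + (cmod (g x))\<^sup>2 \<partial>M)"
  proof (rule integral_mono)
    show "integrable M (\<lambda>x. cmod (f x * cnj (g x)))"
      using * by (rule integrable_norm)
  qed (use i norm_mult_le_sq in \<open>auto simp: norm_mult\<close>)
  finally show "cmod (\<integral>x. f x * cnj (g x) \<partial>M) \<le> (\<integral>x. (cmod (f x))\<^sup>2 \<partial>M) + (\<integral>x. (cmod (g x))\<^sup>2 \<partial>M)"
    using i by simp
qed

lemma AE_cong_unary:
  "AE x in M. f x = g x \<Longrightarrow> AE x in M. H x (f x) = H x (g x)"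
  by (rule eventually_mono) auto

lemma AE_cong_binary:
  assumes "AE x in M. f x = g x" "AE x in M. f' x = g' x"
  shows "AE x in M. H x (f x) (f' x) = H x (g x) (g' x)"
  using assms by eventually_elim simp

section \<open>The one-photon space\<close>

definition photon_fun :: "(real^3 \<Rightarrow> real^3) \<Rightarrow> bool" where
  "photon_fun f \<longleftrightarrow> sq_integrable lborel f \<and> (AE k in lborel. k \<bullet> f k = 0)"

definition photon_rel :: "(real^3 \<Rightarrow> real^3) \<Rightarrow> (real^3 \<Rightarrow> real^3) \<Rightarrow> bool" where
  "photon_rel f g \<longleftrightarrow> photon_fun f \<and> photon_fun g \<and> (AE k in lborel. f k = g k)"

lemma photon_fun_zero: "photon_fun (\<lambda>k. 0)"
  by (simp add: photon_fun_def sq_integrable_zero)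

lemma photon_fun_add: "photon_fun f \<Longrightarrow> photon_fun g \<Longrightarrow> photon_fun (\<lambda>k. f k + g k)"
  unfolding photon_fun_def
  by (intro conjI sq_integrable_add; elim conjE, assumption?)
     (rule eventually_elim2, assumption+, simp add: inner_add_right)

lemma photon_fun_scaleR:
  assumes "photon_fun f" "g \<in> borel_measurable lborel" "\<And>k. \<bar>g k\<bar> \<le> B"
  shows "photon_fun (\<lambda>k. g k *\<^sub>R f k)"
  using assms sq_integrable_scaleR_bounded[of lborel f g B]
  by (auto simp: photon_fun_def elim!: eventually_mono)

lemma photon_fun_scale: "photon_fun f \<Longrightarrow> photon_fun (\<lambda>k. r *\<^sub>R f k)"
  by (rule photon_fun_scaleR[of f "\<lambda>_. r" "\<bar>r\<bar>"]) auto

lemma part_equivp_photon_rel: "part_equivp photon_rel"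
proof (rule part_equivpI)
  show "\<exists>f. photon_rel f f" by (rule exI[of _ "\<lambda>k. 0"]) (simp add: photon_rel_def photon_fun_zero)
  show "symp photon_rel" by (auto simp: symp_def photon_rel_def elim!: eventually_mono)
  show "transp photon_rel"
    unfolding transp_def photon_rel_def
    by (intro allI impI; elim conjE; intro conjI, assumption+) (rule eventually_elim2, assumption+, simp)
qed

quotient_type photon = "real^3 \<Rightarrow> real^3" / partial: photon_rel
  by (rule part_equivp_photon_rel)

lemma photon_fun_rep: "photon_fun (rep_photon f)"
  using Quotient3_rep_reflp[OF Quotient3_photon, of f] by (simp add: photon_rel_def)

instantiation photon :: real_inner
begin

lift_definition zero_photon :: photon is "\<lambda>k. 0"
  by (simp add: photon_rel_def photon_fun_zero)

lift_definition plus_photon :: "photon \<Rightarrow> photon \<Rightarrow> photon" is "\<lambda>f g k. f k + g k"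
  unfolding photon_rel_def by (elim conjE, intro conjI photon_fun_add, assumption+, rule AE_cong_binary)

lift_definition scaleR_photon :: "real \<Rightarrow> photon \<Rightarrow> photon" is "\<lambda>r f k. r *\<^sub>R f k"
  unfolding photon_rel_def by (elim conjE, intro conjI photon_fun_scale, assumption+, rule AE_cong_unary)

definition uminus_photon :: "photon \<Rightarrow> photon" where "- (f :: photon) = (-1) *\<^sub>R f"

definition minus_photon :: "photon \<Rightarrow> photon \<Rightarrow> photon" where "f - g = f + - (g :: photon)"

lift_definition inner_photon :: "photon \<Rightarrow> photon \<Rightarrow> real" is "\<lambda>f g. \<integral>k. f k \<bullet> g k \<partial>lborel"
  by (rule integral_cong_AE; (rule AE_cong_binary)?) (auto simp: photon_rel_def photon_fun_def sq_integrable_def)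

definition norm_photon :: "photon \<Rightarrow> real" where "norm (f :: photon) = sqrt (f \<bullet> f)"
definition dist_photon :: "photon \<Rightarrow> photon \<Rightarrow> real" where "dist f (g :: photon) = norm (f - g)"
definition sgn_photon :: "photon \<Rightarrow> photon" where "sgn (f :: photon) = inverse (norm f) *\<^sub>R f"
definition uniformity_photon :: "(photon \<times> photon) filter" where
  "(uniformity :: (photon \<times> photon) filter) = (INF e\<in>{0<..}. principal {(x, y). dist x y < e})"
definition open_photon :: "photon set \<Rightarrow> bool" where
  "open (S :: photon set) \<longleftrightarrow> (\<forall>x\<in>S. \<forall>\<^sub>F (x', y) in uniformity. x' = x \<longrightarrow> y \<in> S)"

instance
proof
  fix f g e :: photon and r s :: real
  show "f + g + e = f + (g + e)"
    by transfer (auto simp: photon_rel_def photon_fun_add add.assoc)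
  show "f + g = g + f"
    by transfer (auto simp: photon_rel_def photon_fun_add add.commute)
  show "0 + f = f"
    by transfer (auto simp: photon_rel_def)
  show "- f + f = 0"
    unfolding uminus_photon_def
    by transfer (auto simp: photon_rel_def photon_fun_zero photon_fun_add)
  show "f - g = f + - g" by (rule minus_photon_def)
  show "r *\<^sub>R (f + g) = r *\<^sub>R f + r *\<^sub>R g"
    by transfer (auto simp: photon_rel_def scaleR_add_right photon_fun_scale photon_fun_add)
  show "(r + s) *\<^sub>R f = r *\<^sub>R f + s *\<^sub>R f"
    by transfer (auto simp: photon_rel_def scaleR_add_left photon_fun_scale photon_fun_add)
  show "r *\<^sub>R s *\<^sub>R f = (r * s) *\<^sub>R f"
    by transfer (auto simp: photon_rel_def photon_fun_scale)
  show "1 *\<^sub>R f = f"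
    by transfer (auto simp: photon_rel_def)
  show "sgn f = inverse (norm f) *\<^sub>R f" by (rule sgn_photon_def)
  show "dist f g = norm (f - g)" by (rule dist_photon_def)
  show "f \<bullet> g = g \<bullet> f"
    by transfer (simp add: inner_commute)
  show "(f + g) \<bullet> e = f \<bullet> e + g \<bullet> e"
    by transfer (simp add: inner_add_left photon_rel_def photon_fun_def sq_integrable_inner)
  show "(r *\<^sub>R f) \<bullet> g = r * (f \<bullet> g)"
    by transfer simp
  show "0 \<le> f \<bullet> f"
    by transfer simp
  show "(f \<bullet> f = 0) = (f = 0)"
    by transfer (auto simp: photon_rel_def photon_fun_zero photon_fun_def sq_integrable_inner
        integral_nonneg_eq_0_iff_AE)
  show "norm f = sqrt (f \<bullet> f)" by (rule norm_photon_def)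
  show "uniformity = (INF e\<in>{0<..}. principal {(x::photon, y). dist x y < e})"
    by (rule uniformity_photon_def)
  show "open S = (\<forall>x\<in>S. \<forall>\<^sub>F (x', y) in uniformity. x' = x \<longrightarrow> y \<in> S)" for S :: "photon set"
    by (rule open_photon_def)
qed

end

lemma photon_fun_cos: "photon_fun f \<Longrightarrow> photon_fun (\<lambda>k. cos (t * norm k) *\<^sub>R f k)"
  by (rule photon_fun_scaleR[of f _ 1]) auto

lift_definition photon_cos :: "real \<Rightarrow> photon \<Rightarrow> photon" is "\<lambda>t f k. cos (t * norm k) *\<^sub>R f k"
  unfolding photon_rel_def
  by (elim conjE, intro conjI photon_fun_cos, assumption+, rule AE_cong_unary)

lemma photon_fun_sin: "photon_fun f \<Longrightarrow> photon_fun (\<lambda>k. sin (t * norm k) *\<^sub>R f k)"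
  by (rule photon_fun_scaleR[of f _ 1]) auto

lift_definition photon_sin :: "real \<Rightarrow> photon \<Rightarrow> photon" is "\<lambda>t f k. sin (t * norm k) *\<^sub>R f k"
  unfolding photon_rel_def
  by (elim conjE, intro conjI photon_fun_sin, assumption+, rule AE_cong_unary)

fun free_flow :: "real \<Rightarrow> photon \<times> photon \<Rightarrow> photon \<times> photon" where
  "free_flow t (q, p) = (photon_cos t q + photon_sin t p, - photon_sin t q + photon_cos t p)"

section \<open>The Fock space\<close>

text \<open>
  A complex one-photon vector \<open>f = (f\<^sub>1, f\<^sub>2, f\<^sub>3)\<close> is regarded as the function \<open>(k, j) \<mapsto> f\<^sub>j(k)\<close>
  on \<^typ>\<open>(real^3) \<times> 3\<close>. The complexified photon space is then a closed subspace of the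
  \<open>L\<^sup>2\<close> space of \<open>mode_measure\<close>, its \<open>n\<close>-th Hilbert tensor power is the space of those \<open>L\<^sup>2\<close> functions of
  \<open>n\<close> such variables that are transversal in each of them, and its symmetric part consists of
  the symmetric ones among these. Since \<^term>\<open>Pi\<^sub>M {} M\<close> is a unit point mass, the sector \<open>n = 0\<close> is
  one-dimensional.
\<close>

definition mode_measure :: "((real^3) \<times> 3) measure" where
  "mode_measure = lborel \<Otimes>\<^sub>M count_space UNIV"

definition modes :: "nat \<Rightarrow> (nat \<Rightarrow> (real^3) \<times> 3) measure" where
  "modes n = Pi\<^sub>M {..<n} (\<lambda>_. mode_measure)"

definition symmetric_fun :: "nat \<Rightarrow> ((nat \<Rightarrow> (real^3) \<times> 3) \<Rightarrow> complex) \<Rightarrow> bool" where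
  "symmetric_fun n F \<longleftrightarrow> (\<forall>\<pi>. \<pi> permutes {..<n} \<longrightarrow> (AE z in modes n. F (z \<circ> \<pi>) = F z))"

definition transversal_fun :: "nat \<Rightarrow> ((nat \<Rightarrow> (real^3) \<times> 3) \<Rightarrow> complex) \<Rightarrow> bool" where
  "transversal_fun n F \<longleftrightarrow>
    (\<forall>i<n. AE z in modes n. (\<Sum>j\<in>UNIV. of_real (fst (z i) $ j) * F (z(i := (fst (z i), j)))) = 0)"

type_synonym fock_raw = "nat \<Rightarrow> (nat \<Rightarrow> (real^3) \<times> 3) \<Rightarrow> complex"

definition fock_fun :: "fock_raw \<Rightarrow> bool" where
  "fock_fun \<psi> \<longleftrightarrow>
    (\<forall>n. sq_integrable (modes n) (\<psi> n) \<and> symmetric_fun n (\<psi> n) \<and> transversal_fun n (\<psi> n)) \<and>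
    summable (\<lambda>n. \<integral>z. (cmod (\<psi> n z))\<^sup>2 \<partial>modes n)"

definition fock_rel :: "fock_raw \<Rightarrow> fock_raw \<Rightarrow> bool" where
  "fock_rel \<psi> \<phi> \<longleftrightarrow> fock_fun \<psi> \<and> fock_fun \<phi> \<and> (\<forall>n. AE z in modes n. \<psi> n z = \<phi> n z)"

lemma fock_fun_zero: "fock_fun (\<lambda>n z. 0)"
  by (simp add: fock_fun_def sq_integrable_zero symmetric_fun_def transversal_fun_def)

lemma fock_fun_add:
  assumes "fock_fun \<psi>" "fock_fun \<phi>"
  shows "fock_fun (\<lambda>n z. \<psi> n z + \<phi> n z)"
proof -
  have sq: "sq_integrable (modes n) (\<psi> n)" "sq_integrable (modes n) (\<phi> n)" for n
    using assms by (auto simp: fock_fun_def)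
  have "summable (\<lambda>n. \<integral>z. (cmod (\<psi> n z + \<phi> n z))\<^sup>2 \<partial>modes n)"
  proof (rule summable_comparison_test_ev)
    show "\<forall>\<^sub>F n in sequentially. norm (\<integral>z. (cmod (\<psi> n z + \<phi> n z))\<^sup>2 \<partial>modes n)
            \<le> 2 * (\<integral>z. (cmod (\<psi> n z))\<^sup>2 \<partial>modes n) + 2 * (\<integral>z. (cmod (\<phi> n z))\<^sup>2 \<partial>modes n)"
    proof (rule always_eventually, rule allI)
      fix n
      have "(\<integral>z. (cmod (\<psi> n z + \<phi> n z))\<^sup>2 \<partial>modes n)
          \<le> (\<integral>z. 2 * (cmod (\<psi> n z))\<^sup>2 + 2 * (cmod (\<phi> n z))\<^sup>2 \<partial>modes n)"
        by (rule integral_mono)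
           (use sq[of n] sq_integrable_add[OF sq[of n]] norm_add_sq_le in \<open>auto simp: sq_integrable_def\<close>)
      also have "\<dots> = 2 * (\<integral>z. (cmod (\<psi> n z))\<^sup>2 \<partial>modes n) + 2 * (\<integral>z. (cmod (\<phi> n z))\<^sup>2 \<partial>modes n)"
        using sq[of n] by (simp add: sq_integrable_def)
      finally show "norm (\<integral>z. (cmod (\<psi> n z + \<phi> n z))\<^sup>2 \<partial>modes n)
            \<le> 2 * (\<integral>z. (cmod (\<psi> n z))\<^sup>2 \<partial>modes n) + 2 * (\<integral>z. (cmod (\<phi> n z))\<^sup>2 \<partial>modes n)"
        by simp
    qed
    show "summable (\<lambda>n. 2 * (\<integral>z. (cmod (\<psi> n z))\<^sup>2 \<partial>modes n) + 2 * (\<integral>z. (cmod (\<phi> n z))\<^sup>2 \<partial>modes n))"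
      using assms by (intro summable_add summable_mult) (auto simp: fock_fun_def)
  qed
  moreover have "symmetric_fun n (\<lambda>z. \<psi> n z + \<phi> n z)" for n
    unfolding symmetric_fun_def
  proof (intro allI impI)
    fix \<pi> assume "\<pi> permutes {..<n}"
    then have "AE z in modes n. \<psi> n (z \<circ> \<pi>) = \<psi> n z" "AE z in modes n. \<phi> n (z \<circ> \<pi>) = \<phi> n z"
      using assms by (auto simp: fock_fun_def symmetric_fun_def)
    then show "AE z in modes n. \<psi> n (z \<circ> \<pi>) + \<phi> n (z \<circ> \<pi>) = \<psi> n z + \<phi> n z"
      by eventually_elim simp
  qed
  moreover have "transversal_fun n (\<lambda>z. \<psi> n z + \<phi> n z)" for n
    unfolding transversal_fun_def
  proof (intro allI impI)
    fix i assume "i < n"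
    then have "AE z in modes n. (\<Sum>j\<in>UNIV. of_real (fst (z i) $ j) * \<psi> n (z(i := (fst (z i), j)))) = 0"
      "AE z in modes n. (\<Sum>j\<in>UNIV. of_real (fst (z i) $ j) * \<phi> n (z(i := (fst (z i), j)))) = 0"
      using assms by (auto simp: fock_fun_def transversal_fun_def)
    then show "AE z in modes n. (\<Sum>j\<in>UNIV. of_real (fst (z i) $ j) *
        (\<psi> n (z(i := (fst (z i), j))) + \<phi> n (z(i := (fst (z i), j))))) = 0"
      by eventually_elim (simp add: distrib_left sum.distrib)
  qed
  ultimately show ?thesis
    using sq by (simp add: fock_fun_def sq_integrable_add)
qed

lemma fock_fun_scale:
  assumes "fock_fun \<psi>"
  shows "fock_fun (\<lambda>n z. c * \<psi> n z)"
proof -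
  have "symmetric_fun n (\<lambda>z. c * \<psi> n z)" for n
    unfolding symmetric_fun_def
  proof (intro allI impI)
    fix \<pi> assume "\<pi> permutes {..<n}"
    then have "AE z in modes n. \<psi> n (z \<circ> \<pi>) = \<psi> n z"
      using assms by (auto simp: fock_fun_def symmetric_fun_def)
    then show "AE z in modes n. c * \<psi> n (z \<circ> \<pi>) = c * \<psi> n z"
      by eventually_elim simp
  qed
  moreover have "transversal_fun n (\<lambda>z. c * \<psi> n z)" for n
    unfolding transversal_fun_def
  proof (intro allI impI)
    fix i assume "i < n"
    then have "AE z in modes n. (\<Sum>j\<in>UNIV. of_real (fst (z i) $ j) * \<psi> n (z(i := (fst (z i), j)))) = 0"
      using assms by (auto simp: fock_fun_def transversal_fun_def)
    then show "AE z in modes n. (\<Sum>j\<in>UNIV. of_real (fst (z i) $ j) *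
        (c * \<psi> n (z(i := (fst (z i), j))))) = 0"
    proof eventually_elim
      case (elim z)
      have "(\<Sum>j\<in>UNIV. of_real (fst (z i) $ j) * (c * \<psi> n (z(i := (fst (z i), j)))))
        = c * (\<Sum>j\<in>UNIV. of_real (fst (z i) $ j) * \<psi> n (z(i := (fst (z i), j))))"
        by (simp add: sum_distrib_left mult.left_commute)
      then show ?case using elim by simp
    qed
  qed
  ultimately show ?thesis
    using assms by (simp add: fock_fun_def sq_integrable_mult norm_mult power_mult_distrib summable_mult)
qed

lemma part_equivp_fock_rel: "part_equivp fock_rel"
proof (rule part_equivpI)
  show "\<exists>f. fock_rel f f" by (rule exI[of _ "\<lambda>n z. 0"]) (simp add: fock_rel_def fock_fun_zero)
  show "symp fock_rel" by (auto simp: symp_def fock_rel_def eq_commute)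
  show "transp fock_rel"
    unfolding transp_def fock_rel_def
    by (intro allI impI; elim conjE; intro conjI, assumption+)
       (rule allI, rule eventually_elim2, erule spec, erule spec, simp)
qed

quotient_type fock = fock_raw / partial: fock_rel
  by (rule part_equivp_fock_rel)

lemma fock_fun_rep: "fock_fun (rep_fock \<psi>)"
  using Quotient3_rep_reflp[OF Quotient3_fock, of \<psi>] by (simp add: fock_rel_def)

definition cinner_raw :: "fock_raw \<Rightarrow> fock_raw \<Rightarrow> complex" where
  "cinner_raw \<psi> \<phi> = (\<Sum>n. \<integral>z. \<psi> n z * cnj (\<phi> n z) \<partial>modes n)"

lemma cinner_raw_summable:
  assumes "fock_fun \<psi>" "fock_fun \<phi>"
  shows "summable (\<lambda>n. \<integral>z. \<psi> n z * cnj (\<phi> n z) \<partial>modes n)"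
proof (rule summable_comparison_test_ev)
  show "\<forall>\<^sub>F n in sequentially. cmod (\<integral>z. \<psi> n z * cnj (\<phi> n z) \<partial>modes n)
    \<le> (\<integral>z. (cmod (\<psi> n z))\<^sup>2 \<partial>modes n) + (\<integral>z. (cmod (\<phi> n z))\<^sup>2 \<partial>modes n)"
    using assms by (intro always_eventually allI sq_integrable_cprod(2)) (auto simp: fock_fun_def)
qed (use assms in \<open>auto simp: fock_fun_def intro: summable_add\<close>)

lemma cinner_raw_add:
  assumes "fock_fun \<psi>" "fock_fun \<phi>" "fock_fun \<eta>"
  shows "cinner_raw (\<lambda>n z. \<psi> n z + \<phi> n z) \<eta> = cinner_raw \<psi> \<eta> + cinner_raw \<phi> \<eta>"
proof -
  have "integrable (modes n) (\<lambda>z. \<psi> n z * cnj (\<eta> n z))"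
    "integrable (modes n) (\<lambda>z. \<phi> n z * cnj (\<eta> n z))" for n
    using assms by (auto simp: fock_fun_def intro!: sq_integrable_cprod(1))
  then show ?thesis
    unfolding cinner_raw_def
    by (simp add: distrib_right suminf_add[OF cinner_raw_summable cinner_raw_summable] assms)
qed

lemma cinner_raw_scale:
  assumes "fock_fun \<psi>" "fock_fun \<phi>"
  shows "cinner_raw (\<lambda>n z. c * \<psi> n z) \<phi> = c * cinner_raw \<psi> \<phi>"
  unfolding cinner_raw_def
  by (simp add: mult.assoc suminf_mult[OF cinner_raw_summable] assms)

lemma cinner_raw_commute:
  assumes "fock_fun \<psi>" "fock_fun \<phi>"
  shows "cinner_raw \<phi> \<psi> = cnj (cinner_raw \<psi> \<phi>)"
proof -
  have eq: "(\<integral>z. \<phi> n z * cnj (\<psi> n z) \<partial>modes n) = cnj (\<integral>z. \<psi> n z * cnj (\<phi> n z) \<partial>modes n)" for n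
    using Bochner_Integration.integral_cnj[of "modes n" "\<lambda>z. \<psi> n z * cnj (\<phi> n z)"]
    by (simp add: mult.commute del: Bochner_Integration.integral_cnj)
  have "(\<lambda>n. cnj (\<integral>z. \<psi> n z * cnj (\<phi> n z) \<partial>modes n)) sums cnj (cinner_raw \<psi> \<phi>)"
    unfolding sums_cnj cinner_raw_def using cinner_raw_summable[OF assms] by (rule summable_sums)
  then show ?thesis
    by (simp add: cinner_raw_def eq sums_iff)
qed

lemma cinner_raw_self:
  assumes "fock_fun \<psi>"
  shows "cinner_raw \<psi> \<psi> = of_real (\<Sum>n. \<integral>z. (cmod (\<psi> n z))\<^sup>2 \<partial>modes n)"
proof -
  have eq: "(\<integral>z. \<psi> n z * cnj (\<psi> n z) \<partial>modes n) = of_real (\<integral>z. (cmod (\<psi> n z))\<^sup>2 \<partial>modes n)" for n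
    unfolding integral_complex_of_real[symmetric] complex_norm_square ..
  show ?thesis
    unfolding cinner_raw_def eq using assms
    by (intro suminf_of_real[symmetric]) (simp add: fock_fun_def)
qed

lemma cinner_raw_cong:
  assumes "fock_rel \<psi> \<psi>'" "fock_rel \<phi> \<phi>'"
  shows "cinner_raw \<psi> \<phi> = cinner_raw \<psi>' \<phi>'"
proof -
  have "(\<integral>z. \<psi> n z * cnj (\<phi> n z) \<partial>modes n) = (\<integral>z. \<psi>' n z * cnj (\<phi>' n z) \<partial>modes n)" for n
  proof (rule integral_cong_AE)
    have "AE z in modes n. \<psi> n z = \<psi>' n z" "AE z in modes n. \<phi> n z = \<phi>' n z"
      using assms by (auto simp: fock_rel_def)
    then show "AE z in modes n. \<psi> n z * cnj (\<phi> n z) = \<psi>' n z * cnj (\<phi>' n z)"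
      by eventually_elim simp
    have [measurable]: "\<psi> n \<in> borel_measurable (modes n)" "\<psi>' n \<in> borel_measurable (modes n)"
      "\<phi> n \<in> borel_measurable (modes n)" "\<phi>' n \<in> borel_measurable (modes n)"
      using assms by (auto simp: fock_rel_def fock_fun_def sq_integrable_def)
    show "(\<lambda>z. \<psi> n z * cnj (\<phi> n z)) \<in> borel_measurable (modes n)"
      "(\<lambda>z. \<psi>' n z * cnj (\<phi>' n z)) \<in> borel_measurable (modes n)"
      by measurable
  qed
  then show ?thesis by (simp add: cinner_raw_def)
qed

lift_definition cinner :: "fock \<Rightarrow> fock \<Rightarrow> complex" is cinner_raw
  by (rule cinner_raw_cong)

lift_definition cscale :: "complex \<Rightarrow> fock \<Rightarrow> fock" is "\<lambda>c \<psi> n z. c * \<psi> n z"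
  unfolding fock_rel_def
  by (elim conjE, intro conjI allI fock_fun_scale, assumption+, rule AE_cong_unary, erule spec)

instantiation fock :: real_inner
begin

lift_definition zero_fock :: fock is "\<lambda>n z. 0"
  by (simp add: fock_rel_def fock_fun_zero)

lift_definition plus_fock :: "fock \<Rightarrow> fock \<Rightarrow> fock" is "\<lambda>\<psi> \<phi> n z. \<psi> n z + \<phi> n z"
  unfolding fock_rel_def
  by (elim conjE, intro conjI allI fock_fun_add, assumption+, rule AE_cong_binary, (erule spec)+)

definition scaleR_fock :: "real \<Rightarrow> fock \<Rightarrow> fock" where "r *\<^sub>R (\<psi> :: fock) = cscale (of_real r) \<psi>"
definition uminus_fock :: "fock \<Rightarrow> fock" where "- (\<psi> :: fock) = cscale (-1) \<psi>"
definition minus_fock :: "fock \<Rightarrow> fock \<Rightarrow> fock" where "\<psi> - \<phi> = \<psi> + - (\<phi> :: fock)"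
definition inner_fock :: "fock \<Rightarrow> fock \<Rightarrow> real" where "\<psi> \<bullet> (\<phi> :: fock) = Re (cinner \<psi> \<phi>)"
definition norm_fock :: "fock \<Rightarrow> real" where "norm (\<psi> :: fock) = sqrt (\<psi> \<bullet> \<psi>)"
definition dist_fock :: "fock \<Rightarrow> fock \<Rightarrow> real" where "dist \<psi> (\<phi> :: fock) = norm (\<psi> - \<phi>)"
definition sgn_fock :: "fock \<Rightarrow> fock" where "sgn (\<psi> :: fock) = inverse (norm \<psi>) *\<^sub>R \<psi>"
definition uniformity_fock :: "(fock \<times> fock) filter" where
  "(uniformity :: (fock \<times> fock) filter) = (INF e\<in>{0<..}. principal {(x, y). dist x y < e})"
definition open_fock :: "fock set \<Rightarrow> bool" where
  "open (S :: fock set) \<longleftrightarrow> (\<forall>x\<in>S. \<forall>\<^sub>F (x', y) in uniformity. x' = x \<longrightarrow> y \<in> S)"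

instance
proof
  fix f g e :: fock and r s :: real
  show "f + g + e = f + (g + e)"
    by transfer (auto simp: fock_rel_def fock_fun_add add.assoc)
  show "f + g = g + f"
    by transfer (auto simp: fock_rel_def fock_fun_add add.commute)
  show "0 + f = f"
    by transfer (auto simp: fock_rel_def)
  show "- f + f = 0"
    unfolding uminus_fock_def
    by transfer (auto simp: fock_rel_def fock_fun_zero)
  show "f - g = f + - g" by (rule minus_fock_def)
  show "r *\<^sub>R (f + g) = r *\<^sub>R f + r *\<^sub>R g"
    unfolding scaleR_fock_def
    by transfer (auto simp: fock_rel_def distrib_left intro!: fock_fun_scale fock_fun_add)
  show "(r + s) *\<^sub>R f = r *\<^sub>R f + s *\<^sub>R f"
    unfolding scaleR_fock_def
    by transfer (auto simp: fock_rel_def distrib_right intro!: fock_fun_scale fock_fun_add)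
  show "r *\<^sub>R s *\<^sub>R f = (r * s) *\<^sub>R f"
    unfolding scaleR_fock_def
    by transfer (auto simp: fock_rel_def mult.assoc intro!: fock_fun_scale)
  show "1 *\<^sub>R f = f"
    unfolding scaleR_fock_def
    by transfer (auto simp: fock_rel_def)
  show "sgn f = inverse (norm f) *\<^sub>R f" by (rule sgn_fock_def)
  show "dist f g = norm (f - g)" by (rule dist_fock_def)
  show "f \<bullet> g = g \<bullet> f"
    unfolding inner_fock_def
    by transfer (metis cinner_raw_commute complex_cnj(1) complex.sel(1) complex.exhaust_sel fock_rel_def)
  show "(f + g) \<bullet> e = f \<bullet> e + g \<bullet> e"
    unfolding inner_fock_def by transfer (simp add: cinner_raw_add fock_rel_def)
  show "(r *\<^sub>R f) \<bullet> g = r * (f \<bullet> g)"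
    unfolding inner_fock_def scaleR_fock_def by transfer (simp add: cinner_raw_scale fock_rel_def)
  show "0 \<le> f \<bullet> f"
    unfolding inner_fock_def
    by transfer (auto simp: cinner_raw_self fock_rel_def fock_fun_def intro!: suminf_nonneg)
  show "(f \<bullet> f = 0) = (f = 0)"
    unfolding inner_fock_def
    by transfer (auto simp: cinner_raw_self fock_rel_def fock_fun_zero fock_fun_def
        sq_integrable_def suminf_eq_zero_iff integral_nonneg_eq_0_iff_AE)
  show "norm f = sqrt (f \<bullet> f)" by (rule norm_fock_def)
  show "uniformity = (INF e\<in>{0<..}. principal {(x::fock, y). dist x y < e})"
    by (rule uniformity_fock_def)
  show "open S = (\<forall>x\<in>S. \<forall>\<^sub>F (x', y) in uniformity. x' = x \<longrightarrow> y \<in> S)" for S :: "fock set"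
    by (rule open_fock_def)
qed

end

section \<open>Tensor powers and coherent states\<close>

text \<open>A pair \<open>(a, b)\<close> of elements of the real space stands for the element \<open>a + ib\<close> of its complexification.\<close>

definition wave :: "photon \<times> photon \<Rightarrow> (real^3) \<times> 3 \<Rightarrow> complex" where
  "wave f w = Complex (rep_photon (fst f) (fst w) $ snd w) (rep_photon (snd f) (fst w) $ snd w)"

lemma sigma_finite_mode_measure: "sigma_finite_measure mode_measure"
  unfolding mode_measure_def
  by (intro sigma_finite_pair_measure lborel.sigma_finite_measure_axioms
      sigma_finite_measure_count_space_finite) simp

lemma pair_sigma_finite_mode: "pair_sigma_finite lborel (count_space (UNIV :: 3 set))"
  by (intro pair_sigma_finite.intro lborel.sigma_finite_measure_axioms
      sigma_finite_measure_count_space_finite) simp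

lemma AE_mode_measure:
  assumes "AE k in lborel. P k"
  shows "AE w in mode_measure. P (fst w)"
proof -
  interpret pair_sigma_finite lborel "count_space (UNIV :: 3 set)"
    by (rule pair_sigma_finite_mode)
  obtain N where N: "{k \<in> space lborel. \<not> P k} \<subseteq> N" "emeasure lborel N = 0" "N \<in> sets lborel"
    using AE_E[OF assms] .
  have "emeasure mode_measure (N \<times> UNIV) = 0"
    using M2.emeasure_pair_measure_Times[of N lborel UNIV] N by (simp add: mode_measure_def)
  moreover have "N \<times> UNIV \<in> sets mode_measure"
    using N by (auto simp: mode_measure_def)
  moreover have "{w \<in> space mode_measure. \<not> P (fst w)} \<subseteq> N \<times> UNIV"
    using N(1) by auto
  ultimately show ?thesis by (intro AE_I)
qed

lemma AE_modes:
  assumes "AE w in mode_measure. P w" and i: "i < n"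
  shows "AE z in modes n. P (z i)"
proof -
  interpret product_sigma_finite "\<lambda>_::nat. mode_measure"
    by (simp add: product_sigma_finite_def sigma_finite_mode_measure)
  obtain N where N: "{w \<in> space mode_measure. \<not> P w} \<subseteq> N" "emeasure mode_measure N = 0"
      "N \<in> sets mode_measure"
    using AE_E[OF assms(1)] .
  let ?A = "\<lambda>j. if j = i then N else space mode_measure"
  have "emeasure (modes n) (Pi\<^sub>E {..<n} ?A) = (\<Prod>j<n. emeasure mode_measure (?A j))"
    unfolding modes_def by (rule emeasure_PiM) (use N in auto)
  also have "\<dots> = 0"
    using N i by (auto intro!: prod_zero)
  finally have "emeasure (modes n) (Pi\<^sub>E {..<n} ?A) = 0" .
  moreover have "Pi\<^sub>E {..<n} ?A \<in> sets (modes n)"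
    unfolding modes_def by (rule sets_PiM_I_finite) (use N in auto)
  moreover have "{z \<in> space (modes n). \<not> P (z i)} \<subseteq> Pi\<^sub>E {..<n} ?A"
  proof
    fix z assume z: "z \<in> {z \<in> space (modes n). \<not> P (z i)}"
    then have "z i \<in> N"
      using N(1) i by (auto simp: modes_def space_PiM PiE_iff)
    with z show "z \<in> Pi\<^sub>E {..<n} ?A"
      by (simp add: modes_def space_PiM PiE_iff)
  qed
  ultimately show ?thesis by (intro AE_I)
qed

lemma wave_measurable [measurable]: "wave f \<in> borel_measurable mode_measure"
proof -
  have m: "(\<lambda>w. rep_photon g (fst w) $ j) \<in> borel_measurable mode_measure" for g j
  proof -
    have "rep_photon g \<in> borel_measurable lborel"
      using photon_fun_rep[of g] by (simp add: photon_fun_def sq_integrable_def)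
    then have "(\<lambda>k. rep_photon g k $ j) \<in> borel_measurable lborel"
      by (rule measurable_compose) (auto intro!: borel_measurable_continuous_onI continuous_intros)
    then show ?thesis
      unfolding mode_measure_def by (rule measurable_compose[OF measurable_fst])
  qed
  have m': "(\<lambda>w. complex_of_real (rep_photon g (fst w) $ j)) \<in> borel_measurable mode_measure" for g j
    by (rule measurable_compose[OF m borel_measurable_continuous_onI]) (auto intro: continuous_intros)
  have p: "Measurable.pred mode_measure (\<lambda>w. snd w = j)" for j
    unfolding mode_measure_def by (rule measurable_compose[OF measurable_snd]) simp
  have eq: "wave f = (\<lambda>w. \<Sum>j\<in>UNIV. if snd w = j then
      of_real (rep_photon (fst f) (fst w) $ j) + \<i> * of_real (rep_photon (snd f) (fst w) $ j) else 0)"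
    by (auto simp: wave_def fun_eq_iff Complex_eq)
  show ?thesis
    unfolding eq
    by (intro borel_measurable_sum measurable_If borel_measurable_add borel_measurable_times
        m' borel_measurable_const p[unfolded pred_def])
qed

lemma wave_sq_integrable: "sq_integrable mode_measure (wave f)"
proof -
  interpret pair_sigma_finite lborel "count_space (UNIV :: 3 set)"
    by (rule pair_sigma_finite_mode)
  have i: "integrable lborel (\<lambda>k. (norm (rep_photon g k))\<^sup>2)" for g
    using photon_fun_rep[of g] by (simp add: photon_fun_def sq_integrable_def)
  have eq: "(\<Sum>j\<in>UNIV. (cmod (wave f (k, j)))\<^sup>2)
      = (norm (rep_photon (fst f) k))\<^sup>2 + (norm (rep_photon (snd f) k))\<^sup>2" for k
    unfolding power2_norm_eq_inner inner_vec_def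
    by (simp add: wave_def inner_complex_def sum.distrib)
  have "integrable mode_measure (\<lambda>w. (cmod (wave f w))\<^sup>2)"
    unfolding mode_measure_def
  proof (rule Fubini_integrable)
    show "(\<lambda>w. (cmod (wave f w))\<^sup>2) \<in> borel_measurable (lborel \<Otimes>\<^sub>M count_space UNIV)"
      using wave_measurable[of f] by (simp add: mode_measure_def)
    show "integrable lborel (\<lambda>k. \<integral>j. norm ((cmod (wave f (k, j)))\<^sup>2) \<partial>count_space UNIV)"
      using i[of "fst f"] i[of "snd f"] by (simp add: lebesgue_integral_count_space_finite eq)
    show "AE k in lborel. integrable (count_space UNIV) (\<lambda>j. (cmod (wave f (k, j)))\<^sup>2)"
      by (simp add: integrable_count_space)
  qed
  then show ?thesis by (simp add: sq_integrable_def)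
qed

lemma wave_transversal: "AE w in mode_measure. (\<Sum>j\<in>UNIV. of_real (fst w $ j) * wave f (fst w, j)) = 0"
proof -
  have "AE k in lborel. k \<bullet> rep_photon g k = 0" for g
    using photon_fun_rep[of g] by (simp add: photon_fun_def)
  then have "AE k in lborel. k \<bullet> rep_photon (fst f) k = 0 \<and> k \<bullet> rep_photon (snd f) k = 0"
    by auto
  from AE_mode_measure[OF this] show ?thesis
  proof eventually_elim
    case (elim w)
    have "(\<Sum>j\<in>UNIV. of_real (fst w $ j) * wave f (fst w, j))
      = Complex (fst w \<bullet> rep_photon (fst f) (fst w)) (fst w \<bullet> rep_photon (snd f) (fst w))"
      by (simp add: complex_eq_iff wave_def inner_vec_def)
    then show ?case using elim by (simp add: complex_eq_iff)
  qed
qed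

lemma fock_fun_tensor_power: "fock_fun (\<lambda>m z. if m = n then \<Prod>i<n. wave f (z i) else 0)"
proof -
  interpret product_sigma_finite "\<lambda>_::nat. mode_measure"
    by (simp add: product_sigma_finite_def sigma_finite_mode_measure)
  have "sq_integrable (modes n) (\<lambda>z. \<Prod>i<n. wave f (z i))"
    using product_integrable_prod[of "{..<n}" "\<lambda>_ w. (cmod (wave f w))\<^sup>2"] wave_sq_integrable[of f]
    by (auto simp: sq_integrable_def modes_def prod_power_distrib prod_norm[symmetric])
  moreover have "symmetric_fun n (\<lambda>z. \<Prod>i<n. wave f (z i))"
    unfolding symmetric_fun_def
  proof (intro allI impI always_eventually)
    fix \<pi> z assume "\<pi> permutes {..<n}"
    then show "(\<Prod>i<n. wave f ((z \<circ> \<pi>) i)) = (\<Prod>i<n. wave f (z i))"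
      using prod.permute[of \<pi> "{..<n}" "\<lambda>i. wave f (z i)"] by (simp add: o_def)
  qed
  moreover have "transversal_fun n (\<lambda>z. \<Prod>i<n. wave f (z i))"
    unfolding transversal_fun_def
  proof (intro allI impI)
    fix i assume i: "i < n"
    from AE_modes[OF wave_transversal[of f] i]
    show "AE z in modes n. (\<Sum>j\<in>UNIV. of_real (fst (z i) $ j) *
        (\<Prod>l<n. wave f ((z(i := (fst (z i), j))) l))) = 0"
    proof eventually_elim
      case (elim z)
      have "(\<Prod>l<n. wave f ((z(i := (fst (z i), j))) l))
          = wave f (fst (z i), j) * (\<Prod>l\<in>{..<n} - {i}. wave f (z l))" for j
        using i by (subst prod.remove[of _ i]) (auto intro!: prod.cong)
      then have "(\<Sum>j\<in>UNIV. of_real (fst (z i) $ j) * (\<Prod>l<n. wave f ((z(i := (fst (z i), j))) l)))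
          = (\<Sum>j\<in>UNIV. of_real (fst (z i) $ j) * wave f (fst (z i), j)) * (\<Prod>l\<in>{..<n} - {i}. wave f (z l))"
        by (simp add: sum_distrib_right mult.assoc)
      then show ?case using elim by simp
    qed
  qed
  moreover have "summable (\<lambda>m. \<integral>z. (cmod (if m = n then \<Prod>i<n. wave f (z i) else 0))\<^sup>2 \<partial>modes m)"
    by (rule summable_finite[of "{n}"]) auto
  moreover have "sq_integrable (modes m) (\<lambda>z. 0 :: complex)" "symmetric_fun m (\<lambda>z. 0)"
    "transversal_fun m (\<lambda>z. 0)" for m
    by (simp_all add: sq_integrable_zero symmetric_fun_def transversal_fun_def)
  ultimately show ?thesis
    unfolding fock_fun_def
  proof (intro conjI allI)
    fix m
    show "sq_integrable (modes m) (\<lambda>z. if m = n then \<Prod>i<n. wave f (z i) else 0)"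
      "symmetric_fun m (\<lambda>z. if m = n then \<Prod>i<n. wave f (z i) else 0)"
      "transversal_fun m (\<lambda>z. if m = n then \<Prod>i<n. wave f (z i) else 0)"
      using \<open>sq_integrable (modes n) (\<lambda>z. \<Prod>i<n. wave f (z i))\<close>
        \<open>symmetric_fun n (\<lambda>z. \<Prod>i<n. wave f (z i))\<close>
        \<open>transversal_fun n (\<lambda>z. \<Prod>i<n. wave f (z i))\<close>
        sq_integrable_zero[of "modes m"] \<open>symmetric_fun m (\<lambda>z. 0)\<close> \<open>transversal_fun m (\<lambda>z. 0)\<close>
      by (cases "m = n"; simp)+
  qed
qed

lift_definition tensor_power :: "nat \<Rightarrow> photon \<times> photon \<Rightarrow> fock"
  is "\<lambda>n f m z. if m = n then \<Prod>i<n. wave f (z i) else 0"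
  unfolding fock_rel_def by (intro conjI fock_fun_tensor_power) simp

definition coherent :: "real \<Rightarrow> photon \<times> photon \<Rightarrow> fock" where
  "coherent h f = (\<Sum>n. (exp (- ((norm (fst f))\<^sup>2 + (norm (snd f))\<^sup>2) / (4 * h))
      / ((2 * h) powr (real n / 2) * sqrt (fact n))) *\<^sub>R tensor_power n f)"

section \<open>Unbounded operators\<close>

text \<open>
  Operators are represented by their graphs, so that \<^term>\<open>Domain A\<close> is the domain of \<open>A\<close> and
  sums have the intersection of the domains of the summands as domain.
\<close>

definition op_plus :: "('a \<times> 'a::plus) set \<Rightarrow> ('a \<times> 'a) set \<Rightarrow> ('a \<times> 'a) set" where
  "op_plus A B = {(u, v + w) |u v w. (u, v) \<in> A \<and> (u, w) \<in> B}"

definition op_scale :: "real \<Rightarrow> ('a \<times> 'a::real_vector) set \<Rightarrow> ('a \<times> 'a) set" where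
  "op_scale c A = {(u, c *\<^sub>R v) |u v. (u, v) \<in> A}"

definition op_sum :: "('i::finite \<Rightarrow> ('a \<times> 'a::comm_monoid_add) set) \<Rightarrow> ('a \<times> 'a) set" where
  "op_sum A = {(u, \<Sum>i\<in>UNIV. v i) |u v. \<forall>i. (u, v i) \<in> A i}"

definition op_apply :: "('a \<times> 'a) set \<Rightarrow> 'a \<Rightarrow> 'a" where
  "op_apply A u = (THE v. (u, v) \<in> A)"

text \<open>The operator on the Fock space given by a formula \<open>T\<close> on wave functions, with its maximal domain.\<close>

definition fock_op :: "(fock_raw \<Rightarrow> fock_raw) \<Rightarrow> (fock \<times> fock) set" where
  "fock_op T = {(\<psi>, \<phi>). \<forall>n. AE z in modes n. rep_fock \<phi> n z = T (rep_fock \<psi>) n z}"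

text \<open>The second quantization of the operator of multiplication by \<open>m(k)\<close>.\<close>

definition dGamma :: "(real^3 \<Rightarrow> real) \<Rightarrow> (fock \<times> fock) set" where
  "dGamma m = fock_op (\<lambda>\<psi> n z. of_real (\<Sum>i<n. m (fst (z i))) * \<psi> n z)"

definition number_op :: "(fock \<times> fock) set" where
  "number_op = dGamma (\<lambda>k. 1)"

definition free_field :: "real \<Rightarrow> (fock \<times> fock) set" where
  "free_field h = op_scale h (dGamma (\<lambda>k. norm k))"

text \<open>
  On the \<open>n\<close>-photon sector, \<open>a\<^sup>*(f) = \<surd>n S\<^sub>n (f \<otimes> \<cdot>)\<close>, and \<open>a(f)\<close> contracts one variable with \<open>f\<close>,
  which is placed last; the position is immaterial by symmetry.
\<close>

definition creation_raw :: "photon \<times> photon \<Rightarrow> fock_raw \<Rightarrow> fock_raw" where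
  "creation_raw f \<psi> n z =
    (\<Sum>i<n. wave f (z i) * \<psi> (n - 1) (\<lambda>j. if j < i then z j else z (Suc j))) / of_real (sqrt (real n))"

definition annihilation_raw :: "photon \<times> photon \<Rightarrow> fock_raw \<Rightarrow> fock_raw" where
  "annihilation_raw f \<psi> n z =
    of_real (sqrt (real (n + 1))) * (\<integral>w. cnj (wave f w) * \<psi> (n + 1) (z(n := w)) \<partial>mode_measure)"

text \<open>
  The maximal operator defined by \<open>(a(f) + a\<^sup>*(f)) / \<surd>2\<close> is the adjoint of its restriction to the finite
  particle vectors; since that restriction is essentially self-adjoint, it is the self-adjoint Segal field.
\<close>

definition segal :: "photon \<times> photon \<Rightarrow> (fock \<times> fock) set" where
  "segal f = fock_op (\<lambda>\<psi> n z. (annihilation_raw f \<psi> n z + creation_raw f \<psi> n z) / of_real (sqrt 2))"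

section \<open>The magnetic field\<close>

definition schwartz :: "(real \<Rightarrow> real) \<Rightarrow> bool" where
  "schwartz f \<longleftrightarrow> (\<forall>n x. (deriv ^^ n) f field_differentiable (at x)) \<and>
    (\<forall>m n. bounded (range (\<lambda>x. x ^ m * (deriv ^^ n) f x)))"

text \<open>
  For a Schwartz function \<open>chi\<close> the arguments of \<^const>\<open>abs_photon\<close> are square integrable, and they are
  orthogonal to \<open>k\<close>.
\<close>

definition a_field :: "(real \<Rightarrow> real) \<Rightarrow> 3 \<Rightarrow> real^3 \<Rightarrow> photon" where
  "a_field chi m x = abs_photon (\<lambda>k. (chi (norm k) * norm k powr (1/2) / (2 * pi) powr (3/2) * sin (k \<bullet> x))
      *\<^sub>R (cross3 k (axis m 1) /\<^sub>R norm k))"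

definition b_field :: "(real \<Rightarrow> real) \<Rightarrow> 3 \<Rightarrow> real^3 \<Rightarrow> photon" where
  "b_field chi m x = abs_photon (\<lambda>k. (chi (norm k) * norm k powr (1/2) / (2 * pi) powr (3/2) * cos (k \<bullet> x))
      *\<^sub>R (cross3 k (axis m 1) /\<^sub>R norm k))"

definition B_classical :: "(real \<Rightarrow> real) \<Rightarrow> 3 \<Rightarrow> real^3 \<Rightarrow> photon \<Rightarrow> photon \<Rightarrow> real" where
  "B_classical chi m x q p = a_field chi m x \<bullet> q + b_field chi m x \<bullet> p"

definition B_quantum :: "real \<Rightarrow> (real \<Rightarrow> real) \<Rightarrow> 3 \<Rightarrow> real^3 \<Rightarrow> (fock \<times> fock) set" where
  "B_quantum h chi m x = op_scale (sqrt h) (segal (a_field chi m x, b_field chi m x))"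

section \<open>Spins\<close>

text \<open>
  The spins are indexed by a finite type \<open>'n\<close>, and the \<open>CARD('n)\<close>-fold tensor power of \<open>\<complex>\<^sup>2\<close> is given by
  its coordinates in the product basis, which is indexed by \<^typ>\<open>'n \<Rightarrow> 2\<close>. Accordingly, the tensor product
  of the Fock space with the spin space consists of families of Fock vectors indexed by \<^typ>\<open>'n \<Rightarrow> 2\<close>.
\<close>

type_synonym 'n spin = "complex ^ ('n \<Rightarrow> 2)"
type_synonym 'n spin_matrix = "complex ^ ('n \<Rightarrow> 2) ^ ('n \<Rightarrow> 2)"
type_synonym 'n state = "fock ^ ('n \<Rightarrow> 2)"

definition pauli :: "3 \<Rightarrow> complex ^ 2 ^ 2" where
  "pauli m = (if m = 1 then vector [vector [0, 1], vector [1, 0]]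
    else if m = 2 then vector [vector [0, - \<i>], vector [\<i>, 0]]
    else vector [vector [1, 0], vector [0, - 1]])"

definition sigma :: "'n::finite \<Rightarrow> 3 \<Rightarrow> 'n spin_matrix" where
  "sigma l m = (\<chi> s r. if \<forall>j. j \<noteq> l \<longrightarrow> s j = r j then pauli m $ s l $ r l else 0)"

definition product_state :: "fock \<Rightarrow> 'n::finite spin \<Rightarrow> 'n state" where
  "product_state \<psi> a = (\<chi> s. cscale (a $ s) \<psi>)"

definition cscale_state :: "complex \<Rightarrow> 'n::finite state \<Rightarrow> 'n state" where
  "cscale_state c \<Psi> = (\<chi> s. cscale c (\<Psi> $ s))"

definition cinner_state :: "'n::finite state \<Rightarrow> 'n state \<Rightarrow> complex" where
  "cinner_state \<Psi> \<Phi> = (\<Sum>s\<in>UNIV. cinner (\<Psi> $ s) (\<Phi> $ s))"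

definition op_tensor :: "(fock \<times> fock) set \<Rightarrow> 'n::finite spin_matrix \<Rightarrow> ('n state \<times> 'n state) set" where
  "op_tensor A S = {(\<Psi>, \<chi> s. \<Sum>r\<in>UNIV. cscale (S $ s $ r) (\<eta> $ r)) |\<Psi> \<eta>. \<forall>r. (\<Psi> $ r, \<eta> $ r) \<in> A}"

text \<open>
  Since \<open>chi\<close> vanishes near \<open>0\<close>, the fields are defined on the domain of the free Hamiltonian, which is
  therefore (tensored with the spin space) the domain of the sum below.
\<close>

definition hamiltonian ::
  "(real \<Rightarrow> real) \<Rightarrow> real^3 \<Rightarrow> ('n::finite \<Rightarrow> real^3) \<Rightarrow> real \<Rightarrow> ('n state \<times> 'n state) set" where
  "hamiltonian chi \<beta> x h = op_plus (op_tensor (free_field h) (mat 1))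
    (op_scale h (op_sum (\<lambda>l. op_sum (\<lambda>j.
      op_tensor (op_plus (op_scale (\<beta> $ j) Id) (B_quantum h chi j (x l))) (sigma l j)))))"

text \<open>
  \<open>U\<close> is the strongly continuous one-parameter unitary group \<open>t \<mapsto> e\<^bsup>-itA\<^esup>\<close>: its infinitesimal generator,
  including the domain, is \<open>-iA\<close>. (Surjectivity of each \<open>U t\<close> follows from the group law.)
\<close>

definition unitary_group :: "('n::finite state \<times> 'n state) set \<Rightarrow> (real \<Rightarrow> 'n state \<Rightarrow> 'n state) \<Rightarrow> bool" where
  "unitary_group A U \<longleftrightarrow>
    (\<forall>t \<Psi> \<Phi>. U t (\<Psi> + \<Phi>) = U t \<Psi> + U t \<Phi>) \<and>
    (\<forall>t c \<Psi>. U t (cscale_state c \<Psi>) = cscale_state c (U t \<Psi>)) \<and>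
    (\<forall>t \<Psi> \<Phi>. cinner_state (U t \<Psi>) (U t \<Phi>) = cinner_state \<Psi> \<Phi>) \<and>
    (\<forall>\<Psi>. U 0 \<Psi> = \<Psi>) \<and>
    (\<forall>s t \<Psi>. U (s + t) \<Psi> = U s (U t \<Psi>)) \<and>
    (\<forall>\<Psi>. continuous_on UNIV (\<lambda>t. U t \<Psi>)) \<and>
    (\<forall>\<Psi>. \<Psi> \<in> Domain A \<longleftrightarrow> (\<exists>\<Phi>. ((\<lambda>t. U t \<Psi>) has_vector_derivative \<Phi>) (at 0))) \<and>
    (\<forall>\<Psi> \<Phi>. (\<Psi>, \<Phi>) \<in> A \<longrightarrow> ((\<lambda>t. U t \<Psi>) has_vector_derivative cscale_state (- \<i>) \<Phi>) (at 0))"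

section \<open>The classical system\<close>

text \<open>The Lie algebra of the special unitary group of \<open>\<complex>\<^sup>d\<close>.\<close>

definition cadjoint :: "complex ^ 'd ^ 'd \<Rightarrow> complex ^ 'd ^ 'd" where
  "cadjoint A = (\<chi> i j. cnj (A $ j $ i))"

typedef (overloaded) ('d::finite) su = "{A :: complex ^ 'd ^ 'd. cadjoint A = - A \<and> trace A = 0}"
  morphisms matrix_of su_of
  by (rule exI[of _ 0]) (simp add: cadjoint_def trace_def vec_eq_iff)

setup_lifting type_definition_su

instantiation su :: (finite) real_normed_vector
begin

lift_definition zero_su :: "'a su" is 0
  by (simp add: cadjoint_def trace_def vec_eq_iff)

lift_definition plus_su :: "'a su \<Rightarrow> 'a su \<Rightarrow> 'a su" is "(+)"
  by (auto simp: cadjoint_def trace_def vec_eq_iff sum.distrib)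

lift_definition minus_su :: "'a su \<Rightarrow> 'a su \<Rightarrow> 'a su" is "(-)"
  by (auto simp: cadjoint_def trace_def vec_eq_iff sum_subtractf)

lift_definition uminus_su :: "'a su \<Rightarrow> 'a su" is uminus
  by (auto simp: cadjoint_def trace_def vec_eq_iff sum_negf)

lift_definition scaleR_su :: "real \<Rightarrow> 'a su \<Rightarrow> 'a su" is scaleR
  by (auto simp: cadjoint_def trace_def vec_eq_iff simp flip: scaleR_sum_right)

lift_definition norm_su :: "'a su \<Rightarrow> real" is norm .

lift_definition dist_su :: "'a su \<Rightarrow> 'a su \<Rightarrow> real" is dist .

definition sgn_su :: "'a su \<Rightarrow> 'a su" where "sgn (A :: 'a su) = inverse (norm A) *\<^sub>R A"
definition uniformity_su :: "('a su \<times> 'a su) filter" where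
  "(uniformity :: ('a su \<times> 'a su) filter) = (INF e\<in>{0<..}. principal {(x, y). dist x y < e})"
definition open_su :: "'a su set \<Rightarrow> bool" where
  "open (S :: 'a su set) \<longleftrightarrow> (\<forall>x\<in>S. \<forall>\<^sub>F (x', y) in uniformity. x' = x \<longrightarrow> y \<in> S)"

instance
proof
  fix A B C :: "'a su" and r s :: real
  show "A + B + C = A + (B + C)" by transfer (rule add.assoc)
  show "A + B = B + A" by transfer (rule add.commute)
  show "0 + A = A" by transfer simp
  show "- A + A = 0" by transfer simp
  show "A - B = A + - B" by transfer simp
  show "r *\<^sub>R (A + B) = r *\<^sub>R A + r *\<^sub>R B" by transfer (rule scaleR_add_right)
  show "(r + s) *\<^sub>R A = r *\<^sub>R A + s *\<^sub>R A" by transfer (rule scaleR_add_left)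
  show "r *\<^sub>R s *\<^sub>R A = (r * s) *\<^sub>R A" by transfer simp
  show "1 *\<^sub>R A = A" by transfer simp
  show "sgn A = inverse (norm A) *\<^sub>R A" by (rule sgn_su_def)
  show "dist A B = norm (A - B)" by transfer (rule dist_norm)
  show "(norm A = 0) = (A = 0)" by transfer simp
  show "norm (A + B) \<le> norm A + norm B" by transfer (rule norm_triangle_ineq)
  show "norm (r *\<^sub>R A) = \<bar>r\<bar> * norm A" by transfer simp
  show "uniformity = (INF e\<in>{0<..}. principal {(x::'a su, y). dist x y < e})"
    by (rule uniformity_su_def)
  show "open S = (\<forall>x\<in>S. \<forall>\<^sub>F (x', y) in uniformity. x' = x \<longrightarrow> y \<in> S)" for S :: "'a su set"
    by (rule open_su_def)
qed

end

lift_definition bracket :: "'d::finite su \<Rightarrow> 'd su \<Rightarrow> 'd su" is "\<lambda>A B. A ** B - B ** A"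
proof (intro conjI)
  fix A B :: "complex ^ 'd ^ 'd"
  assume "cadjoint A = - A \<and> trace A = 0" "cadjoint B = - B \<and> trace B = 0"
  then have "cnj (A $ j $ i) = - A $ i $ j" "cnj (B $ j $ i) = - B $ i $ j" for i j
    by (auto simp: cadjoint_def vec_eq_iff)
  then show "cadjoint (A ** B - B ** A) = - (A ** B - B ** A)"
    by (simp add: cadjoint_def vec_eq_iff matrix_matrix_mult_def cnj_sum mult.commute)
  show "trace (A ** B - B ** A) = 0"
    by (simp add: trace_sub trace_mul_sym[of A B])
qed

lemma pauli_hermitian: "cnj (pauli m $ b $ a) = pauli m $ a $ b"
  using exhaust_2[of a] exhaust_2[of b] by (auto simp: pauli_def)

lemma trace_sigma: "trace (sigma l m) = 0"
proof -
  define f :: "2 \<Rightarrow> 2" where "f b = (if b = 1 then 2 else 1)" for b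
  have ff: "f (f b) = b" for b
    using exhaust_2[of b] by (auto simp: f_def)
  have pf: "pauli m $ f b $ f b = - pauli m $ b $ b" for b
    using exhaust_2[of b] by (auto simp: f_def pauli_def)
  let ?S = "\<Sum>s\<in>UNIV. pauli m $ (s :: 'a \<Rightarrow> 2) l $ s l"
  have "?S = (\<Sum>s\<in>UNIV. pauli m $ f ((s :: 'a \<Rightarrow> 2) l) $ f (s l))"
    by (rule sum.reindex_bij_witness[of _ "\<lambda>s. s(l := f (s l))" "\<lambda>s. s(l := f (s l))"]) (auto simp: ff)
  also have "\<dots> = - ?S"
    by (simp add: pf sum_negf)
  finally show ?thesis
    by (simp add: trace_def sigma_def)
qed

lift_definition i_sigma :: "'n::finite \<Rightarrow> 3 \<Rightarrow> ('n \<Rightarrow> 2) su" is "\<lambda>l m. \<chi> s r. \<i> * sigma l m $ s $ r"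
proof (intro CollectI conjI)
  fix l :: 'n and m :: 3
  have "cnj (sigma l m $ r $ s) = sigma l m $ s $ r" for r s
    by (auto simp: sigma_def pauli_hermitian)
  then show "cadjoint (\<chi> s r. \<i> * sigma l m $ s $ r) = - (\<chi> s r. \<i> * sigma l m $ s $ r)"
    by (simp add: cadjoint_def vec_eq_iff)
  show "trace (\<chi> s r. \<i> * sigma l m $ s $ r) = 0"
    using trace_sigma[of l m] by (simp add: trace_def flip: sum_distrib_left)
qed

definition cdot :: "complex ^ 'd::finite \<Rightarrow> complex ^ 'd \<Rightarrow> complex" where
  "cdot u v = (\<Sum>s\<in>UNIV. u $ s * cnj (v $ s))"

text \<open>The quotient below is real because the matrix is anti-Hermitian.\<close>

lift_definition pi_functional :: "complex ^ 'd::finite \<Rightarrow> 'd su \<Rightarrow>\<^sub>L real"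
  is "\<lambda>a Y. Re (cdot (matrix_of Y *v a) a / \<i>)"
proof (rule bounded_linear_intro)
  fix a :: "complex ^ 'd" and X Y :: "'d su" and r :: real
  show "Re (cdot (matrix_of (X + Y) *v a) a / \<i>)
      = Re (cdot (matrix_of X *v a) a / \<i>) + Re (cdot (matrix_of Y *v a) a / \<i>)"
    by (simp add: plus_su.rep_eq matrix_vector_mult_add_rdistrib cdot_def distrib_right sum.distrib
        add_divide_distrib)
  show "Re (cdot (matrix_of (r *\<^sub>R X) *v a) a / \<i>) = r *\<^sub>R Re (cdot (matrix_of X *v a) a / \<i>)"
  proof -
    have "cdot (matrix_of (r *\<^sub>R X) *v a) a = r *\<^sub>R cdot (matrix_of X *v a) a"
      by (simp add: scaleR_su.rep_eq cdot_def matrix_vector_mult_def flip: scaleR_sum_right)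
    then show ?thesis by (simp add: complex_eq_iff)
  qed
  show "norm (Re (cdot (matrix_of X *v a) a / \<i>))
      \<le> norm X * (\<Sum>s\<in>(UNIV::'d set). \<Sum>t\<in>(UNIV::'d set). norm a * norm a)"
  proof -
    have "norm (Re (cdot (matrix_of X *v a) a / \<i>)) \<le> cmod (cdot (matrix_of X *v a) a)"
      using abs_Im_le_cmod[of "cdot (matrix_of X *v a) a"] by simp
    also have "\<dots> \<le> (\<Sum>s\<in>UNIV. \<Sum>t\<in>UNIV. cmod (matrix_of X $ s $ t * a $ t * cnj (a $ s)))"
      unfolding cdot_def matrix_vector_mult_def
      by (rule order_trans[OF norm_sum]) (auto simp: sum_distrib_right intro!: sum_mono order_trans[OF norm_sum])
    also have "\<dots> \<le> (\<Sum>s\<in>(UNIV::'d set). \<Sum>t\<in>(UNIV::'d set). norm X * (norm a * norm a))"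
    proof (intro sum_mono)
      fix s t :: 'd
      have "cmod (matrix_of X $ s $ t) \<le> norm (matrix_of X)"
        by (rule order_trans[OF Finite_Cartesian_Product.norm_nth_le Finite_Cartesian_Product.norm_nth_le])
      then show "cmod (matrix_of X $ s $ t * a $ t * cnj (a $ s)) \<le> norm X * (norm a * norm a)"
        by (simp add: norm_mult norm_su.rep_eq mult.assoc mult_mono Finite_Cartesian_Product.norm_nth_le)
    qed
    finally show ?thesis by (simp add: mult.left_commute mult.assoc)
  qed
qed

definition Q_source :: "(real \<Rightarrow> real) \<Rightarrow> ('n::finite \<Rightarrow> real^3) \<Rightarrow> real \<Rightarrow> (('n \<Rightarrow> 2) su \<Rightarrow>\<^sub>L real) \<Rightarrow> photon" where
  "Q_source chi x h \<omega> = h *\<^sub>R (\<Sum>l\<in>UNIV. \<Sum>m\<in>UNIV. blinfun_apply \<omega> (i_sigma l m) *\<^sub>R b_field chi m (x l))"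

definition P_source :: "(real \<Rightarrow> real) \<Rightarrow> ('n::finite \<Rightarrow> real^3) \<Rightarrow> real \<Rightarrow> (('n \<Rightarrow> 2) su \<Rightarrow>\<^sub>L real) \<Rightarrow> photon" where
  "P_source chi x h \<omega> = - (h *\<^sub>R (\<Sum>l\<in>UNIV. \<Sum>m\<in>UNIV. blinfun_apply \<omega> (i_sigma l m) *\<^sub>R a_field chi m (x l)))"

definition time_integral :: "(real \<Rightarrow> 'a::real_normed_vector) \<Rightarrow> real \<Rightarrow> 'a" where
  "time_integral f t = (if 0 \<le> t then integral {0..t} f else - integral {t..0} f)"

definition weak_solution ::
  "(real \<Rightarrow> real) \<Rightarrow> real^3 \<Rightarrow> ('n::finite \<Rightarrow> real^3) \<Rightarrow> real \<Rightarrow>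
   (real \<Rightarrow> photon) \<Rightarrow> (real \<Rightarrow> photon) \<Rightarrow> (real \<Rightarrow> (('n \<Rightarrow> 2) su \<Rightarrow>\<^sub>L real)) \<Rightarrow> bool" where
  "weak_solution chi \<beta> x h q p \<omega> \<longleftrightarrow>
    continuous_on UNIV (\<lambda>t. (q t, p t, \<omega> t)) \<and>
    (\<forall>t. (q t, p t) = free_flow t (q 0, p 0) +
      time_integral (\<lambda>s. free_flow (t - s) (Q_source chi x h (\<omega> s), P_source chi x h (\<omega> s))) t) \<and>
    (\<forall>t Y. blinfun_apply (\<omega> t) Y = blinfun_apply (\<omega> 0) Y +
      time_integral (\<lambda>s. \<Sum>l\<in>UNIV. \<Sum>m\<in>UNIV. (\<beta> $ m + B_classical chi m (x l) (q s) (p s)) *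
        blinfun_apply (\<omega> s) (bracket (i_sigma l m) Y)) t)"

end

theory Submission
  imports Defs
begin

text \<open>
  Both sides of the estimate stay within \<open>O(h)\<close> of \<open>|q\<^sub>0|\<^sup>2 + |p\<^sub>0|\<^sup>2\<close>, so that the two dynamics need not
  be compared. Classically, the free flow is isometric, the source terms carry a factor \<open>h\<close>, and \<open>\<omega>\<close>
  stays bounded because it moves on a coadjoint orbit. On the quantum side only the field terms fail to
  commute with \<open>N\<close>; their commutator with \<open>hN\<close> is bounded by a multiple of \<open>h(1 + hN)\<close> in rescaled time, and
  Gronwall's inequality applies. Truncated weights \<open>w(N)\<close> make this rigorous: the estimate
  is obtained for initial states in the domain of the Hamiltonian, extends to its closure, and passes to
  the limit of the truncation. A quadratic weight yields that the evolved state is in the domain of \<open>N\<close>.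
\<close>

section \<open>Measure theory of the mode variables\<close>

text \<open>The powers of \<open>h\<close> balance as follows. The field enters the Hamiltonian with
  \<open>h * sqrt h\<close>, and the evolution runs to time \<open>t / h\<close>, which absorbs the
  factor \<open>h\<close>. Passing from \<open>n\<close> to \<open>n + 1\<close> photons costs
  \<open>sqrt (n + 1)\<close>, while the weight \<open>1 + h n\<close> changes only by
  \<open>h\<close>; since \<open>sqrt (h (n + 1)) a b\<close> is at most
  \<open>a^2 + h (n + 1) b^2\<close>, the growth rate of this weight in rescaled time is of order
  \<open>h\<close>. Hence the mean of \<open>1 + h N\<close> moves by \<open>O(h)\<close>, upwards
  or downwards. It starts from an explicit value: the photon number of the coherent state is Poisson
  distributed with mean \<open>|X_0|^2 / (2 h)\<close>, so that \<open>2 h N\<close> starts at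
  exactly \<open>|X_0|^2\<close>. The obstacles are that \<open>N\<close> is unbounded and that a
  coherent state may lie outside the domain of the Hamiltonian, no decay in momentum being imposed
  on \<open>X_0\<close>. A weight that is constant beyond \<open>L\<close> is bounded, and
  subtracting its final value, a multiple of the identity, leaves a weight of finite support, so
  that every commutator is a finite sum.\<close>

lemma product_sigma_finite_mode: "product_sigma_finite (\<lambda>_::nat. mode_measure)"
  by (simp add: product_sigma_finite_def sigma_finite_mode_measure)

lemma measurable_modes_component [measurable]:
  "i < n \<Longrightarrow> (\<lambda>z. z i) \<in> measurable (modes n) mode_measure"
  unfolding modes_def by (rule measurable_component_singleton) auto

lemma measurable_permute_modes:
  assumes "\<pi> permutes {..<n}"
  shows "(\<lambda>z. z \<circ> \<pi>) \<in> measurable (modes n) (modes n)"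
proof -
  have "(\<lambda>z. \<lambda>i\<in>{..<n}. z (\<pi> i)) \<in> measurable (modes n) (modes n)"
    unfolding modes_def
    by (rule measurable_restrict, rule measurable_component_singleton)
       (use permutes_in_image[OF assms] in auto)
  moreover have "z \<circ> \<pi> = (\<lambda>i\<in>{..<n}. z (\<pi> i))" if "z \<in> space (modes n)" for z
    using that permutes_not_in[OF assms]
    by (auto simp: modes_def space_PiM fun_eq_iff PiE_def extensional_def)
  ultimately show ?thesis
    using measurable_cong[of "modes n" "\<lambda>z. z \<circ> \<pi>" "\<lambda>z. \<lambda>i\<in>{..<n}. z (\<pi> i)" "modes n"] by blast
qed

text \<open>Boxes determine the product measure, and the preimage of a box under composition with
  \<open>\<pi>\<close> is the box whose factors are permuted by \<open>inv \<pi>\<close>; the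
  product of the measures of its factors is the same.\<close>

lemma distr_permute_modes:
  assumes \<pi>: "\<pi> permutes {..<n}"
  shows "distr (modes n) (modes n) (\<lambda>z. z \<circ> \<pi>) = modes n"
proof -
  interpret product_sigma_finite "\<lambda>_::nat. mode_measure" by (rule product_sigma_finite_mode)
  have "distr (modes n) (modes n) (\<lambda>z. z \<circ> \<pi>) = Pi\<^sub>M {..<n} (\<lambda>_. mode_measure)"
  proof (rule PiM_eqI)
    fix A assume A: "\<And>i. i \<in> {..<n} \<Longrightarrow> A i \<in> sets mode_measure"
    let ?\<pi>' = "inv \<pi>"
    have inv: "?\<pi>' permutes {..<n}" using \<pi> by (rule permutes_inv)
    have sA: "Pi\<^sub>E {..<n} A \<in> sets (modes n)"
      unfolding modes_def by (rule sets_PiM_I_finite) (use A in auto)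
    have "(\<lambda>z. z \<circ> \<pi>) -` Pi\<^sub>E {..<n} A \<inter> space (modes n) = Pi\<^sub>E {..<n} (\<lambda>i. A (?\<pi>' i))"
    proof (intro set_eqI iffI)
      fix z assume z: "z \<in> (\<lambda>z. z \<circ> \<pi>) -` Pi\<^sub>E {..<n} A \<inter> space (modes n)"
      have "z i \<in> A (?\<pi>' i)" if "i < n" for i
      proof -
        have "?\<pi>' i \<in> {..<n}" using permutes_in_image[OF inv, of i] that by auto
        moreover have "z \<circ> \<pi> \<in> Pi\<^sub>E {..<n} A" using z by simp
        ultimately have "(z \<circ> \<pi>) (?\<pi>' i) \<in> A (?\<pi>' i)" by (rule PiE_mem[rotated])
        then show ?thesis by (simp add: permutes_inverses(1)[OF \<pi>])
      qed
      moreover have "z \<in> extensional {..<n}" using z by (auto simp: modes_def space_PiM PiE_def)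
      ultimately show "z \<in> Pi\<^sub>E {..<n} (\<lambda>i. A (?\<pi>' i))" by (auto simp: PiE_def)
    next
      fix z assume z: "z \<in> Pi\<^sub>E {..<n} (\<lambda>i. A (?\<pi>' i))"
      have "z i \<in> space mode_measure" if "i < n" for i
        using z that A[of "?\<pi>' i"] permutes_in_image[OF inv, of i] sets.sets_into_space by fastforce
      then have "z \<in> space (modes n)" using z by (auto simp: modes_def space_PiM PiE_def)
      moreover have "(z \<circ> \<pi>) i \<in> A i" if "i < n" for i
      proof -
        have "\<pi> i \<in> {..<n}" using permutes_in_image[OF \<pi>, of i] that by auto
        with z have "z (\<pi> i) \<in> A (?\<pi>' (\<pi> i))" by (rule PiE_mem)
        then show ?thesis by (simp add: permutes_inverses(2)[OF \<pi>])
      qed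
      moreover have "z \<circ> \<pi> \<in> extensional {..<n}"
        using z permutes_not_in[OF \<pi>] by (auto simp: PiE_def extensional_def)
      ultimately show "z \<in> (\<lambda>z. z \<circ> \<pi>) -` Pi\<^sub>E {..<n} A \<inter> space (modes n)" by (auto simp: PiE_def)
    qed
    then have "emeasure (distr (modes n) (modes n) (\<lambda>z. z \<circ> \<pi>)) (Pi\<^sub>E {..<n} A)
        = emeasure (modes n) (Pi\<^sub>E {..<n} (\<lambda>i. A (?\<pi>' i)))"
      by (simp add: emeasure_distr[OF measurable_permute_modes[OF \<pi>] sA])
    also have "\<dots> = (\<Prod>i<n. emeasure mode_measure (A (?\<pi>' i)))"
      unfolding modes_def
      by (rule emeasure_PiM) (use A permutes_in_image[OF inv] in auto)
    also have "\<dots> = (\<Prod>i<n. emeasure mode_measure (A i))"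
      using prod.permute[OF inv, of "\<lambda>i. emeasure mode_measure (A i)"] by (simp add: o_def)
    finally show "emeasure (distr (modes n) (modes n) (\<lambda>z. z \<circ> \<pi>)) (Pi\<^sub>E {..<n} A)
        = (\<Prod>i<n. emeasure mode_measure (A i))" .
  qed (simp_all add: modes_def)
  then show ?thesis by (simp only: modes_def)
qed

lemma AE_permute_modes:
  assumes "\<pi> permutes {..<n}" "AE z in modes n. P z"
  shows "AE z in modes n. P (z \<circ> \<pi>)"
  by (rule AE_distrD[OF measurable_permute_modes[OF assms(1)]])
     (subst distr_permute_modes[OF assms(1)], rule assms(2))

lemma integral_permute_modes:
  fixes F :: "(nat \<Rightarrow> (real^3) \<times> 3) \<Rightarrow> complex"
  assumes "\<pi> permutes {..<n}" "F \<in> borel_measurable (modes n)"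
  shows "(\<integral>z. F (z \<circ> \<pi>) \<partial>modes n) = (\<integral>z. F z \<partial>modes n)"
  using integral_distr[OF measurable_permute_modes[OF assms(1)] assms(2)]
  by (simp add: distr_permute_modes[OF assms(1)])

lemma integrable_permute_modes:
  fixes F :: "(nat \<Rightarrow> (real^3) \<times> 3) \<Rightarrow> 'b::{banach, second_countable_topology}"
  assumes "\<pi> permutes {..<n}" "integrable (modes n) F"
  shows "integrable (modes n) (\<lambda>z. F (z \<circ> \<pi>))"
  using integrable_distr_eq[OF measurable_permute_modes[OF assms(1)], of F] assms(2)
  by (simp add: distr_permute_modes[OF assms(1)] borel_measurable_integrable)

section \<open>Splitting off the last variable\<close>

lemma space_modes_upd:
  "z \<in> space (modes n) \<Longrightarrow> w \<in> space mode_measure \<Longrightarrow> z(n := w) \<in> space (modes (Suc n))"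
  by (auto simp: modes_def space_PiM PiE_iff extensional_def less_Suc_eq)

lemma measurable_modes_upd [measurable]:
  "(\<lambda>(z, w). z(n := w)) \<in> measurable (modes n \<Otimes>\<^sub>M mode_measure) (modes (Suc n))"
  unfolding modes_def lessThan_Suc by (rule measurable_add_dim)

lemma nn_integral_modes_Suc:
  assumes "F \<in> borel_measurable (modes (Suc n))"
  shows "(\<integral>\<^sup>+z. F z \<partial>modes (Suc n)) = (\<integral>\<^sup>+z. (\<integral>\<^sup>+w. F (z(n := w)) \<partial>mode_measure) \<partial>modes n)"
  using product_sigma_finite.product_nn_integral_insert[OF product_sigma_finite_mode, of "{..<n}" n F] assms
  by (simp add: modes_def lessThan_Suc)

lemma integral_modes_Suc:
  fixes F :: "(nat \<Rightarrow> (real^3) \<times> 3) \<Rightarrow> complex"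
  assumes "integrable (modes (Suc n)) F"
  shows "(\<integral>z. F z \<partial>modes (Suc n)) = (\<integral>z. (\<integral>w. F (z(n := w)) \<partial>mode_measure) \<partial>modes n)"
  using product_sigma_finite.product_integral_insert[OF product_sigma_finite_mode, of "{..<n}" n F] assms
  by (simp add: modes_def lessThan_Suc)

text \<open>Tonelli for the indicator of an exceptional null set. \<open>annihilation_raw\<close>
  integrates over single slices of a wave function, so a change of representative on a null set
  requires control of almost every slice.\<close>

lemma AE_modes_Suc:
  assumes "AE z in modes (Suc n). P z"
  shows "AE z in modes n. AE w in mode_measure. P (z(n := w))"
proof -
  interpret M: sigma_finite_measure mode_measure by (rule sigma_finite_mode_measure)
  obtain N where N: "{z \<in> space (modes (Suc n)). \<not> P z} \<subseteq> N" "emeasure (modes (Suc n)) N = 0"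
      "N \<in> sets (modes (Suc n))"
    using AE_E[OF assms] .
  note [measurable] = N(3)
  have "(\<lambda>(z, w). indicator N (z(n := w)) :: ennreal) \<in> borel_measurable (modes n \<Otimes>\<^sub>M mode_measure)"
    using measurable_compose[OF measurable_modes_upd borel_measurable_indicator[OF N(3)]]
    by (simp add: case_prod_beta')
  note m = this
  have "(\<integral>\<^sup>+z. (\<integral>\<^sup>+w. indicator N (z(n := w)) \<partial>mode_measure) \<partial>modes n) = 0"
    using nn_integral_modes_Suc[of "indicator N" n] N by simp
  then have "AE z in modes n. (\<integral>\<^sup>+w. indicator N (z(n := w)) \<partial>mode_measure) = 0"
    by (subst (asm) nn_integral_0_iff_AE)
       (use M.borel_measurable_nn_integral[OF m] in \<open>auto\<close>)
  with AE_space show ?thesis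
  proof eventually_elim
    case (elim z)
    have "(\<lambda>w. indicator N (z(n := w)) :: ennreal) \<in> borel_measurable mode_measure"
      using measurable_compose[OF measurable_Pair1' m, OF elim(1)] by simp
    then have "AE w in mode_measure. indicator N (z(n := w)) = (0::ennreal)"
      using elim(2) by (simp add: nn_integral_0_iff_AE)
    with AE_space show ?case
    proof eventually_elim
      case (elim w)
      then show ?case
        using N(1) space_modes_upd[OF \<open>z \<in> space (modes n)\<close> elim(1)] by (auto simp: indicator_def split: if_splits)
    qed
  qed
qed

section \<open>Deleting one variable\<close>

definition drop_var :: "nat \<Rightarrow> (nat \<Rightarrow> 'a) \<Rightarrow> nat \<Rightarrow> 'a" where
  "drop_var i z = (\<lambda>j. if j < i then z j else z (Suc j))"

text \<open>The cycle that moves variable \<open>i\<close> to the last place and keeps the others in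
  order. Through it every deletion reduces to the deletion of the last variable, and every summand
  of a creation operator to the one that adds a last variable.\<close>

definition shift_perm :: "nat \<Rightarrow> nat \<Rightarrow> nat \<Rightarrow> nat" where
  "shift_perm i n j = (if j < i then j else if j < n then Suc j else if j = n then i else j)"

lemma shift_perm_permutes:
  assumes "i \<le> n"
  shows "shift_perm i n permutes {..<Suc n}"
proof (rule bij_imp_permutes)
  show "bij_betw (shift_perm i n) {..<Suc n} {..<Suc n}"
  proof (rule bij_betwI[where g = "\<lambda>j. if j < i then j else if j = i then n else j - 1"])
  qed (use assms in \<open>auto simp: shift_perm_def split: if_splits\<close>)
qed (auto simp: shift_perm_def assms)

lemma drop_var_shift_perm: "i \<le> n \<Longrightarrow> drop_var n (z \<circ> shift_perm i n) = drop_var i z"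
  by (auto simp: drop_var_def shift_perm_def fun_eq_iff)

lemma shift_perm_last: "i \<le> n \<Longrightarrow> (z \<circ> shift_perm i n) n = z i"
  by (auto simp: shift_perm_def)

lemma measurable_drop_last: "drop_var n \<in> measurable (modes (Suc n)) (modes n)"
proof -
  have "(\<lambda>z. \<lambda>i\<in>{..<n}. z i) \<in> measurable (modes (Suc n)) (modes n)"
    unfolding modes_def
    by (rule measurable_restrict, rule measurable_component_singleton) auto
  moreover have "drop_var n z = (\<lambda>i\<in>{..<n}. z i)" if "z \<in> space (modes (Suc n))" for z
    using that
    by (auto simp: modes_def space_PiM fun_eq_iff PiE_def extensional_def drop_var_def)
  ultimately show ?thesis
    using measurable_cong[of "modes (Suc n)" "drop_var n" "\<lambda>z. \<lambda>i\<in>{..<n}. z i" "modes n"] by blast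
qed

lemma measurable_drop_var:
  assumes "i \<le> n"
  shows "drop_var i \<in> measurable (modes (Suc n)) (modes n)"
  using measurable_compose[OF measurable_permute_modes[OF shift_perm_permutes[OF assms]] measurable_drop_last]
  by (simp add: drop_var_shift_perm[OF assms])

lemma drop_last_upd: "z \<in> space (modes n) \<Longrightarrow> drop_var n (z(n := w)) = z"
  by (auto simp: drop_var_def fun_eq_iff modes_def space_PiM PiE_def extensional_def)

text \<open>For the last variable the preimage of a null set is a cylinder over it; its measure is
  \<open>0\<close> times the infinite mass of the deleted variable, which is \<open>0\<close> in
  \<open>ennreal\<close>. The other variables follow through \<open>shift_perm\<close>.\<close>

lemma AE_drop_var:
  assumes "AE z in modes n. P z" and i: "i \<le> n"
  shows "AE z in modes (Suc n). P (drop_var i z)"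
proof -
  obtain N where N: "{z \<in> space (modes n). \<not> P z} \<subseteq> N" "emeasure (modes n) N = 0" "N \<in> sets (modes n)"
    using AE_E[OF assms(1)] .
  let ?N = "drop_var n -` N \<inter> space (modes (Suc n))"
  have sN: "?N \<in> sets (modes (Suc n))"
    using measurable_drop_last N(3) by (rule measurable_sets)
  have "emeasure (modes (Suc n)) ?N = (\<integral>\<^sup>+z. (\<integral>\<^sup>+w. indicator ?N (z(n := w)) \<partial>mode_measure) \<partial>modes n)"
    using nn_integral_modes_Suc[of "indicator ?N" n] sN by simp
  also have "\<dots> = (\<integral>\<^sup>+z. indicator N z * emeasure mode_measure (space mode_measure) \<partial>modes n)"
  proof (rule nn_integral_cong)
    fix z assume z: "z \<in> space (modes n)"
    have "(\<integral>\<^sup>+w. indicator ?N (z(n := w)) \<partial>mode_measure) = (\<integral>\<^sup>+w. indicator N z \<partial>mode_measure)"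
      by (rule nn_integral_cong) (use z drop_last_upd[OF z] space_modes_upd[OF z] in \<open>auto simp: indicator_def\<close>)
    then show "(\<integral>\<^sup>+w. indicator ?N (z(n := w)) \<partial>mode_measure)
        = indicator N z * emeasure mode_measure (space mode_measure)" by simp
  qed
  also have "\<dots> = 0"
    using N by (simp add: nn_integral_multc)
  finally have "AE z in modes (Suc n). P (drop_var n z)"
    by (rule AE_I[OF _ _ sN, rotated])
       (use N(1) measurable_space[OF measurable_drop_last] in auto)
  from AE_permute_modes[OF shift_perm_permutes[OF i] this] show ?thesis
    by (simp add: drop_var_shift_perm[OF i])
qed

lemma integral_Cauchy_Schwarz:
  assumes f: "sq_integrable M (f :: _ \<Rightarrow> complex)" and g: "sq_integrable M g"
  shows "cmod (\<integral>x. f x * cnj (g x) \<partial>M) \<le> sqrt (\<integral>x. (cmod (f x))\<^sup>2 \<partial>M) * sqrt (\<integral>x. (cmod (g x))\<^sup>2 \<partial>M)"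
proof -
  let ?A = "\<integral>x. (cmod (f x))\<^sup>2 \<partial>M" and ?B = "\<integral>x. (cmod (g x))\<^sup>2 \<partial>M"
  have i: "integrable M (\<lambda>x. (cmod (f x))\<^sup>2)" "integrable M (\<lambda>x. (cmod (g x))\<^sup>2)"
    using f g by (auto simp: sq_integrable_def)
  have nn: "0 \<le> ?A" "0 \<le> ?B" by simp_all
  show ?thesis
  proof (cases "?A = 0 \<or> ?B = 0")
    case True
    then have "AE x in M. f x * cnj (g x) = 0"
      using i by (auto simp: integral_nonneg_eq_0_iff_AE)
    then have "(\<integral>x. f x * cnj (g x) \<partial>M) = 0"
      by (rule integral_eq_zero_AE)
    then show ?thesis using nn by simp
  next
    case False
    define a b where "a = sqrt ?A" and "b = sqrt ?B"
    have ab: "0 < a" "0 < b" "a\<^sup>2 = ?A" "b\<^sup>2 = ?B" using False nn by (auto simp: a_def b_def less_le)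
    have "cmod (\<integral>x. f x * cnj (g x) \<partial>M) \<le> (\<integral>x. cmod (f x * cnj (g x)) \<partial>M)"
      by (rule integral_norm_bound)
    \<comment> \<open>Young's inequality with the ratio of the two norms as parameter: each of the
      two terms then integrates to \<open>a * b / 2\<close>.\<close>
    also have "\<dots> \<le> (\<integral>x. (b / (2 * a)) * (cmod (f x))\<^sup>2 + (a / (2 * b)) * (cmod (g x))\<^sup>2 \<partial>M)"
    proof (rule integral_mono)
      show "integrable M (\<lambda>x. cmod (f x * cnj (g x)))"
        using sq_integrable_cprod(1)[OF f g] by (rule integrable_norm)
      fix x
      have "0 \<le> (b * cmod (f x) - a * cmod (g x))\<^sup>2" by simp
      then have "2 * a * b * (cmod (f x) * cmod (g x)) \<le> b\<^sup>2 * (cmod (f x))\<^sup>2 + a\<^sup>2 * (cmod (g x))\<^sup>2"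
        by (simp add: power2_diff power_mult_distrib mult_ac)
      then show "cmod (f x * cnj (g x)) \<le> (b / (2 * a)) * (cmod (f x))\<^sup>2 + (a / (2 * b)) * (cmod (g x))\<^sup>2"
        using ab(1,2) by (simp add: norm_mult field_simps power2_eq_square)
    qed (use i in auto)
    also have "\<dots> = (b / (2 * a)) * a\<^sup>2 + (a / (2 * b)) * b\<^sup>2"
      using i ab by simp
    also have "\<dots> = a * b" using ab(1,2) by (simp add: field_simps power2_eq_square)
    finally show ?thesis by (simp add: a_def b_def)
  qed
qed

section \<open>Sectors of the Fock space and the adjointness of creation and annihilation\<close>

lemma inner_photon_rep: "f \<bullet> g = (\<integral>k. rep_photon f k \<bullet> rep_photon g k \<partial>lborel)"
  by (simp add: inner_photon_def)

lemma integral_wave_norm: "(\<integral>w. (cmod (wave f w))\<^sup>2 \<partial>mode_measure) = (norm f)\<^sup>2"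
proof -
  interpret pair_sigma_finite lborel "count_space (UNIV :: 3 set)"
    by (rule pair_sigma_finite_mode)
  have i: "integrable lborel (\<lambda>k. rep_photon g k \<bullet> rep_photon g k)" for g
    using photon_fun_rep[of g] by (simp add: photon_fun_def sq_integrable_def power2_norm_eq_inner)
  have eq: "(\<Sum>j\<in>UNIV. (cmod (wave f (k, j)))\<^sup>2)
      = rep_photon (fst f) k \<bullet> rep_photon (fst f) k + rep_photon (snd f) k \<bullet> rep_photon (snd f) k" for k
    unfolding power2_norm_eq_inner inner_vec_def
    by (simp add: wave_def inner_complex_def sum.distrib)
  have "(\<integral>w. (cmod (wave f w))\<^sup>2 \<partial>mode_measure)
      = (\<integral>k. (\<integral>j. (cmod (wave f (k, j)))\<^sup>2 \<partial>count_space UNIV) \<partial>lborel)"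
    using integral_fst'[of "\<lambda>w. (cmod (wave f w))\<^sup>2"] wave_sq_integrable[of f]
    by (simp add: mode_measure_def sq_integrable_def)
  also have "\<dots> = fst f \<bullet> fst f + snd f \<bullet> snd f"
    using i[of "fst f"] i[of "snd f"] by (simp add: lebesgue_integral_count_space_finite eq inner_photon_rep)
  finally show ?thesis by (simp add: norm_prod_def power2_norm_eq_inner)
qed

text \<open>The unsymmetrised tensor product of \<open>A\<close> with one further factor. Tonelli
  for nonnegative integrals gives the value of the norm and the integrability at once.\<close>

lemma sq_integrable_append:
  assumes g: "sq_integrable mode_measure (g :: _ \<Rightarrow> complex)" and A: "sq_integrable (modes n) A"
  shows "sq_integrable (modes (Suc n)) (\<lambda>z. g (z n) * A (drop_var n z))"
    and "(\<integral>z. (cmod (g (z n) * A (drop_var n z)))\<^sup>2 \<partial>modes (Suc n))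
      = (\<integral>w. (cmod (g w))\<^sup>2 \<partial>mode_measure) * (\<integral>z. (cmod (A z))\<^sup>2 \<partial>modes n)"
proof -
  have m: "(\<lambda>z. g (z n)) \<in> borel_measurable (modes (Suc n))"
    "(\<lambda>z. A (drop_var n z)) \<in> borel_measurable (modes (Suc n))"
    using g A measurable_compose[OF measurable_modes_component[of n "Suc n"]]
      measurable_compose[OF measurable_drop_last] by (auto simp: sq_integrable_def)
  have [measurable]: "g \<in> borel_measurable mode_measure" "A \<in> borel_measurable (modes n)"
    using g A by (auto simp: sq_integrable_def)
  define a b where "a = (\<integral>w. (cmod (g w))\<^sup>2 \<partial>mode_measure)" and "b = (\<integral>z. (cmod (A z))\<^sup>2 \<partial>modes n)"
  have ab: "0 \<le> a" "0 \<le> b" by (simp_all add: a_def b_def)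
  have a: "(\<integral>\<^sup>+w. ennreal ((cmod (g w))\<^sup>2) \<partial>mode_measure) = ennreal a"
    unfolding a_def using g by (intro nn_integral_eq_integral) (auto simp: sq_integrable_def)
  have b: "(\<integral>\<^sup>+z. ennreal ((cmod (A z))\<^sup>2) \<partial>modes n) = ennreal b"
    unfolding b_def using A by (intro nn_integral_eq_integral) (auto simp: sq_integrable_def)
  have "(\<integral>\<^sup>+z. ennreal ((cmod (g (z n) * A (drop_var n z)))\<^sup>2) \<partial>modes (Suc n))
    = (\<integral>\<^sup>+z. (\<integral>\<^sup>+w. ennreal ((cmod (g w * A (drop_var n (z(n := w)))))\<^sup>2) \<partial>mode_measure) \<partial>modes n)"
    by (subst nn_integral_modes_Suc) (use m in auto)
  also have "\<dots> = (\<integral>\<^sup>+z. ennreal a * ennreal ((cmod (A z))\<^sup>2) \<partial>modes n)"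
  proof (rule nn_integral_cong)
    fix z assume "z \<in> space (modes n)"
    then show "(\<integral>\<^sup>+w. ennreal ((cmod (g w * A (drop_var n (z(n := w)))))\<^sup>2) \<partial>mode_measure)
        = ennreal a * ennreal ((cmod (A z))\<^sup>2)"
      by (simp add: drop_last_upd norm_mult power_mult_distrib ennreal_mult nn_integral_multc a)
  qed
  also have "\<dots> = ennreal (a * b)"
    using ab by (simp add: nn_integral_cmult b ennreal_mult)
  finally have "has_bochner_integral (modes (Suc n)) (\<lambda>z. (cmod (g (z n) * A (drop_var n z)))\<^sup>2) (a * b)"
    by (intro has_bochner_integral_nn_integral) (use m ab in auto)
  then show "sq_integrable (modes (Suc n)) (\<lambda>z. g (z n) * A (drop_var n z))"
    "(\<integral>z. (cmod (g (z n) * A (drop_var n z)))\<^sup>2 \<partial>modes (Suc n))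
      = (\<integral>w. (cmod (g w))\<^sup>2 \<partial>mode_measure) * (\<integral>z. (cmod (A z))\<^sup>2 \<partial>modes n)"
    using m by (auto simp: sq_integrable_def has_bochner_integral_iff a_def b_def)
qed

lemma creation_raw_Suc:
  "creation_raw f \<psi> (Suc n) z =
    (\<Sum>i<Suc n. wave f (z i) * \<psi> n (drop_var i z)) / of_real (sqrt (real (Suc n)))"
  by (simp add: creation_raw_def drop_var_def)

text \<open>Against a symmetric \<open>\<phi> (Suc n)\<close> all \<open>n + 1\<close> summands of
  the creation operator contribute the same integral \<open>?J\<close>; with the normalisation they
  add up to \<open>sqrt (n + 1) * ?J\<close>. Integrating over the last variable first turns
  \<open>?J\<close> into the annihilation side. The bound is Cauchy-Schwarz for \<open>?J\<close>:
  it controls the form before the annihilated function is known to be square integrable.\<close>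

lemma creation_annihilation_adjoint:
  assumes \<psi>: "sq_integrable (modes n) (\<psi> n)" and \<phi>: "sq_integrable (modes (Suc n)) (\<phi> (Suc n))"
    and sym: "symmetric_fun (Suc n) (\<phi> (Suc n))"
  shows "(\<integral>z. creation_raw f \<psi> (Suc n) z * cnj (\<phi> (Suc n) z) \<partial>modes (Suc n))
      = cnj (\<integral>z. annihilation_raw f \<phi> n z * cnj (\<psi> n z) \<partial>modes n)" (is "?L = ?R")
    and "cmod (\<integral>z. annihilation_raw f \<phi> n z * cnj (\<psi> n z) \<partial>modes n)
      \<le> sqrt (Suc n) * norm f * sqrt (\<integral>z. (cmod (\<psi> n z))\<^sup>2 \<partial>modes n)
        * sqrt (\<integral>z. (cmod (\<phi> (Suc n) z))\<^sup>2 \<partial>modes (Suc n))"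
proof -
  let ?T = "\<lambda>z. wave f (z n) * \<psi> n (drop_var n z)"
  have T: "sq_integrable (modes (Suc n)) ?T"
    and Tn: "(\<integral>z. (cmod (?T z))\<^sup>2 \<partial>modes (Suc n)) = (norm f)\<^sup>2 * (\<integral>z. (cmod (\<psi> n z))\<^sup>2 \<partial>modes n)"
    using sq_integrable_append[OF wave_sq_integrable[of f] \<psi>] by (simp_all add: integral_wave_norm)
  let ?J = "\<integral>z. ?T z * cnj (\<phi> (Suc n) z) \<partial>modes (Suc n)"
  have Ti: "integrable (modes (Suc n)) (\<lambda>z. ?T z * cnj (\<phi> (Suc n) z))"
    by (rule sq_integrable_cprod(1)[OF T \<phi>])
  have trm: "integrable (modes (Suc n)) (\<lambda>z. wave f (z i) * \<psi> n (drop_var i z) * cnj (\<phi> (Suc n) z))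
      \<and> (\<integral>z. wave f (z i) * \<psi> n (drop_var i z) * cnj (\<phi> (Suc n) z) \<partial>modes (Suc n)) = ?J"
    if i: "i < Suc n" for i
  proof -
    have i': "i \<le> n" using i by simp
    let ?\<pi> = "shift_perm i n"
    note p = shift_perm_permutes[OF i']
    have "AE z in modes (Suc n). \<phi> (Suc n) (z \<circ> ?\<pi>) = \<phi> (Suc n) z"
      using sym p by (simp add: symmetric_fun_def)
    then have ae: "AE z in modes (Suc n). ?T (z \<circ> ?\<pi>) * cnj (\<phi> (Suc n) (z \<circ> ?\<pi>))
        = wave f (z i) * \<psi> n (drop_var i z) * cnj (\<phi> (Suc n) z)"
      by eventually_elim (simp only: shift_perm_last[OF i'] drop_var_shift_perm[OF i'])
    have m: "(\<lambda>z. wave f (z i) * \<psi> n (drop_var i z) * cnj (\<phi> (Suc n) z)) \<in> borel_measurable (modes (Suc n))"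
    proof (intro borel_measurable_times borel_measurable_cnj)
      show "(\<lambda>z. wave f (z i)) \<in> borel_measurable (modes (Suc n))"
        by (rule measurable_compose[OF measurable_modes_component[OF i] wave_measurable])
      show "(\<lambda>z. \<psi> n (drop_var i z)) \<in> borel_measurable (modes (Suc n))"
        using \<psi> by (intro measurable_compose[OF measurable_drop_var[OF i']]) (simp add: sq_integrable_def)
      show "\<phi> (Suc n) \<in> borel_measurable (modes (Suc n))"
        using \<phi> by (simp add: sq_integrable_def)
    qed
    have int: "integrable (modes (Suc n)) (\<lambda>z. ?T (z \<circ> ?\<pi>) * cnj (\<phi> (Suc n) (z \<circ> ?\<pi>)))"
      using integrable_permute_modes[OF p Ti] .
    show ?thesis
    proof
      show "integrable (modes (Suc n)) (\<lambda>z. wave f (z i) * \<psi> n (drop_var i z) * cnj (\<phi> (Suc n) z))"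
        by (rule integrable_cong_AE_imp[OF int m]) (use ae in \<open>eventually_elim, simp\<close>)
      have "(\<integral>z. wave f (z i) * \<psi> n (drop_var i z) * cnj (\<phi> (Suc n) z) \<partial>modes (Suc n))
         = (\<integral>z. ?T (z \<circ> ?\<pi>) * cnj (\<phi> (Suc n) (z \<circ> ?\<pi>)) \<partial>modes (Suc n))"
        by (rule integral_cong_AE[OF m borel_measurable_integrable[OF int]]) (use ae in \<open>eventually_elim, simp\<close>)
      also have "\<dots> = ?J"
        by (rule integral_permute_modes[OF p borel_measurable_integrable[OF Ti]])
      finally show "(\<integral>z. wave f (z i) * \<psi> n (drop_var i z) * cnj (\<phi> (Suc n) z) \<partial>modes (Suc n)) = ?J" .
    qed
  qed
  let ?s = "complex_of_real (sqrt (real (Suc n)))"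
  have s: "?s * ?s = of_nat (Suc n)" "?s \<noteq> 0"
    by (simp_all flip: of_real_mult)
  have "?L = (\<integral>z. (\<Sum>i<Suc n. wave f (z i) * \<psi> n (drop_var i z) * cnj (\<phi> (Suc n) z)) / ?s \<partial>modes (Suc n))"
    by (simp only: creation_raw_Suc sum_distrib_right times_divide_eq_left)
  also have "\<dots> = (\<Sum>i<Suc n. (\<integral>z. wave f (z i) * \<psi> n (drop_var i z) * cnj (\<phi> (Suc n) z) \<partial>modes (Suc n))) / ?s"
    by (subst Bochner_Integration.integral_divide_zero, subst Bochner_Integration.integral_sum)
       (use trm[THEN conjunct1] in auto)
  also have "(\<Sum>i<Suc n. (\<integral>z. wave f (z i) * \<psi> n (drop_var i z) * cnj (\<phi> (Suc n) z) \<partial>modes (Suc n)))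
      = (\<Sum>i<Suc n. ?J)"
    by (rule sum.cong[OF refl]) (use trm in \<open>blast\<close>)
  also have "\<dots> = of_nat (Suc n) * ?J"
    by (simp del: sum.lessThan_Suc)
  also have "of_nat (Suc n) * ?J / ?s = ?s * ?J"
    unfolding s(1)[symmetric] using s(2) by simp
  finally have L: "?L = ?s * ?J" .
  have "?J = (\<integral>z. (\<integral>w. wave f w * \<psi> n z * cnj (\<phi> (Suc n) (z(n := w))) \<partial>mode_measure) \<partial>modes n)"
    by (subst integral_modes_Suc[OF Ti]) (auto intro!: Bochner_Integration.integral_cong simp: drop_last_upd)
  also have "\<dots> = (\<integral>z. cnj ((\<integral>w. cnj (wave f w) * \<phi> (Suc n) (z(n := w)) \<partial>mode_measure) * cnj (\<psi> n z)) \<partial>modes n)"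
  proof (rule Bochner_Integration.integral_cong[OF refl])
    fix z
    have "(\<integral>w. wave f w * \<psi> n z * cnj (\<phi> (Suc n) (z(n := w))) \<partial>mode_measure)
        = (\<integral>w. cnj (cnj (wave f w) * \<phi> (Suc n) (z(n := w))) * \<psi> n z \<partial>mode_measure)"
      by (simp add: mult_ac)
    also have "\<dots> = cnj (\<integral>w. cnj (wave f w) * \<phi> (Suc n) (z(n := w)) \<partial>mode_measure) * \<psi> n z"
      by (simp only: Bochner_Integration.integral_cnj Bochner_Integration.integral_mult_left_zero)
    finally show "(\<integral>w. wave f w * \<psi> n z * cnj (\<phi> (Suc n) (z(n := w))) \<partial>mode_measure)
       = cnj ((\<integral>w. cnj (wave f w) * \<phi> (Suc n) (z(n := w)) \<partial>mode_measure) * cnj (\<psi> n z))" by simp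
  qed
  also have "\<dots> = cnj (\<integral>z. (\<integral>w. cnj (wave f w) * \<phi> (Suc n) (z(n := w)) \<partial>mode_measure) * cnj (\<psi> n z) \<partial>modes n)"
    by (rule Bochner_Integration.integral_cnj)
  also have "?s * \<dots> = ?R"
    by (simp only: annihilation_raw_def mult.assoc
        Bochner_Integration.integral_mult_right_zero complex_cnj_mult complex_cnj_complex_of_real Suc_eq_plus1)
  finally have R: "?s * ?J = ?R" .
  show "?L = ?R" using L R by simp
  have "cmod ?R = sqrt (Suc n) * cmod ?J"
    unfolding R[symmetric] norm_mult by simp
  also have "\<dots> \<le> sqrt (Suc n) * (sqrt ((norm f)\<^sup>2 * (\<integral>z. (cmod (\<psi> n z))\<^sup>2 \<partial>modes n))
       * sqrt (\<integral>z. (cmod (\<phi> (Suc n) z))\<^sup>2 \<partial>modes (Suc n)))"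
    using integral_Cauchy_Schwarz[OF T \<phi>] unfolding Tn by (intro mult_left_mono) auto
  finally show "cmod (\<integral>z. annihilation_raw f \<phi> n z * cnj (\<psi> n z) \<partial>modes n)
      \<le> sqrt (Suc n) * norm f * sqrt (\<integral>z. (cmod (\<psi> n z))\<^sup>2 \<partial>modes n)
        * sqrt (\<integral>z. (cmod (\<phi> (Suc n) z))\<^sup>2 \<partial>modes (Suc n))"
    by (simp add: real_sqrt_mult mult.assoc)
qed

section \<open>Representatives of Fock vectors and the complex inner product\<close>

lemma fock_rel_rep_abs: "fock_fun r \<Longrightarrow> fock_rel (rep_fock (abs_fock r)) r"
  using Quotient3_rep_abs[OF Quotient3_fock] by (simp add: fock_rel_def)

lemma AE_rep_abs: "fock_fun r \<Longrightarrow> AE z in modes n. rep_fock (abs_fock r) n z = r n z"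
  using fock_rel_rep_abs by (auto simp: fock_rel_def)

lemma AE_rep_add: "AE z in modes n. rep_fock (\<psi> + \<phi>) n z = rep_fock \<psi> n z + rep_fock \<phi> n z"
  unfolding plus_fock_def by (auto intro!: AE_rep_abs fock_fun_add fock_fun_rep)

lemma AE_rep_cscale: "AE z in modes n. rep_fock (cscale c \<psi>) n z = c * rep_fock \<psi> n z"
  unfolding cscale_def by (auto intro!: AE_rep_abs fock_fun_scale fock_fun_rep)

lemma fock_eqI:
  assumes "\<And>n. AE z in modes n. rep_fock \<psi> n z = rep_fock \<phi> n z"
  shows "\<psi> = \<phi>"
  using Quotient3_rel_rep[OF Quotient3_fock, of \<psi> \<phi>] assms by (simp add: fock_rel_def fock_fun_rep)

definition sector :: "nat \<Rightarrow> fock \<Rightarrow> fock \<Rightarrow> complex" where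
  "sector n \<psi> \<phi> = (\<integral>z. rep_fock \<psi> n z * cnj (rep_fock \<phi> n z) \<partial>modes n)"

definition sector_sq :: "nat \<Rightarrow> fock \<Rightarrow> real" where
  "sector_sq n \<psi> = (\<integral>z. (cmod (rep_fock \<psi> n z))\<^sup>2 \<partial>modes n)"

lemma cinner_sums: "(\<lambda>n. sector n \<psi> \<phi>) sums cinner \<psi> \<phi>"
  using summable_sums[OF cinner_raw_summable[OF fock_fun_rep[of \<psi>] fock_fun_rep[of \<phi>]]]
  by (simp add: cinner_def cinner_raw_def sector_def)

lemma sector_self: "sector n \<psi> \<psi> = of_real (sector_sq n \<psi>)"
  unfolding sector_def sector_sq_def integral_complex_of_real[symmetric] complex_norm_square ..

lemma sector_sq_nonneg [simp]: "0 \<le> sector_sq n \<psi>"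
  by (simp add: sector_sq_def)

lemma norm_fock_sums: "(\<lambda>n. sector_sq n \<psi>) sums (norm \<psi>)\<^sup>2"
  using sums_Re[OF cinner_sums[of \<psi> \<psi>]]
  by (simp add: sector_self power2_norm_eq_inner inner_fock_def)

lemma rep_fock_measurable [measurable]: "rep_fock \<psi> n \<in> borel_measurable (modes n)"
  using fock_fun_rep[of \<psi>] by (auto simp: fock_fun_def sq_integrable_def)

lemma rep_fock_sq_integrable: "sq_integrable (modes n) (rep_fock \<psi> n)"
  using fock_fun_rep[of \<psi>] by (auto simp: fock_fun_def)

lemma rep_fock_symmetric: "symmetric_fun n (rep_fock \<psi> n)"
  using fock_fun_rep[of \<psi>] by (auto simp: fock_fun_def)

lemma sector_commute: "sector n \<phi> \<psi> = cnj (sector n \<psi> \<phi>)"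
  using Bochner_Integration.integral_cnj[of "modes n" "\<lambda>z. rep_fock \<psi> n z * cnj (rep_fock \<phi> n z)"]
  by (simp add: sector_def mult.commute del: Bochner_Integration.integral_cnj)

lemma cinner_commute: "cinner \<phi> \<psi> = cnj (cinner \<psi> \<phi>)"
  using cinner_sums[of \<psi> \<phi>] cinner_sums[of \<phi> \<psi>]
  by (subst (asm) sums_cnj[symmetric]) (simp add: sector_commute[of _ \<phi> \<psi>] sums_unique2)

lemma cinner_add_left: "cinner (\<psi> + \<phi>) \<eta> = cinner \<psi> \<eta> + cinner \<phi> \<eta>"
  by transfer (simp add: cinner_raw_add fock_rel_def)

lemma cinner_scale_left: "cinner (cscale c \<psi>) \<eta> = c * cinner \<psi> \<eta>"
  by transfer (simp add: cinner_raw_scale fock_rel_def)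

lemma cinner_add_right: "cinner \<eta> (\<psi> + \<phi>) = cinner \<eta> \<psi> + cinner \<eta> \<phi>"
  by (metis cinner_add_left cinner_commute complex_cnj_add)

lemma cinner_scale_right: "cinner \<eta> (cscale c \<psi>) = cnj c * cinner \<eta> \<psi>"
  by (metis cinner_scale_left cinner_commute complex_cnj_mult)

lemma cinner_scaleR_right: "cinner \<eta> (r *\<^sub>R \<psi>) = of_real r * cinner \<eta> \<psi>"
  by (simp add: scaleR_fock_def cinner_scale_right)

lemma cinner_zero_right: "cinner \<eta> 0 = 0"
  using cinner_scaleR_right[of \<eta> 0 0] by simp

lemma cinner_sum_right: "cinner \<eta> (\<Sum>i\<in>I. f i) = (\<Sum>i\<in>I. cinner \<eta> (f i))"
  by (induction I rule: infinite_finite_induct) (simp_all add: cinner_zero_right cinner_add_right)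

lemma cscale_add: "cscale c (\<psi> + \<phi>) = cscale c \<psi> + cscale c \<phi>"
  by transfer (auto simp: fock_rel_def distrib_left intro!: fock_fun_scale fock_fun_add)

lemma cscale_cscale: "cscale c (cscale d \<psi>) = cscale (c * d) \<psi>"
  by transfer (auto simp: fock_rel_def mult.assoc intro!: fock_fun_scale)

lemma cscale_one [simp]: "cscale 1 \<psi> = \<psi>"
  by transfer (auto simp: fock_rel_def)

lemma cscale_scaleR: "cscale c (r *\<^sub>R \<psi>) = r *\<^sub>R cscale c \<psi>"
  by (simp add: scaleR_fock_def cscale_cscale mult.commute)

lemma norm_cscale: "norm (cscale c \<psi>) = cmod c * norm \<psi>"
proof -
  have "(norm (cscale c \<psi>))\<^sup>2 = Re (cnj c * (c * cinner \<psi> \<psi>))"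
    by (simp only: power2_norm_eq_inner inner_fock_def cinner_scale_left cinner_scale_right)
  also have "cnj c * (c * cinner \<psi> \<psi>) = of_real ((cmod c)\<^sup>2) * cinner \<psi> \<psi>"
    by (simp only: complex_norm_square mult.assoc mult.left_commute)
  also have "Re \<dots> = (cmod c)\<^sup>2 * (norm \<psi>)\<^sup>2"
    by (simp only: power2_norm_eq_inner inner_fock_def times_complex.sel Re_complex_of_real Im_complex_of_real mult_zero_left diff_zero)
  finally show ?thesis
    by (metis norm_ge_zero mult_nonneg_nonneg power2_eq_iff_nonneg power_mult_distrib)
qed

lemma bounded_linear_cscale: "bounded_linear (cscale c)"
  by (rule bounded_linear_intro[where K = "cmod c"]) (simp_all add: cscale_add cscale_scaleR norm_cscale mult.commute)

section \<open>Weights in the number of photons\<close>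

text \<open>Only a weighted moment has to be finite, so unbounded weights are covered as well;
  \<open>G = real\<close> yields the number operator on states with a finite second moment.\<close>

lemma fock_fun_weight:
  assumes "summable (\<lambda>n. (G n)\<^sup>2 * sector_sq n \<psi>)"
  shows "fock_fun (\<lambda>n z. of_real (G n) * rep_fock \<psi> n z)"
proof -
  have "fock_fun (rep_fock \<psi>)" by (rule fock_fun_rep)
  note f = fock_fun_scale[OF this]
  have "sq_integrable (modes n) (\<lambda>z. of_real (G n) * rep_fock \<psi> n z)"
    "symmetric_fun n (\<lambda>z. of_real (G n) * rep_fock \<psi> n z)"
    "transversal_fun n (\<lambda>z. of_real (G n) * rep_fock \<psi> n z)" for n
    using f[of "of_real (G n)"] by (auto simp: fock_fun_def)
  then show ?thesis
    using assms by (simp add: fock_fun_def norm_mult power_mult_distrib sector_sq_def)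
qed

text \<open>The function \<open>G\<close> of the number operator in the sense of the functional
  calculus. The value is meaningful when the weighted components are square summable, as they are
  for bounded \<open>G\<close>.\<close>

definition weight_op :: "(nat \<Rightarrow> real) \<Rightarrow> fock \<Rightarrow> fock" where
  "weight_op G \<psi> = abs_fock (\<lambda>n z. of_real (G n) * rep_fock \<psi> n z)"

lemma summable_weight:
  assumes "\<And>n. \<bar>G n\<bar> \<le> B"
  shows "summable (\<lambda>n. (G n)\<^sup>2 * sector_sq n \<psi>)"
proof (rule summable_comparison_test)
  have "(G n)\<^sup>2 \<le> B\<^sup>2" for n
    using assms[of n] by (metis abs_ge_zero abs_of_nonneg abs_le_square_iff order_trans)
  then show "\<exists>N. \<forall>n\<ge>N. norm ((G n)\<^sup>2 * sector_sq n \<psi>) \<le> B\<^sup>2 * sector_sq n \<psi>"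
    by (auto intro!: mult_right_mono)
  show "summable (\<lambda>n. B\<^sup>2 * sector_sq n \<psi>)"
    using norm_fock_sums[of \<psi>] by (intro summable_mult) (simp add: sums_iff)
qed

locale bounded_weight =
  fixes G :: "nat \<Rightarrow> real" and B :: real
  assumes bounded: "\<bar>G n\<bar> \<le> B"
begin

lemma AE_rep_weight: "AE z in modes n. rep_fock (weight_op G \<psi>) n z = of_real (G n) * rep_fock \<psi> n z"
  unfolding weight_op_def by (rule AE_rep_abs[OF fock_fun_weight[OF summable_weight[OF bounded]]])

lemma sector_weight: "sector n (weight_op G \<psi>) \<phi> = of_real (G n) * sector n \<psi> \<phi>"
proof -
  have "sector n (weight_op G \<psi>) \<phi>
      = (\<integral>z. of_real (G n) * (rep_fock \<psi> n z * cnj (rep_fock \<phi> n z)) \<partial>modes n)"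
    unfolding sector_def
    by (rule integral_cong_AE) (use AE_rep_weight[of \<psi> n] in \<open>auto simp: mult.assoc elim!: eventually_mono\<close>)
  then show ?thesis by (simp add: sector_def)
qed

lemma cinner_weight_sums: "(\<lambda>n. of_real (G n) * sector n \<psi> \<phi>) sums cinner (weight_op G \<psi>) \<phi>"
  using cinner_sums[of "weight_op G \<psi>" \<phi>] by (simp add: sector_weight)

lemma inner_weight_self_sums: "(\<lambda>n. G n * sector_sq n \<psi>) sums (weight_op G \<psi> \<bullet> \<psi>)"
  using sums_Re[OF cinner_weight_sums[of \<psi> \<psi>]] by (simp add: sector_self inner_fock_def)

lemma cinner_weight_commute: "cinner (weight_op G \<psi>) \<phi> = cnj (cinner (weight_op G \<phi>) \<psi>)"
proof -
  have "(\<lambda>n. cnj (of_real (G n) * sector n \<phi> \<psi>)) sums cnj (cinner (weight_op G \<phi>) \<psi>)"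
    unfolding sums_cnj by (rule cinner_weight_sums)
  moreover have "(\<lambda>n. cnj (of_real (G n) * sector n \<phi> \<psi>)) = (\<lambda>n. of_real (G n) * sector n \<psi> \<phi>)"
    by (simp add: sector_commute[of _ \<phi> \<psi>])
  ultimately show ?thesis
    using cinner_weight_sums[of \<psi> \<phi>] sums_unique2 by metis
qed

lemma inner_weight_commute: "weight_op G \<psi> \<bullet> \<phi> = weight_op G \<phi> \<bullet> \<psi>"
  using cinner_weight_commute[of \<psi> \<phi>] by (simp add: inner_fock_def)

lemma weight_op_add: "weight_op G (\<psi> + \<phi>) = weight_op G \<psi> + weight_op G \<phi>"
proof (rule fock_eqI)
  fix n
  show "AE z in modes n. rep_fock (weight_op G (\<psi> + \<phi>)) n z = rep_fock (weight_op G \<psi> + weight_op G \<phi>) n z"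
    using AE_rep_weight[of "\<psi> + \<phi>" n] AE_rep_weight[of \<psi> n] AE_rep_weight[of \<phi> n]
      AE_rep_add[of \<psi> \<phi> n] AE_rep_add[of "weight_op G \<psi>" "weight_op G \<phi>" n]
    by eventually_elim (simp add: distrib_left)
qed

lemma weight_op_cscale: "weight_op G (cscale c \<psi>) = cscale c (weight_op G \<psi>)"
proof (rule fock_eqI)
  fix n
  show "AE z in modes n. rep_fock (weight_op G (cscale c \<psi>)) n z = rep_fock (cscale c (weight_op G \<psi>)) n z"
    using AE_rep_weight[of "cscale c \<psi>" n] AE_rep_weight[of \<psi> n]
      AE_rep_cscale[of c \<psi> n] AE_rep_cscale[of c "weight_op G \<psi>" n]
    by eventually_elim simp
qed

lemma norm_weight_op: "norm (weight_op G \<psi>) \<le> B * norm \<psi>"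
proof -
  have B: "0 \<le> B" using bounded[of 0] by linarith
  have 1: "sector_sq n (weight_op G \<psi>) = (G n)\<^sup>2 * sector_sq n \<psi>" for n
  proof -
    have cm: "sector n \<psi> (weight_op G \<psi>) = cnj (sector n (weight_op G \<psi>) \<psi>)"
      by (rule sector_commute)
    have "of_real (sector_sq n (weight_op G \<psi>)) = of_real (G n) * cnj (sector n (weight_op G \<psi>) \<psi>)"
      by (simp only: sector_self[symmetric] sector_weight[of n \<psi> "weight_op G \<psi>"] cm)
    also have "\<dots> = of_real ((G n)\<^sup>2 * sector_sq n \<psi>)"
      by (simp add: sector_weight sector_self power2_eq_square)
    finally show ?thesis by (simp only: of_real_eq_iff)
  qed
  have "(norm (weight_op G \<psi>))\<^sup>2 \<le> B\<^sup>2 * (norm \<psi>)\<^sup>2"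
  proof (rule sums_le)
    show "(\<lambda>n. (G n)\<^sup>2 * sector_sq n \<psi>) sums (norm (weight_op G \<psi>))\<^sup>2"
      using norm_fock_sums[of "weight_op G \<psi>"] by (simp add: 1)
    show "(\<lambda>n. B\<^sup>2 * sector_sq n \<psi>) sums (B\<^sup>2 * (norm \<psi>)\<^sup>2)"
      by (rule sums_mult[OF norm_fock_sums])
    show "(G n)\<^sup>2 * sector_sq n \<psi> \<le> B\<^sup>2 * sector_sq n \<psi>" for n
      using bounded[of n] B by (intro mult_right_mono) (auto simp: abs_le_square_iff[symmetric])
  qed
  then show ?thesis
    using B by (metis mult_nonneg_nonneg norm_ge_zero power2_le_imp_le power_mult_distrib)
qed

lemma bounded_linear_weight_op: "bounded_linear (weight_op G)"
  by (rule bounded_linear_intro[where K = B])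
     (simp_all add: weight_op_add weight_op_cscale scaleR_fock_def norm_weight_op mult.commute[of _ B])

end

section \<open>Matrix elements of the field between neighbouring sectors\<close>

lemma sq_integrable_creation:
  assumes "sq_integrable (modes (n - 1)) (\<psi> (n - 1))"
  shows "sq_integrable (modes n) (creation_raw f \<psi> n)"
proof (cases n)
  case 0
  then have "creation_raw f \<psi> n = (\<lambda>z. 0)" by (simp add: creation_raw_def fun_eq_iff)
  then show ?thesis by (simp add: sq_integrable_zero)
next
  case (Suc m)
  let ?T = "\<lambda>z. wave f (z m) * \<psi> m (drop_var m z)"
  have T: "sq_integrable (modes (Suc m)) ?T"
    using sq_integrable_append(1)[OF wave_sq_integrable[of f]] assms Suc by simp
  have *: "sq_integrable (modes (Suc m)) (\<lambda>z. wave f (z i) * \<psi> m (drop_var i z))" if "i \<le> m" for i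
  proof -
    note p = shift_perm_permutes[OF that]
    have "sq_integrable (modes (Suc m)) (\<lambda>z. ?T (z \<circ> shift_perm i m))"
      using T integrable_permute_modes[OF p, of "\<lambda>z. (cmod (?T z))\<^sup>2"]
        measurable_compose[OF measurable_permute_modes[OF p], of ?T]
      unfolding sq_integrable_def by blast
    then show ?thesis by (simp only: shift_perm_last[OF that] drop_var_shift_perm[OF that])
  qed
  have "sq_integrable (modes (Suc m)) (\<lambda>z. \<Sum>i\<in>I. wave f (z i) * \<psi> m (drop_var i z))"
    if "finite I" "I \<subseteq> {..m}" for I :: "nat set"
    using that
    by (induction I rule: finite_induct) (simp_all add: sq_integrable_zero sq_integrable_add *)
  from this[of "{..<Suc m}"]
  have "sq_integrable (modes (Suc m)) (\<lambda>z. \<Sum>i<Suc m. wave f (z i) * \<psi> m (drop_var i z))"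
    by (simp only: lessThan_Suc_atMost finite_atMost subset_refl True_implies_equals)
  from sq_integrable_mult[OF this, of "1 / of_real (sqrt (Suc m))"]
  show ?thesis unfolding Suc by (simp add: creation_raw_Suc[abs_def] del: sum.lessThan_Suc)
qed

lemma measurable_annihilation:
  assumes "\<psi> (Suc n) \<in> borel_measurable (modes (Suc n))"
  shows "annihilation_raw f \<psi> n \<in> borel_measurable (modes n)"
proof -
  interpret M: sigma_finite_measure mode_measure by (rule sigma_finite_mode_measure)
  have "(\<lambda>p. cnj (wave f (snd p)) * \<psi> (Suc n) ((fst p)(n := snd p))) \<in> borel_measurable (modes n \<Otimes>\<^sub>M mode_measure)"
    by (intro borel_measurable_times borel_measurable_cnj measurable_compose[OF measurable_snd wave_measurable])
       (use measurable_compose[OF measurable_modes_upd assms] in \<open>simp add: case_prod_beta'\<close>)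
  from M.borel_measurable_lebesgue_integral[of "\<lambda>z w. cnj (wave f w) * \<psi> (Suc n) (z(n := w))"] this
  have "(\<lambda>z. \<integral>w. cnj (wave f w) * \<psi> (Suc n) (z(n := w)) \<partial>mode_measure) \<in> borel_measurable (modes n)"
    by (simp add: case_prod_beta')
  then show ?thesis
    unfolding annihilation_raw_def[abs_def] by simp
qed

text \<open>The annihilation operator stands in the second, antilinear slot because the fields do so
  in the pairings to be estimated. By \<open>creation_lowering\<close> the creation part is the
  conjugate of the same quantity with exchanged arguments, so that one bound serves both.\<close>

definition lowering :: "photon \<times> photon \<Rightarrow> nat \<Rightarrow> fock \<Rightarrow> fock \<Rightarrow> complex" where
  "lowering f n \<phi> \<psi> = (\<integral>z. rep_fock \<phi> n z * cnj (annihilation_raw f (rep_fock \<psi>) n z) \<partial>modes n)"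

lemma lowering_eq_cnj:
  "lowering f n \<phi> \<psi> = cnj (\<integral>z. annihilation_raw f (rep_fock \<psi>) n z * cnj (rep_fock \<phi> n z) \<partial>modes n)"
  unfolding lowering_def Bochner_Integration.integral_cnj[symmetric] by (simp add: mult.commute)

lemma lowering_bound:
  "cmod (lowering f n \<phi> \<psi>) \<le> sqrt (Suc n) * norm f * sqrt (sector_sq n \<phi>) * sqrt (sector_sq (Suc n) \<psi>)"
  using creation_annihilation_adjoint(2)[where \<psi> = "rep_fock \<phi>" and \<phi> = "rep_fock \<psi>" and n = n and f = f]
  by (simp add: lowering_eq_cnj sector_sq_def rep_fock_sq_integrable rep_fock_symmetric)

lemma creation_lowering:
  "(\<integral>z. rep_fock \<phi> (Suc n) z * cnj (creation_raw f (rep_fock \<psi>) (Suc n) z) \<partial>modes (Suc n))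
    = cnj (lowering f n \<psi> \<phi>)"
proof -
  have "(\<integral>z. rep_fock \<phi> (Suc n) z * cnj (creation_raw f (rep_fock \<psi>) (Suc n) z) \<partial>modes (Suc n))
    = cnj (\<integral>z. creation_raw f (rep_fock \<psi>) (Suc n) z * cnj (rep_fock \<phi> (Suc n) z) \<partial>modes (Suc n))"
    unfolding Bochner_Integration.integral_cnj[symmetric] by (simp add: mult.commute)
  also have "\<dots> = cnj (lowering f n \<psi> \<phi>)"
    unfolding lowering_eq_cnj
    by (subst creation_annihilation_adjoint(1)) (simp_all add: rep_fock_sq_integrable rep_fock_symmetric)
  finally show ?thesis .
qed

text \<open>Membership in \<open>segal f\<close> only says that the sum of the two parts is square
  integrable. In each sector the creation part is so by itself, hence so is the annihilation part as
  a difference, and the integral may be split.\<close>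

lemma sector_segal:
  assumes "(\<psi>, \<zeta>) \<in> segal f"
  shows "sector n \<phi> \<zeta> = (lowering f n \<phi> \<psi>
    + (\<integral>z. rep_fock \<phi> n z * cnj (creation_raw f (rep_fock \<psi>) n z) \<partial>modes n)) / of_real (sqrt 2)"
proof -
  let ?a = "annihilation_raw f (rep_fock \<psi>) n" and ?c = "creation_raw f (rep_fock \<psi>) n"
  let ?q = "complex_of_real (sqrt 2)"
  have q: "?q \<noteq> 0" by simp
  have ae: "AE z in modes n. rep_fock \<zeta> n z = (?a z + ?c z) / ?q"
    using assms by (simp add: segal_def fock_op_def)
  have c: "sq_integrable (modes n) ?c"
    by (rule sq_integrable_creation, rule rep_fock_sq_integrable)
  have am: "?a \<in> borel_measurable (modes n)"
    by (rule measurable_annihilation) simp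
  let ?d = "\<lambda>z. ?q * rep_fock \<zeta> n z + (-1) * ?c z"
  have "sq_integrable (modes n) ?d"
    by (rule sq_integrable_add[OF sq_integrable_mult[OF rep_fock_sq_integrable] sq_integrable_mult[OF c]])
  then have d: "integrable (modes n) (\<lambda>z. (cmod (?d z))\<^sup>2)" by (simp only: sq_integrable_def)
  have "integrable (modes n) (\<lambda>z. (cmod (?a z))\<^sup>2)"
  proof (rule integrable_cong_AE_imp[OF d])
    show "AE z in modes n. (cmod (?d z))\<^sup>2 = (cmod (?a z))\<^sup>2"
      using ae
    proof eventually_elim
      case (elim z)
      have "?d z = ?a z" unfolding elim using q by simp
      then show ?case by (simp only:)
    qed
  qed (use am in simp)
  with am have a: "sq_integrable (modes n) ?a" by (simp only: sq_integrable_def)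
  have ia: "integrable (modes n) (\<lambda>z. rep_fock \<phi> n z * cnj (?a z))"
    and ic: "integrable (modes n) (\<lambda>z. rep_fock \<phi> n z * cnj (?c z))"
    by (rule sq_integrable_cprod(1)[OF rep_fock_sq_integrable a], rule sq_integrable_cprod(1)[OF rep_fock_sq_integrable c])
  have [measurable]: "?a \<in> borel_measurable (modes n)" "?c \<in> borel_measurable (modes n)"
    using a c by (auto simp: sq_integrable_def)
  have "sector n \<phi> \<zeta> = (\<integral>z. (rep_fock \<phi> n z * cnj (?a z) + rep_fock \<phi> n z * cnj (?c z)) / ?q \<partial>modes n)"
    unfolding sector_def
  proof (rule integral_cong_AE)
    show "AE z in modes n. rep_fock \<phi> n z * cnj (rep_fock \<zeta> n z)
        = (rep_fock \<phi> n z * cnj (?a z) + rep_fock \<phi> n z * cnj (?c z)) / ?q"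
      using ae by eventually_elim (simp add: distrib_left)
  qed measurable
  then show ?thesis
    using ia ic by (simp add: lowering_def)
qed

text \<open>The exceptional value at \<open>n = 0\<close> reflects that no sector lies below the
  vacuum.\<close>

lemma summation_by_parts:
  fixes G d :: "nat \<Rightarrow> real"
  shows "(\<Sum>n<Suc m. G n * (if n = 0 then d 0 else d n - d (n - 1)))
    = (\<Sum>n<m. (G n - G (Suc n)) * d n) + G m * d m"
  by (induction m) (simp_all add: algebra_simps)

text \<open>
  The weight changes by one unit across the creation and annihilation parts of the field, so that
  only its increments survive in the imaginary part.
\<close>

lemma segal_weight_commutator:
  fixes u \<zeta> :: "'i::finite \<Rightarrow> fock" and \<sigma> :: "'i \<Rightarrow> 'i \<Rightarrow> complex"
  assumes segal: "\<And>r. (u r, \<zeta> r) \<in> segal f"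
    and herm: "\<And>s r. cnj (\<sigma> r s) = \<sigma> s r" and \<sigma>: "\<And>s r. cmod (\<sigma> s r) \<le> 1"
    and w: "\<And>n. 0 \<le> w n" "\<And>n. L \<le> n \<Longrightarrow> w n = w L" and w_bounded: "bounded_weight w B"
    and \<kappa>: "0 \<le> \<kappa>" and C: "0 \<le> C"
    and increment: "\<And>n a b. 0 \<le> a \<Longrightarrow> 0 \<le> b \<Longrightarrow>
      \<kappa> * \<bar>w (Suc n) - w n\<bar> * sqrt (Suc n) * (a * b) \<le> C * (w n * a\<^sup>2 + w (Suc n) * b\<^sup>2)"
  shows "\<kappa> * \<bar>Im (\<Sum>s\<in>UNIV. \<Sum>r\<in>UNIV. cinner (weight_op (\<lambda>n. w n - w L) (u s)) (cscale (\<sigma> s r) (\<zeta> r)))\<bar>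
    \<le> 2 * real CARD('i) * norm f * C * (\<Sum>s\<in>UNIV. weight_op w (u s) \<bullet> u s)"
proof -
  interpret w: bounded_weight w B by fact
  let ?G = "\<lambda>n. w n - w L"
  interpret G: bounded_weight ?G "2 * B"
  proof
    show "\<bar>w n - w L\<bar> \<le> 2 * B" for n
      using w.bounded[of n] w.bounded[of L] by linarith
  qed
  \<comment> \<open>\<open>D n\<close> collects all transitions between the sectors \<open>n\<close>
    and \<open>n + 1\<close>. As \<open>\<sigma>\<close> is Hermitian, summing over both spin
    indices turns the creation part into the conjugate of \<open>D n\<close>, which is the content
    of \<open>D'\<close>.\<close>
  define D where "D n = (\<Sum>s\<in>UNIV. \<Sum>r\<in>UNIV. cnj (\<sigma> s r) * lowering f n (u s) (u r))" for n
  have D': "(\<Sum>s\<in>UNIV. \<Sum>r\<in>UNIV. cnj (\<sigma> s r) * cnj (lowering f n (u r) (u s))) = cnj (D n)" for n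
    unfolding D_def cnj_sum complex_cnj_mult complex_cnj_cnj
    by (subst sum.swap) (simp add: herm)
  define X where "X n = (\<Sum>s\<in>UNIV. \<Sum>r\<in>UNIV. cnj (\<sigma> s r) * sector n (u s) (\<zeta> r))" for n
  let ?q = "complex_of_real (sqrt 2)"
  have X0: "X 0 = D 0 / ?q"
    unfolding X_def D_def
    by (simp add: sector_segal[OF segal] creation_raw_def sum_divide_distrib)
  have XS: "X (Suc n) = (D (Suc n) + cnj (D n)) / ?q" for n
    unfolding X_def D'[symmetric]
    by (simp add: D_def sector_segal[OF segal] creation_lowering sum_divide_distrib sum.distrib
        distrib_left add_divide_distrib)
  \<comment> \<open>Conjugation flips the sign of the imaginary part, which thus becomes a discrete
    derivative of \<open>Im (D n)\<close>, ready for summation by parts.\<close>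
  have ImX: "Im (X n) = (if n = 0 then Im (D 0) else Im (D n) - Im (D (n - 1))) / sqrt 2" for n
    by (cases n) (simp_all add: X0 XS)
  have G0: "?G n = 0" if "L \<le> n" for n
    using w(2)[OF that] by simp
  \<comment> \<open>Beyond \<open>L\<close> the shifted weight vanishes. The series becomes a finite
    sum, and the question whether the \<open>D n\<close> are summable does not arise.\<close>
  have fin: "cinner (weight_op ?G (u s)) (\<zeta> r) = (\<Sum>n<Suc L. of_real (?G n) * sector n (u s) (\<zeta> r))" for s r
  proof -
    have "(\<lambda>n. of_real (?G n) * sector n (u s) (\<zeta> r)) sums (\<Sum>n<Suc L. of_real (?G n) * sector n (u s) (\<zeta> r))"
    proof (rule sums_finite)
      fix n assume "n \<notin> {..<Suc L}"
      then have "?G n = 0" by (intro G0) simp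
      then show "of_real (?G n) * sector n (u s) (\<zeta> r) = 0" by simp
    qed simp
    then show ?thesis
      using G.cinner_weight_sums sums_unique2 by blast
  qed
  have "(\<Sum>s\<in>UNIV. \<Sum>r\<in>UNIV. cinner (weight_op ?G (u s)) (cscale (\<sigma> s r) (\<zeta> r)))
      = (\<Sum>s\<in>UNIV. \<Sum>r\<in>UNIV. \<Sum>n<Suc L. of_real (?G n) * (cnj (\<sigma> s r) * sector n (u s) (\<zeta> r)))"
    by (simp only: cinner_scale_right fin sum_distrib_left mult.left_commute)
  also have "\<dots> = (\<Sum>s\<in>UNIV. \<Sum>n<Suc L. \<Sum>r\<in>UNIV. of_real (?G n) * (cnj (\<sigma> s r) * sector n (u s) (\<zeta> r)))"
    by (intro sum.cong[OF refl] sum.swap)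
  also have "\<dots> = (\<Sum>n<Suc L. \<Sum>s\<in>UNIV. \<Sum>r\<in>UNIV. of_real (?G n) * (cnj (\<sigma> s r) * sector n (u s) (\<zeta> r)))"
    by (rule sum.swap)
  also have "\<dots> = (\<Sum>n<Suc L. of_real (?G n) * X n)"
    by (simp only: X_def sum_distrib_left)
  finally have "Im (\<Sum>s\<in>UNIV. \<Sum>r\<in>UNIV. cinner (weight_op ?G (u s)) (cscale (\<sigma> s r) (\<zeta> r)))
      = (\<Sum>n<Suc L. ?G n * Im (X n))"
    by (simp only: Im_sum times_complex.sel Re_complex_of_real Im_complex_of_real mult_zero_left add_0_right)
  also have "\<dots> = (\<Sum>n<Suc L. ?G n * (if n = 0 then Im (D 0) else Im (D n) - Im (D (n - 1)))) / sqrt 2"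
    by (simp only: ImX sum_divide_distrib times_divide_eq_right)
  \<comment> \<open>The boundary term carries the factor \<open>?G L = 0\<close>.\<close>
  also have "\<dots> = (\<Sum>n<L. (?G n - ?G (Suc n)) * Im (D n)) / sqrt 2"
    unfolding summation_by_parts[of ?G "\<lambda>n. Im (D n)" L] by simp
  finally have eq: "Im (\<Sum>s\<in>UNIV. \<Sum>r\<in>UNIV. cinner (weight_op ?G (u s)) (cscale (\<sigma> s r) (\<zeta> r)))
      = (\<Sum>n<L. (?G n - ?G (Suc n)) * Im (D n)) / sqrt 2" .
  have ImD: "\<kappa> * \<bar>(?G n - ?G (Suc n)) * Im (D n)\<bar>
      \<le> (\<Sum>s\<in>UNIV. \<Sum>r\<in>UNIV. norm f * (C * (w n * sector_sq n (u s) + w (Suc n) * sector_sq (Suc n) (u r))))" for n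
  proof -
    have "\<bar>Im (D n)\<bar> \<le> cmod (D n)" by (rule abs_Im_le_cmod)
    also have "\<dots> \<le> (\<Sum>s\<in>UNIV. \<Sum>r\<in>UNIV. cmod (cnj (\<sigma> s r) * lowering f n (u s) (u r)))"
      unfolding D_def by (intro order_trans[OF norm_sum] sum_mono) simp
    also have "\<dots> \<le> (\<Sum>s\<in>UNIV. \<Sum>r\<in>UNIV.
        sqrt (Suc n) * norm f * sqrt (sector_sq n (u s)) * sqrt (sector_sq (Suc n) (u r)))"
    proof (intro sum_mono)
      fix s r
      have "cmod (cnj (\<sigma> s r) * lowering f n (u s) (u r)) \<le> 1 * cmod (lowering f n (u s) (u r))"
        unfolding norm_mult complex_mod_cnj by (intro mult_right_mono \<sigma>) simp
      then show "cmod (cnj (\<sigma> s r) * lowering f n (u s) (u r))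
          \<le> sqrt (Suc n) * norm f * sqrt (sector_sq n (u s)) * sqrt (sector_sq (Suc n) (u r))"
        using lowering_bound[of f n "u s" "u r"] by linarith
    qed
    finally have "\<kappa> * \<bar>?G n - ?G (Suc n)\<bar> * \<bar>Im (D n)\<bar> \<le> \<kappa> * \<bar>?G n - ?G (Suc n)\<bar> * (\<Sum>s\<in>UNIV. \<Sum>r\<in>UNIV.
        sqrt (Suc n) * norm f * sqrt (sector_sq n (u s)) * sqrt (sector_sq (Suc n) (u r)))"
      using \<kappa> by (intro mult_left_mono) auto
    also have "\<dots> = (\<Sum>s\<in>UNIV. \<Sum>r\<in>UNIV. norm f * (\<kappa> * \<bar>w (Suc n) - w n\<bar> * sqrt (Suc n) *
        (sqrt (sector_sq n (u s)) * sqrt (sector_sq (Suc n) (u r)))))"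
      by (simp add: sum_distrib_left mult_ac abs_minus_commute)
    also have "\<dots> \<le> (\<Sum>s\<in>UNIV. \<Sum>r\<in>UNIV. norm f *
        (C * (w n * sector_sq n (u s) + w (Suc n) * sector_sq (Suc n) (u r))))"
    proof (intro sum_mono mult_left_mono)
      fix s r
      show "\<kappa> * \<bar>w (Suc n) - w n\<bar> * sqrt (Suc n) * (sqrt (sector_sq n (u s)) * sqrt (sector_sq (Suc n) (u r)))
        \<le> C * (w n * sector_sq n (u s) + w (Suc n) * sector_sq (Suc n) (u r))"
        using increment[of "sqrt (sector_sq n (u s))" "sqrt (sector_sq (Suc n) (u r))" n] by simp
    qed simp
    finally show ?thesis by (simp only: abs_mult mult.assoc)
  qed
  have part: "(\<Sum>n<m. w n * sector_sq n (u s)) \<le> weight_op w (u s) \<bullet> u s" for s m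
    using sum_le_suminf[of "\<lambda>n. w n * sector_sq n (u s)" "{..<m}"] w.inner_weight_self_sums[of "u s"] w(1)
    by (simp add: sums_iff)
  \<comment> \<open>Shifting the index by one only discards the nonnegative vacuum term.\<close>
  have part': "(\<Sum>n<m. w (Suc n) * sector_sq (Suc n) (u s)) \<le> weight_op w (u s) \<bullet> u s" for s m
    using part[of s "Suc m"] w(1)[of 0] mult_nonneg_nonneg[OF w(1)[of 0] sector_sq_nonneg[of 0 "u s"]]
    unfolding sum.lessThan_Suc_shift by linarith
  let ?S = "\<Sum>s\<in>UNIV. weight_op w (u s) \<bullet> u s"
  have "\<kappa> * \<bar>\<Sum>n<L. (?G n - ?G (Suc n)) * Im (D n)\<bar> \<le> (\<Sum>n<L. \<kappa> * \<bar>(?G n - ?G (Suc n)) * Im (D n)\<bar>)"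
    unfolding sum_distrib_left[symmetric] using \<kappa> by (intro mult_left_mono sum_abs)
  also have "\<dots> \<le> (\<Sum>n<L. \<Sum>s\<in>UNIV. \<Sum>r\<in>UNIV.
      norm f * (C * (w n * sector_sq n (u s) + w (Suc n) * sector_sq (Suc n) (u r))))"
    by (intro sum_mono ImD)
  also have "\<dots> = (\<Sum>s\<in>UNIV. \<Sum>r\<in>UNIV. \<Sum>n<L.
      norm f * (C * (w n * sector_sq n (u s) + w (Suc n) * sector_sq (Suc n) (u r))))"
    by (subst sum.swap, rule sum.cong[OF refl], rule sum.swap)
  also have "\<dots> = norm f * C * (\<Sum>s\<in>UNIV. \<Sum>r\<in>UNIV.
      (\<Sum>n<L. w n * sector_sq n (u s)) + (\<Sum>n<L. w (Suc n) * sector_sq (Suc n) (u r)))"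
    by (simp add: sum_distrib_left sum.distrib distrib_left mult_ac)
  also have "\<dots> \<le> norm f * C * (\<Sum>s\<in>UNIV. \<Sum>r\<in>UNIV. weight_op w (u s) \<bullet> u s + weight_op w (u r) \<bullet> u r)"
    using C by (intro mult_left_mono sum_mono add_mono part part') auto
  also have "\<dots> = 2 * real CARD('i) * norm f * C * ?S"
    by (simp add: sum.distrib flip: sum_distrib_left)
  finally have "\<kappa> * \<bar>\<Sum>n<L. (?G n - ?G (Suc n)) * Im (D n)\<bar> \<le> 2 * real CARD('i) * norm f * C * ?S" .
  \<comment> \<open>The normalisation \<open>1 / sqrt 2\<close> of the field is simply estimated by
    \<open>1\<close>.\<close>
  moreover have "\<bar>\<Sum>n<L. (?G n - ?G (Suc n)) * Im (D n)\<bar> / sqrt 2 \<le> \<bar>\<Sum>n<L. (?G n - ?G (Suc n)) * Im (D n)\<bar> / 1"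
    by (intro divide_left_mono) auto
  then have "\<kappa> * (\<bar>\<Sum>n<L. (?G n - ?G (Suc n)) * Im (D n)\<bar> / sqrt 2) \<le> \<kappa> * \<bar>\<Sum>n<L. (?G n - ?G (Suc n)) * Im (D n)\<bar>"
    using \<kappa> by (intro mult_left_mono) auto
  ultimately show ?thesis
    unfolding eq abs_divide by simp
qed

section \<open>Evolution of weights\<close>

text \<open>The bound on \<open>g'\<close> makes \<open>g s * exp (- k * s)\<close> nonincreasing
  and \<open>g s * exp (k * s)\<close> nondecreasing. The second estimate is what later limits a
  decrease of the photon number.\<close>

lemma gronwall_two_sided:
  fixes g :: "real \<Rightarrow> real"
  assumes d: "\<And>s. (g has_real_derivative g' s) (at s)" and b: "\<And>s. \<bar>g' s\<bar> \<le> k * g s"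
  shows "g t \<le> g 0 * exp (k * \<bar>t\<bar>)" and "g 0 \<le> g t * exp (k * \<bar>t\<bar>)"
proof -
  have up: "g v \<le> g u * exp (k * (v - u))" and down: "g u \<le> g v * exp (k * (v - u))" if "u \<le> v" for u v
  proof -
    have "g v * exp (- k * v) \<le> g u * exp (- k * u)"
    proof (rule DERIV_nonpos_imp_nonincreasing[OF that])
      fix s
      have "((\<lambda>s. g s * exp (- k * s)) has_real_derivative (g' s - k * g s) * exp (- k * s)) (at s)"
        by (auto intro!: derivative_eq_intros d simp: algebra_simps)
      moreover have "(g' s - k * g s) * exp (- k * s) \<le> 0"
        using b[of s] by (intro mult_nonpos_nonneg) auto
      ultimately show "\<exists>y. ((\<lambda>s. g s * exp (- k * s)) has_real_derivative y) (at s) \<and> y \<le> 0" by blast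
    qed
    then have "g v * exp (- k * v) * exp (k * v) \<le> g u * exp (- k * u) * exp (k * v)"
      by (rule mult_right_mono) simp
    then show "g v \<le> g u * exp (k * (v - u))"
      by (simp add: mult.assoc exp_add[symmetric] algebra_simps)
    have "g u * exp (k * u) \<le> g v * exp (k * v)"
    proof (rule DERIV_nonneg_imp_nondecreasing[OF that])
      fix s
      have "((\<lambda>s. g s * exp (k * s)) has_real_derivative (g' s + k * g s) * exp (k * s)) (at s)"
        by (auto intro!: derivative_eq_intros d simp: algebra_simps)
      moreover have "0 \<le> (g' s + k * g s) * exp (k * s)"
        using b[of s] by (intro mult_nonneg_nonneg) auto
      ultimately show "\<exists>y. ((\<lambda>s. g s * exp (k * s)) has_real_derivative y) (at s) \<and> 0 \<le> y" by blast
    qed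
    then have "g u * exp (k * u) * exp (- k * u) \<le> g v * exp (k * v) * exp (- k * u)"
      by (rule mult_right_mono) simp
    then show "g u \<le> g v * exp (k * (v - u))"
      by (simp add: mult.assoc exp_add[symmetric] algebra_simps)
  qed
  show "g t \<le> g 0 * exp (k * \<bar>t\<bar>)" "g 0 \<le> g t * exp (k * \<bar>t\<bar>)"
    using up[of 0 t] down[of 0 t] up[of t 0] down[of t 0] by (cases "0 \<le> t"; simp)+
qed

definition state_weight :: "(nat \<Rightarrow> real) \<Rightarrow> 'n::finite state \<Rightarrow> 'n state" where
  "state_weight G \<Psi> = (\<chi> s. weight_op G (\<Psi> $ s))"

lemma bounded_linear_componentwise:
  fixes T :: "'a::real_normed_vector \<Rightarrow> 'b::real_normed_vector"
  assumes "bounded_linear T"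
  shows "bounded_linear (\<lambda>\<Psi> :: 'a ^ 'd::finite. \<chi> s. T (\<Psi> $ s))"
proof -
  interpret T: bounded_linear T by fact
  obtain K where K: "0 \<le> K" "\<And>x. norm (T x) \<le> norm x * K"
    using T.nonneg_bounded by blast
  show ?thesis
  proof (rule bounded_linear_intro)
    show "norm (\<chi> s. T (\<Psi> $ s)) \<le> norm \<Psi> * K" for \<Psi> :: "'a ^ 'd"
    proof -
      have "norm (\<chi> s. T (\<Psi> $ s)) \<le> L2_set (\<lambda>s. K * norm (\<Psi> $ s)) UNIV"
        unfolding norm_vec_def by (rule L2_set_mono) (use K in \<open>auto simp: mult.commute\<close>)
      also have "\<dots> = norm \<Psi> * K"
        unfolding norm_vec_def using K by (simp add: L2_set_right_distrib mult.commute)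
      finally show ?thesis .
    qed
  qed (simp_all add: vec_eq_iff T.add T.scaleR)
qed

lemma bounded_linear_state_weight: "bounded_weight G B \<Longrightarrow> bounded_linear (state_weight G)"
  unfolding state_weight_def[abs_def]
  by (intro bounded_linear_componentwise bounded_weight.bounded_linear_weight_op)

lemma bounded_linear_cscale_state: "bounded_linear (cscale_state c)"
  unfolding cscale_state_def[abs_def]
  by (intro bounded_linear_componentwise bounded_linear_cscale)

lemma inner_state: "\<Psi> \<bullet> \<Phi> = Re (cinner_state \<Psi> \<Phi>)"
  by (simp add: inner_vec_def cinner_state_def inner_fock_def)

lemma scaleR_state: "r *\<^sub>R \<Psi> = cscale_state (of_real r) \<Psi>"
  by (simp add: cscale_state_def vec_eq_iff scaleR_fock_def)

lemma cinner_state_cscale_right: "cinner_state \<Psi> (cscale_state c \<Phi>) = cnj c * cinner_state \<Psi> \<Phi>"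
  by (simp add: cinner_state_def cscale_state_def cinner_scale_right sum_distrib_left)

locale unitary_evolution =
  fixes A :: "('n::finite state \<times> 'n state) set" and U :: "real \<Rightarrow> 'n state \<Rightarrow> 'n state"
  assumes unitary: "unitary_group A U"
begin

lemma U_props:
  "U t (\<Psi> + \<Phi>) = U t \<Psi> + U t \<Phi>"
  "U t (cscale_state c \<Psi>) = cscale_state c (U t \<Psi>)"
  "cinner_state (U t \<Psi>) (U t \<Phi>) = cinner_state \<Psi> \<Phi>"
  "U 0 \<Psi> = \<Psi>"
  "U (s + t) \<Psi> = U s (U t \<Psi>)"
  using unitary by (auto simp: unitary_group_def)

lemma Domain_iff: "\<Psi> \<in> Domain A \<longleftrightarrow> (\<exists>\<Phi>. ((\<lambda>t. U t \<Psi>) has_vector_derivative \<Phi>) (at 0))"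
  and generator: "(\<Psi>, \<Phi>) \<in> A \<Longrightarrow> ((\<lambda>t. U t \<Psi>) has_vector_derivative cscale_state (- \<i>) \<Phi>) (at 0)"
  using unitary unfolding unitary_group_def by blast+

lemma norm_U [simp]: "norm (U t \<Psi>) = norm \<Psi>"
  by (simp add: norm_eq_sqrt_inner inner_state U_props)

lemma bounded_linear_U: "bounded_linear (U t)"
  by (rule bounded_linear_intro[where K = 1]) (simp_all add: U_props scaleR_state)

lemma Domain_add: "\<Psi> \<in> Domain A \<Longrightarrow> \<Phi> \<in> Domain A \<Longrightarrow> \<Psi> + \<Phi> \<in> Domain A"
  unfolding Domain_iff U_props by (elim exE, rule exI, rule has_vector_derivative_add)

lemma Domain_cscale: "\<Psi> \<in> Domain A \<Longrightarrow> cscale_state c \<Psi> \<in> Domain A"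
  unfolding Domain_iff U_props
  by (elim exE, rule exI, rule bounded_linear.has_vector_derivative[OF bounded_linear_cscale_state])

text \<open>Linearity is read off from the differentiability of orbits at \<open>0\<close>, which
  characterises the domain of a generator, rather than from the formula for the operator.\<close>

lemma subspace_Domain: "subspace (Domain A)"
proof -
  have "U t 0 = 0" for t
    by (rule linear_0[OF bounded_linear.linear[OF bounded_linear_U]])
  then have "0 \<in> Domain A"
    unfolding Domain_iff by (intro exI[of _ 0]) simp
  then show ?thesis
    unfolding subspace_def scaleR_state by (blast intro: Domain_add Domain_cscale)
qed

text \<open>\<open>U t\<close> commutes with \<open>U s\<close>, so the orbit through
  \<open>U t \<Psi>\<close> is again differentiable at \<open>0\<close> and the domain is invariant;
  a shift of time moves the derivative to \<open>t\<close>. As \<open>A\<close> is a relation, some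
  image \<open>\<Phi>\<close> of \<open>U t \<Psi>\<close> is picked.\<close>

lemma evolution_derivative:
  assumes "\<Psi> \<in> Domain A"
  shows "\<exists>\<Phi>. (U t \<Psi>, \<Phi>) \<in> A \<and> ((\<lambda>s. U s \<Psi>) has_vector_derivative cscale_state (- \<i>) \<Phi>) (at t)"
proof -
  obtain \<Phi>0 where "((\<lambda>s. U s \<Psi>) has_vector_derivative \<Phi>0) (at 0)"
    using assms Domain_iff by blast
  then have "((\<lambda>s. U t (U s \<Psi>)) has_vector_derivative U t \<Phi>0) (at 0)"
    by (rule bounded_linear.has_vector_derivative[OF bounded_linear_U])
  moreover have "U t (U s \<Psi>) = U s (U t \<Psi>)" for s
    by (metis U_props(5) add.commute)
  ultimately have "U t \<Psi> \<in> Domain A" using Domain_iff by auto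
  then obtain \<Phi> where \<Phi>: "(U t \<Psi>, \<Phi>) \<in> A" by blast
  have "((\<lambda>s. s - t) has_vector_derivative 1) (at t)"
    by (auto intro!: derivative_eq_intros)
  from vector_diff_chain_at[OF this, of "\<lambda>s. U s (U t \<Psi>)" "cscale_state (- \<i>) \<Phi>"] generator[OF \<Phi>]
  have "((\<lambda>s. U (s - t) (U t \<Psi>)) has_vector_derivative cscale_state (- \<i>) \<Phi>) (at t)"
    by (simp add: o_def)
  moreover have "U (s - t) (U t \<Psi>) = U s \<Psi>" for s
    using U_props(5)[of "s - t" t \<Psi>] by simp
  ultimately show ?thesis using \<Phi> by auto
qed

text \<open>Along an orbit in the domain the derivative of the weighted norm is minus twice the
  imaginary part of the pairing in \<open>comm\<close>. Both sides of the Gronwall estimates are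
  continuous in \<open>\<Psi>\<close>, because the weight is bounded and \<open>U t\<close>
  isometric, and so the estimates pass to the closure of the domain.\<close>

lemma weight_evolution:
  assumes w: "bounded_weight w B" and comm: "\<And>\<Psi> \<Phi>. (\<Psi>, \<Phi>) \<in> A \<Longrightarrow>
      \<bar>Im (cinner_state (state_weight (\<lambda>n. w n - c) \<Psi>) \<Phi>)\<bar> \<le> k * (state_weight w \<Psi> \<bullet> \<Psi>)"
    and \<Psi>: "\<Psi> \<in> closure (Domain A)"
  shows "state_weight w (U t \<Psi>) \<bullet> U t \<Psi> \<le> (state_weight w \<Psi> \<bullet> \<Psi>) * exp (2 * k * \<bar>t\<bar>)"
    and "state_weight w \<Psi> \<bullet> \<Psi> \<le> (state_weight w (U t \<Psi>) \<bullet> U t \<Psi>) * exp (2 * k * \<bar>t\<bar>)"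
proof -
  let ?G = "\<lambda>n. w n - c"
  interpret w: bounded_weight w B by fact
  interpret G: bounded_weight ?G "B + \<bar>c\<bar>"
  proof
    show "\<bar>?G n\<bar> \<le> B + \<bar>c\<bar>" for n using w.bounded[of n] by linarith
  qed
  note bl = bounded_linear_state_weight[OF w]
  have sG: "state_weight w \<Psi> \<bullet> \<Phi> = state_weight ?G \<Psi> \<bullet> \<Phi> + c * (\<Psi> \<bullet> \<Phi>)" for \<Psi> \<Phi> :: "'n state"
  proof -
    have "weight_op w \<psi> \<bullet> \<phi> = weight_op ?G \<psi> \<bullet> \<phi> + c * (\<psi> \<bullet> \<phi>)" for \<psi> \<phi>
    proof -
      have "(\<lambda>n. Re (of_real (?G n) * sector n \<psi> \<phi>) + c * Re (sector n \<psi> \<phi>)) sums (weight_op ?G \<psi> \<bullet> \<phi> + c * (\<psi> \<bullet> \<phi>))"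
        unfolding inner_fock_def
        by (intro sums_add sums_mult sums_Re G.cinner_weight_sums cinner_sums)
      moreover have "(\<lambda>n. Re (of_real (w n) * sector n \<psi> \<phi>)) sums (weight_op w \<psi> \<bullet> \<phi>)"
        unfolding inner_fock_def by (intro sums_Re w.cinner_weight_sums)
      moreover have "(\<lambda>n. Re (of_real (w n) * sector n \<psi> \<phi>))
          = (\<lambda>n. Re (of_real (?G n) * sector n \<psi> \<phi>) + c * Re (sector n \<psi> \<phi>))"
        by (simp add: algebra_simps fun_eq_iff)
      ultimately show ?thesis using sums_unique2 by metis
    qed
    then show ?thesis
      by (simp add: inner_vec_def state_weight_def sum.distrib sum_distrib_left)
  qed
  have comm_w: "state_weight w \<Psi> \<bullet> \<Phi> = state_weight w \<Phi> \<bullet> \<Psi>" for \<Psi> \<Phi> :: "'n state"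
    by (simp add: inner_vec_def state_weight_def w.inner_weight_commute[of "\<Psi> $ _"])
  have ev: "state_weight w (U t \<Psi>) \<bullet> U t \<Psi> \<le> (state_weight w \<Psi> \<bullet> \<Psi>) * exp (2 * k * \<bar>t\<bar>)
      \<and> state_weight w \<Psi> \<bullet> \<Psi> \<le> (state_weight w (U t \<Psi>) \<bullet> U t \<Psi>) * exp (2 * k * \<bar>t\<bar>)"
    if D: "\<Psi> \<in> Domain A" for \<Psi>
  proof -
    let ?g = "\<lambda>s. state_weight w (U s \<Psi>) \<bullet> U s \<Psi>"
    have "\<forall>s. \<exists>\<Phi>. (U s \<Psi>, \<Phi>) \<in> A \<and> ((\<lambda>s. U s \<Psi>) has_vector_derivative cscale_state (- \<i>) \<Phi>) (at s)"
      using evolution_derivative[OF D] by blast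
    then obtain \<Phi> where A: "\<And>s. (U s \<Psi>, \<Phi> s) \<in> A"
      and d: "\<And>s. ((\<lambda>s. U s \<Psi>) has_vector_derivative cscale_state (- \<i>) (\<Phi> s)) (at s)"
      by metis
    \<comment> \<open>Differentiating the constant norm shows that the velocity is orthogonal to the
      state. Hence shifting the weight by \<open>c\<close> changes nothing, and this stands in for a
      proof that the Hamiltonian is symmetric.\<close>
    have cons: "U s \<Psi> \<bullet> cscale_state (- \<i>) (\<Phi> s) = 0" for s
    proof -
      have "((\<lambda>s. U s \<Psi> \<bullet> U s \<Psi>) has_vector_derivative
          U s \<Psi> \<bullet> cscale_state (- \<i>) (\<Phi> s) + cscale_state (- \<i>) (\<Phi> s) \<bullet> U s \<Psi>) (at s)"
        by (rule bounded_bilinear.has_vector_derivative[OF bounded_bilinear_inner d d])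
      moreover have "((\<lambda>s. U s \<Psi> \<bullet> U s \<Psi>) has_vector_derivative 0) (at s)"
        by (simp add: inner_state U_props)
      ultimately have "U s \<Psi> \<bullet> cscale_state (- \<i>) (\<Phi> s) + cscale_state (- \<i>) (\<Phi> s) \<bullet> U s \<Psi> = 0"
        by (rule vector_derivative_unique_at)
      then show ?thesis by (simp add: inner_commute)
    qed
    let ?g' = "\<lambda>s. 2 * (state_weight w (U s \<Psi>) \<bullet> cscale_state (- \<i>) (\<Phi> s))"
    have "(?g has_real_derivative ?g' s) (at s)" for s
    proof -
      have "(?g has_vector_derivative state_weight w (U s \<Psi>) \<bullet> cscale_state (- \<i>) (\<Phi> s)
          + state_weight w (cscale_state (- \<i>) (\<Phi> s)) \<bullet> U s \<Psi>) (at s)"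
        by (rule bounded_bilinear.has_vector_derivative[OF bounded_bilinear_inner
              bounded_linear.has_vector_derivative[OF bl d] d])
      then show ?thesis
        by (simp add: has_real_derivative_iff_has_vector_derivative comm_w[of "cscale_state (- \<i>) (\<Phi> s)"])
    qed
    moreover have "\<bar>?g' s\<bar> \<le> 2 * k * ?g s" for s
    proof -
      have "state_weight w (U s \<Psi>) \<bullet> cscale_state (- \<i>) (\<Phi> s)
          = - Im (cinner_state (state_weight ?G (U s \<Psi>)) (\<Phi> s))"
        by (simp add: sG cons, simp add: inner_state cinner_state_cscale_right)
      then show ?thesis using comm[OF A[of s]] by simp
    qed
    ultimately have "?g t \<le> ?g 0 * exp (2 * k * \<bar>t\<bar>)" "?g 0 \<le> ?g t * exp (2 * k * \<bar>t\<bar>)"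
      by (rule gronwall_two_sided)+
    then show ?thesis by (simp add: U_props)
  qed
  have cont: "continuous_on S (\<lambda>\<Psi>. state_weight w (U t \<Psi>) \<bullet> U t \<Psi>)"
    "continuous_on S (\<lambda>\<Psi>. state_weight w \<Psi> \<bullet> \<Psi>)" for S
    by (intro continuous_on_inner bounded_linear.continuous_on[OF bl]
        bounded_linear.continuous_on[OF bounded_linear_U] continuous_on_id)+
  have "(state_weight w (U t \<Psi>) \<bullet> U t \<Psi>) - (state_weight w \<Psi> \<bullet> \<Psi>) * exp (2 * k * \<bar>t\<bar>) \<le> 0"
  proof (rule continuous_le_on_closure[OF _ \<Psi>])
    show "continuous_on (closure (Domain A)) (\<lambda>\<Psi>. (state_weight w (U t \<Psi>) \<bullet> U t \<Psi>)
        - (state_weight w \<Psi> \<bullet> \<Psi>) * exp (2 * k * \<bar>t\<bar>))"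
      by (intro continuous_on_diff continuous_on_mult_right cont)
    show "(state_weight w (U t \<Psi>) \<bullet> U t \<Psi>)
        - (state_weight w \<Psi> \<bullet> \<Psi>) * exp (2 * k * \<bar>t\<bar>) \<le> 0"
      if "\<Psi> \<in> Domain A" for \<Psi>
      using ev[OF that] by linarith
  qed
  then show "state_weight w (U t \<Psi>) \<bullet> U t \<Psi> \<le> (state_weight w \<Psi> \<bullet> \<Psi>) * exp (2 * k * \<bar>t\<bar>)" by simp
  have "(state_weight w \<Psi> \<bullet> \<Psi>) - (state_weight w (U t \<Psi>) \<bullet> U t \<Psi>) * exp (2 * k * \<bar>t\<bar>) \<le> 0"
  proof (rule continuous_le_on_closure[OF _ \<Psi>])
    show "continuous_on (closure (Domain A)) (\<lambda>\<Psi>. (state_weight w \<Psi> \<bullet> \<Psi>)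
        - (state_weight w (U t \<Psi>) \<bullet> U t \<Psi>) * exp (2 * k * \<bar>t\<bar>))"
      by (intro continuous_on_diff continuous_on_mult_right cont)
    show "(state_weight w \<Psi> \<bullet> \<Psi>)
        - (state_weight w (U t \<Psi>) \<bullet> U t \<Psi>) * exp (2 * k * \<bar>t\<bar>) \<le> 0"
      if "\<Psi> \<in> Domain A" for \<Psi>
      using ev[OF that] by linarith
  qed
  then show "state_weight w \<Psi> \<bullet> \<Psi> \<le> (state_weight w (U t \<Psi>) \<bullet> U t \<Psi>) * exp (2 * k * \<bar>t\<bar>)" by simp
qed

end

section \<open>The pairing of a weight with the Hamiltonian\<close>

lemma sigma_hermitian: "cnj (sigma l m $ r $ s) = sigma l m $ s $ r"
  by (auto simp: sigma_def pauli_hermitian)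

lemma norm_sigma_le: "cmod (sigma l m $ s $ r) \<le> 1"
proof -
  have "cmod (pauli m $ a $ b) \<le> 1" for a b
    using exhaust_2[of a] exhaust_2[of b] by (auto simp: pauli_def)
  then show ?thesis by (simp add: sigma_def)
qed

text \<open>In each sector \<open>dGamma m\<close> multiplies by a real function, so its expectation
  there is real, and real weights on the sectors preserve this.\<close>

lemma dGamma_weight_real:
  assumes G: "bounded_weight G B" and "(\<psi>, \<eta>) \<in> dGamma m"
  shows "Im (cinner (weight_op G \<psi>) \<eta>) = 0"
proof -
  interpret bounded_weight G B by fact
  have "sector n \<psi> \<eta> = cnj (sector n \<psi> \<eta>)" for n
  proof -
    have ae: "AE z in modes n. rep_fock \<eta> n z = of_real (\<Sum>i<n. m (fst (z i))) * rep_fock \<psi> n z"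
      using assms(2) by (simp add: dGamma_def fock_op_def)
    have "sector n \<psi> \<eta> = sector n \<eta> \<psi>"
      unfolding sector_def
    proof (rule integral_cong_AE)
      show "AE z in modes n. rep_fock \<psi> n z * cnj (rep_fock \<eta> n z) = rep_fock \<eta> n z * cnj (rep_fock \<psi> n z)"
        using ae by eventually_elim simp
    qed measurable
    also have "\<dots> = cnj (sector n \<psi> \<eta>)" by (rule sector_commute)
    finally show ?thesis .
  qed
  from arg_cong[OF this, of Im] have "Im (sector n \<psi> \<eta>) = 0" for n
    by simp
  then have "(\<lambda>n. 0) sums Im (cinner (weight_op G \<psi>) \<eta>)"
    using sums_Im[OF cinner_weight_sums[of \<psi> \<eta>]] by simp
  then show ?thesis by (simp add: sums_iff)
qed

text \<open>The weight and the spin matrix act on different tensor factors; both are Hermitian and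
  they commute, so the expectation of their product is real.\<close>

lemma spin_weight_real:
  fixes u :: "'i::finite \<Rightarrow> fock"
  assumes G: "bounded_weight G B" and herm: "\<And>s r. cnj (\<sigma> r s) = \<sigma> s r"
  shows "Im (\<Sum>s\<in>UNIV. \<Sum>r\<in>UNIV. cinner (weight_op G (u s)) (cscale (\<sigma> s r) (u r))) = 0"
proof -
  interpret bounded_weight G B by fact
  let ?T = "\<Sum>s\<in>UNIV. \<Sum>r\<in>UNIV. cinner (weight_op G (u s)) (cscale (\<sigma> s r) (u r))"
  have "cnj ?T = (\<Sum>s\<in>UNIV. \<Sum>r\<in>UNIV. \<sigma> s r * cinner (weight_op G (u r)) (u s))"
    unfolding cinner_scale_right cnj_sum complex_cnj_mult complex_cnj_cnj
    by (simp only: cinner_weight_commute[symmetric])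
  also have "\<dots> = ?T"
    by (subst sum.swap) (simp add: cinner_scale_right herm)
  finally have "Im (cnj ?T) = Im ?T" by (rule arg_cong)
  then show ?thesis unfolding cnj.simps by linarith
qed

lemma op_tensor_identity: "op_tensor A (mat 1) = {(\<Psi>, \<Phi>). \<forall>s. (\<Psi> $ s, \<Phi> $ s) \<in> A}"
proof -
  have "(\<chi> s. \<Sum>r\<in>UNIV. cscale (mat 1 $ s $ r) (\<eta> $ r)) = \<eta>" for \<eta> :: "'a state"
  proof -
    have "cscale 0 \<psi> = 0" for \<psi> using scaleR_fock_def[of 0 \<psi>] by simp
    then have "(\<Sum>r\<in>UNIV. cscale (mat 1 $ s $ r) (\<eta> $ r)) = (\<Sum>r\<in>UNIV. if s = r then \<eta> $ r else 0)" for s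
      by (intro sum.cong) (auto simp: mat_def)
    then show ?thesis by (simp add: vec_eq_iff)
  qed
  then show ?thesis unfolding op_tensor_def by auto
qed

text \<open>The part of the growth rate that depends neither on \<open>h\<close> nor on the weight:
  the constants of \<open>segal_weight_commutator\<close>, added over all couplings. The number of
  spin basis states comes from the double sum over matrix entries, each bounded by
  \<open>1\<close>.\<close>

definition field_bound :: "(real \<Rightarrow> real) \<Rightarrow> ('n::finite \<Rightarrow> real^3) \<Rightarrow> real" where
  "field_bound chi x = (\<Sum>l\<in>UNIV. \<Sum>j\<in>UNIV.
    2 * real CARD('n \<Rightarrow> 2) * norm (a_field chi j (x l), b_field chi j (x l)))"

text \<open>The free energy and the constant field \<open>\<beta>\<close> have real pairings with a
  weight, so only the quantised fields contribute. Their \<open>sqrt h\<close> goes into the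
  hypothesis \<open>increment\<close>, while the outer \<open>h\<close> stays in front, to be
  cancelled by the time \<open>t / h\<close>.\<close>

lemma hamiltonian_weight_commutator:
  fixes \<Psi> \<Phi> :: "'n::finite state"
  assumes "(\<Psi>, \<Phi>) \<in> hamiltonian chi \<beta> x h" and h: "0 < h"
    and w: "\<And>n. 0 \<le> w n" "\<And>n. L \<le> n \<Longrightarrow> w n = w L" and w_bounded: "bounded_weight w B"
    and C: "0 \<le> C"
    and increment: "\<And>n a b. 0 \<le> a \<Longrightarrow> 0 \<le> b \<Longrightarrow>
      sqrt h * \<bar>w (Suc n) - w n\<bar> * sqrt (Suc n) * (a * b) \<le> C * (w n * a\<^sup>2 + w (Suc n) * b\<^sup>2)"
  shows "\<bar>Im (cinner_state (state_weight (\<lambda>n. w n - w L) \<Psi>) \<Phi>)\<bar>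
    \<le> h * (field_bound chi x * C) * (state_weight w \<Psi> \<bullet> \<Psi>)"
proof -
  let ?G = "\<lambda>n. w n - w L"
  interpret w: bounded_weight w B by fact
  have G: "bounded_weight ?G (2 * B)"
  proof
    show "\<bar>?G n\<bar> \<le> 2 * B" for n using w.bounded[of n] w.bounded[of L] by linarith
  qed
  from assms(1) obtain \<Phi>1 \<Phi>2 where \<Phi>: "\<Phi> = \<Phi>1 + h *\<^sub>R \<Phi>2" and 1: "(\<Psi>, \<Phi>1) \<in> op_tensor (free_field h) (mat 1)"
    and 2: "(\<Psi>, \<Phi>2) \<in> op_sum (\<lambda>l. op_sum (\<lambda>j.
      op_tensor (op_plus (op_scale (\<beta> $ j) Id) (B_quantum h chi j (x l))) (sigma l j)))"
    unfolding hamiltonian_def op_plus_def op_scale_def by auto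
  have 1: "\<exists>\<eta>. (\<Psi> $ s, \<eta>) \<in> dGamma norm \<and> \<Phi>1 $ s = h *\<^sub>R \<eta>" for s
  proof -
    have "(\<Psi> $ s, \<Phi>1 $ s) \<in> free_field h"
      using 1 unfolding op_tensor_identity by blast
    then show ?thesis unfolding free_field_def op_scale_def by blast
  qed
  from 2 obtain v where v: "\<Phi>2 = (\<Sum>l\<in>UNIV. v l)" and "\<forall>l. (\<Psi>, v l) \<in> op_sum (\<lambda>j.
      op_tensor (op_plus (op_scale (\<beta> $ j) Id) (B_quantum h chi j (x l))) (sigma l j))"
    unfolding op_sum_def by auto
  then have "\<forall>l. \<exists>v'. v l = (\<Sum>j\<in>UNIV. v' j) \<and> (\<forall>j. (\<Psi>, v' j) \<in>
      op_tensor (op_plus (op_scale (\<beta> $ j) Id) (B_quantum h chi j (x l))) (sigma l j))"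
    unfolding op_sum_def by blast
  then obtain v' where v': "\<And>l. v l = (\<Sum>j\<in>UNIV. v' l j)"
    and T: "\<And>l j. (\<Psi>, v' l j) \<in> op_tensor (op_plus (op_scale (\<beta> $ j) Id) (B_quantum h chi j (x l))) (sigma l j)"
    by metis
  have bound: "\<bar>Im (cinner_state (state_weight ?G \<Psi>) (v' l j))\<bar>
      \<le> 2 * real CARD('n \<Rightarrow> 2) * norm (a_field chi j (x l), b_field chi j (x l)) * C * (state_weight w \<Psi> \<bullet> \<Psi>)" for l j
  proof -
    from T[of l j] obtain \<eta> where v'_eq: "v' l j = (\<chi> s. \<Sum>r\<in>UNIV. cscale (sigma l j $ s $ r) (\<eta> $ r))"
      and "\<forall>r. (\<Psi> $ r, \<eta> $ r) \<in> op_plus (op_scale (\<beta> $ j) Id) (B_quantum h chi j (x l))"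
      unfolding op_tensor_def by auto
    then have "\<forall>r. \<exists>\<zeta>. (\<Psi> $ r, \<zeta>) \<in> segal (a_field chi j (x l), b_field chi j (x l)) \<and>
        \<eta> $ r = (\<beta> $ j) *\<^sub>R \<Psi> $ r + sqrt h *\<^sub>R \<zeta>"
      by (auto simp: op_plus_def op_scale_def B_quantum_def)
    then obtain \<zeta> where \<zeta>: "\<And>r. (\<Psi> $ r, \<zeta> r) \<in> segal (a_field chi j (x l), b_field chi j (x l))"
      and \<eta>: "\<And>r. \<eta> $ r = (\<beta> $ j) *\<^sub>R \<Psi> $ r + sqrt h *\<^sub>R \<zeta> r" by metis
    let ?c = "\<lambda>\<xi>. \<Sum>s\<in>UNIV. \<Sum>r\<in>UNIV. cinner (weight_op ?G (\<Psi> $ s)) (cscale (sigma l j $ s $ r) (\<xi> r))"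
    have "cinner_state (state_weight ?G \<Psi>) (v' l j) = of_real (\<beta> $ j) * ?c (\<lambda>r. \<Psi> $ r) + of_real (sqrt h) * ?c \<zeta>"
      by (simp add: cinner_state_def state_weight_def v'_eq \<eta> cinner_sum_right cscale_add cscale_scaleR
          cinner_add_right cinner_scaleR_right sum.distrib sum_distrib_left)
    then have "Im (cinner_state (state_weight ?G \<Psi>) (v' l j)) = (\<beta> $ j) * Im (?c (\<lambda>r. \<Psi> $ r)) + sqrt h * Im (?c \<zeta>)"
      by (simp del: Im_sum)
    also have "Im (?c (\<lambda>r. \<Psi> $ r)) = 0"
      by (rule spin_weight_real[OF G sigma_hermitian])
    finally have "\<bar>Im (cinner_state (state_weight ?G \<Psi>) (v' l j))\<bar> = sqrt h * \<bar>Im (?c \<zeta>)\<bar>"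
      using h by (simp add: abs_mult del: Im_sum)
    also have "\<dots> \<le> 2 * real CARD('n \<Rightarrow> 2) * norm (a_field chi j (x l), b_field chi j (x l)) * C *
        (\<Sum>s\<in>UNIV. weight_op w (\<Psi> $ s) \<bullet> \<Psi> $ s)"
      by (rule segal_weight_commutator[OF \<zeta> sigma_hermitian norm_sigma_le w w_bounded _ C increment])
         (use h in auto)
    finally show ?thesis by (simp add: inner_vec_def state_weight_def)
  qed
  have lin: "cinner_state \<Xi> (\<Sum>i\<in>I. f i) = (\<Sum>i\<in>I. cinner_state \<Xi> (f i))"
    for \<Xi> :: "'n state" and f :: "'j \<Rightarrow> 'n state" and I
    by (simp add: cinner_state_def cinner_sum_right) (rule sum.swap)
  have "cinner_state (state_weight ?G \<Psi>) \<Phi> = cinner_state (state_weight ?G \<Psi>) \<Phi>1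
      + of_real h * cinner_state (state_weight ?G \<Psi>) \<Phi>2"
    by (simp add: \<Phi> cinner_state_def cinner_add_right cinner_scaleR_right sum.distrib sum_distrib_left)
  moreover have "Im (cinner_state (state_weight ?G \<Psi>) \<Phi>1) = 0"
  proof -
    have "Im (cinner (weight_op ?G (\<Psi> $ s)) (\<Phi>1 $ s)) = 0" for s
      using 1[of s] dGamma_weight_real[OF G] by (auto simp: cinner_scaleR_right)
    then show ?thesis by (simp add: cinner_state_def state_weight_def)
  qed
  ultimately have "\<bar>Im (cinner_state (state_weight ?G \<Psi>) \<Phi>)\<bar> = h * \<bar>Im (cinner_state (state_weight ?G \<Psi>) \<Phi>2)\<bar>"
    using h by (simp add: abs_mult)
  also have "\<bar>Im (cinner_state (state_weight ?G \<Psi>) \<Phi>2)\<bar>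
      = \<bar>\<Sum>l\<in>UNIV. \<Sum>j\<in>UNIV. Im (cinner_state (state_weight ?G \<Psi>) (v' l j))\<bar>"
    unfolding v v' lin by simp
  also have "\<dots> \<le> (\<Sum>l\<in>UNIV. \<Sum>j\<in>UNIV. \<bar>Im (cinner_state (state_weight ?G \<Psi>) (v' l j))\<bar>)"
    by (intro order_trans[OF sum_abs] sum_mono) simp
  also have "\<dots> \<le> (\<Sum>l\<in>UNIV. \<Sum>j\<in>UNIV. 2 * real CARD('n \<Rightarrow> 2) *
      norm (a_field chi j (x l), b_field chi j (x l)) * C * (state_weight w \<Psi> \<bullet> \<Psi>))"
    by (intro sum_mono bound)
  also have "\<dots> = field_bound chi x * C * (state_weight w \<Psi> \<bullet> \<Psi>)"
    by (simp add: field_bound_def sum_distrib_right)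
  finally show ?thesis using h by (simp add: mult.assoc)
qed

section \<open>Coherent states\<close>

lemma wave_product_integrable:
  "integrable mode_measure (\<lambda>w. wave f w * cnj (wave g w))"
  by (rule sq_integrable_cprod(1)[OF wave_sq_integrable wave_sq_integrable])

lemma AE_rep_tensor_power:
  "AE z in modes m. rep_fock (tensor_power n f) m z = (if m = n then \<Prod>i<n. wave f (z i) else 0)"
  unfolding tensor_power_def map_fun_def comp_def id_def
  by (rule AE_rep_abs[OF fock_fun_tensor_power])

lemma measurable_wave_prod [measurable]: "(\<lambda>z. \<Prod>i<n. wave f (z i)) \<in> borel_measurable (modes n)"
  by (intro borel_measurable_prod measurable_compose[OF measurable_modes_component wave_measurable]) simp

lemma sector_tensor_power:
  "sector m (tensor_power n f) (tensor_power n g)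
    = (if m = n then (\<integral>w. wave f w * cnj (wave g w) \<partial>mode_measure) ^ n else 0)"
proof -
  interpret product_sigma_finite "\<lambda>_::nat. mode_measure" by (rule product_sigma_finite_mode)
  have m: "(\<lambda>z. if m = n then \<Prod>i<n. wave f (z i) * cnj (wave g (z i)) else 0) \<in> borel_measurable (modes m)"
    by (cases "m = n") (auto intro!: borel_measurable_prod borel_measurable_times borel_measurable_cnj
        measurable_compose[OF measurable_modes_component wave_measurable])
  have "sector m (tensor_power n f) (tensor_power n g)
      = (\<integral>z. (if m = n then \<Prod>i<n. wave f (z i) * cnj (wave g (z i)) else 0) \<partial>modes m)"
    unfolding sector_def
  proof (rule integral_cong_AE[OF _ m])
    show "AE z in modes m. rep_fock (tensor_power n f) m z * cnj (rep_fock (tensor_power n g) m z)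
        = (if m = n then \<Prod>i<n. wave f (z i) * cnj (wave g (z i)) else 0)"
      using AE_rep_tensor_power[where m = m and n = n and f = f] AE_rep_tensor_power[where m = m and n = n and f = g]
      by eventually_elim (simp add: prod.distrib cnj_prod)
  qed measurable
  also have "\<dots> = (if m = n then (\<integral>w. wave f w * cnj (wave g w) \<partial>mode_measure) ^ n else 0)"
    using product_integral_prod[of "{..<n}" "\<lambda>_ w. wave f w * cnj (wave g w)"] wave_product_integrable[of f g]
    by (simp add: modes_def)
  finally show ?thesis .
qed

lemma integral_wave_self: "(\<integral>w. wave f w * cnj (wave f w) \<partial>mode_measure) = of_real ((norm f)\<^sup>2)"
  unfolding integral_wave_norm[symmetric] integral_complex_of_real[symmetric] complex_norm_square ..

lemma sector_sq_tensor_power: "sector_sq m (tensor_power n f) = (if m = n then (norm f) ^ (2 * n) else 0)"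
proof -
  have "complex_of_real (sector_sq m (tensor_power n f)) = of_real (if m = n then (norm f) ^ (2 * n) else 0)"
    unfolding sector_self[symmetric] sector_tensor_power integral_wave_self
    by (simp add: power_mult)
  then show ?thesis by (simp only: of_real_eq_iff)
qed

lemma cinner_tensor_power:
  "cinner (tensor_power n f) (tensor_power n g) = (\<integral>w. wave f w * cnj (wave g w) \<partial>mode_measure) ^ n"
  using sums_unique2[OF cinner_sums[of "tensor_power n f" "tensor_power n g"]]
    sums_single[of n "\<lambda>_. (\<integral>w. wave f w * cnj (wave g w) \<partial>mode_measure) ^ n"]
  by (simp add: sector_tensor_power)

lemma AE_rep_scaleR: "AE z in modes n. rep_fock (r *\<^sub>R \<psi>) n z = of_real r * rep_fock \<psi> n z"
  unfolding scaleR_fock_def by (rule AE_rep_cscale)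

lemma AE_rep_zero: "AE z in modes n. rep_fock 0 n z = 0"
  unfolding zero_fock_def by (rule AE_rep_abs[OF fock_fun_zero])

lemma AE_rep_diff: "AE z in modes n. rep_fock (\<psi> - \<phi>) n z = rep_fock \<psi> n z - rep_fock \<phi> n z"
  using AE_rep_add[of \<psi> "(-1) *\<^sub>R \<phi>" n] AE_rep_scaleR[of "-1" \<phi> n]
  by eventually_elim simp

lemma AE_rep_tensor_sum:
  "AE z in modes k. rep_fock (\<Sum>n<m. c n *\<^sub>R tensor_power n f) k z
    = (if k < m then of_real (c k) * (\<Prod>i<k. wave f (z i)) else 0)"
proof (induction m)
  case 0
  then show ?case using AE_rep_zero[of k] by simp
next
  case (Suc m)
  from Suc AE_rep_add[of "\<Sum>n<m. c n *\<^sub>R tensor_power n f" "c m *\<^sub>R tensor_power m f" k]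
    AE_rep_scaleR[of "c m" "tensor_power m f" k] AE_rep_tensor_power[where m = k and n = m and f = f]
  show ?case
    by eventually_elim (auto simp: less_Suc_eq)
qed

lemma sector_sq_eqI:
  assumes "AE z in modes n. rep_fock \<psi> n z = c * rep_fock \<phi> n z"
  shows "sector_sq n \<psi> = (cmod c)\<^sup>2 * sector_sq n \<phi>"
proof -
  have "sector_sq n \<psi> = (\<integral>z. (cmod c)\<^sup>2 * (cmod (rep_fock \<phi> n z))\<^sup>2 \<partial>modes n)"
    unfolding sector_sq_def
  proof (rule integral_cong_AE)
    show "AE z in modes n. (cmod (rep_fock \<psi> n z))\<^sup>2 = (cmod c)\<^sup>2 * (cmod (rep_fock \<phi> n z))\<^sup>2"
      using assms by eventually_elim (simp add: norm_mult power_mult_distrib)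
  qed measurable
  then show ?thesis by (simp add: sector_sq_def)
qed

text \<open>The limit is written down sector by sector rather than obtained from completeness. The
  remainder after \<open>m\<close> terms vanishes in the sectors below \<open>m\<close> and agrees
  with \<open>\<xi>\<close> in the others, so that its squared norm is the tail of a convergent
  series.\<close>

lemma tensor_series:
  assumes s: "summable (\<lambda>n. (c n)\<^sup>2 * norm f ^ (2 * n))"
  shows "\<exists>\<xi>. (\<lambda>n. c n *\<^sub>R tensor_power n f) sums \<xi> \<and> (\<forall>n. sector_sq n \<xi> = (c n)\<^sup>2 * norm f ^ (2 * n))"
proof -
  let ?P = "\<lambda>n z. \<Prod>i<n. wave f (z i)"
  have component: "sq_integrable (modes n) (\<lambda>z. of_real (c n) * ?P n z)"
    "symmetric_fun n (\<lambda>z. of_real (c n) * ?P n z)" "transversal_fun n (\<lambda>z. of_real (c n) * ?P n z)" for n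
  proof -
    have "fock_fun (\<lambda>m z. of_real (c n) * (if m = n then ?P n z else 0))"
      by (intro fock_fun_scale fock_fun_tensor_power)
    then have "sq_integrable (modes n) (\<lambda>z. of_real (c n) * (if n = n then ?P n z else 0)) \<and>
      symmetric_fun n (\<lambda>z. of_real (c n) * (if n = n then ?P n z else 0)) \<and>
      transversal_fun n (\<lambda>z. of_real (c n) * (if n = n then ?P n z else 0))"
      unfolding fock_fun_def by blast
    then show "sq_integrable (modes n) (\<lambda>z. of_real (c n) * ?P n z)"
      "symmetric_fun n (\<lambda>z. of_real (c n) * ?P n z)" "transversal_fun n (\<lambda>z. of_real (c n) * ?P n z)"
      by simp_all
  qed
  have P_sq: "(\<integral>z. (cmod (?P n z))\<^sup>2 \<partial>modes n) = norm f ^ (2 * n)" for n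
  proof -
    have "sector_sq n (tensor_power n f) = (\<integral>z. (cmod (?P n z))\<^sup>2 \<partial>modes n)"
      unfolding sector_sq_def
    proof (rule integral_cong_AE)
      show "AE z in modes n. (cmod (rep_fock (tensor_power n f) n z))\<^sup>2 = (cmod (?P n z))\<^sup>2"
        using AE_rep_tensor_power[where m = n and n = n and f = f] by eventually_elim simp
    qed measurable
    then show ?thesis by (simp add: sector_sq_tensor_power)
  qed
  have ff: "fock_fun (\<lambda>n z. of_real (c n) * ?P n z)"
    unfolding fock_fun_def using component s P_sq
    by (simp add: norm_mult power_mult_distrib)
  define \<xi> where "\<xi> = abs_fock (\<lambda>n z. of_real (c n) * ?P n z)"
  have rep: "AE z in modes n. rep_fock \<xi> n z = of_real (c n) * ?P n z" for n
    unfolding \<xi>_def by (rule AE_rep_abs[OF ff])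
  have sec: "sector_sq n \<xi> = (c n)\<^sup>2 * norm f ^ (2 * n)" for n
  proof -
    have "AE z in modes n. rep_fock \<xi> n z = of_real (c n) * rep_fock (tensor_power n f) n z"
      using rep[of n] AE_rep_tensor_power[where m = n and n = n and f = f] by eventually_elim simp
    from sector_sq_eqI[OF this] show ?thesis by (simp add: sector_sq_tensor_power)
  qed
  let ?S = "\<lambda>m. \<Sum>n<m. c n *\<^sub>R tensor_power n f"
  have tail: "(norm (\<xi> - ?S m))\<^sup>2 = (norm \<xi>)\<^sup>2 - (\<Sum>n<m. sector_sq n \<xi>)" for m
  proof -
    have "sector_sq k (\<xi> - ?S m) = sector_sq k \<xi> - (if k \<in> {..<m} then sector_sq k \<xi> else 0)" for k
    proof -
      have "AE z in modes k. rep_fock (\<xi> - ?S m) k z = (if k < m then 0 else 1) * rep_fock \<xi> k z"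
        using rep[of k] AE_rep_tensor_sum[where k = k and m = m and c = c and f = f] AE_rep_diff[of \<xi> "?S m" k]
        by eventually_elim simp
      from sector_sq_eqI[OF this] show ?thesis by simp
    qed
    then have "(\<lambda>k. sector_sq k (\<xi> - ?S m)) sums ((norm \<xi>)\<^sup>2 - (\<Sum>n<m. sector_sq n \<xi>))"
      by (simp only:) (intro sums_diff norm_fock_sums sums_If_finite_set finite_lessThan)
    with norm_fock_sums show ?thesis by (rule sums_unique2)
  qed
  have "(\<lambda>m. (norm \<xi>)\<^sup>2 - (\<Sum>n<m. sector_sq n \<xi>)) \<longlonglongrightarrow> (norm \<xi>)\<^sup>2 - (norm \<xi>)\<^sup>2"
    using norm_fock_sums[of \<xi>] unfolding sums_def by (intro tendsto_diff tendsto_const)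
  then have "(\<lambda>m. (norm (\<xi> - ?S m))\<^sup>2) \<longlonglongrightarrow> 0" by (simp add: tail)
  then have "(\<lambda>m. sqrt ((norm (\<xi> - ?S m))\<^sup>2)) \<longlonglongrightarrow> sqrt 0" by (rule tendsto_real_sqrt)
  then have "(\<lambda>m. norm (?S m - \<xi>)) \<longlonglongrightarrow> 0" by (simp add: norm_minus_commute)
  then have "(\<lambda>n. c n *\<^sub>R tensor_power n f) sums \<xi>"
    unfolding sums_def by (rule LIM_zero_cancel[OF tendsto_norm_zero_cancel])
  then show ?thesis using sec by blast
qed

text \<open>\<open>coherent\<close> is an infinite sum, which has its intended meaning once
  convergence is known. The sector weights form the Poisson distribution with parameter
  \<open>(norm f)\<^sup>2 / (2 * h)\<close>, and the moment estimates see the coherent state only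
  through them.\<close>

lemma coherent_sums:
  assumes h: "0 < h"
  shows "\<exists>c. (\<lambda>n. c n *\<^sub>R tensor_power n f) sums coherent h f"
    and "sector_sq n (coherent h f) = exp (- ((norm f)\<^sup>2 / (2 * h))) * (((norm f)\<^sup>2 / (2 * h)) ^ n / fact n)"
proof -
  define c where "c n = exp (- ((norm (fst f))\<^sup>2 + (norm (snd f))\<^sup>2) / (4 * h))
      / ((2 * h) powr (real n / 2) * sqrt (fact n))" for n
  let ?l = "(norm f)\<^sup>2 / (2 * h)"
  have nf: "(norm (fst f))\<^sup>2 + (norm (snd f))\<^sup>2 = (norm f)\<^sup>2" by (simp add: norm_prod_def)
  have c2: "(c n)\<^sup>2 * norm f ^ (2 * n) = exp (- ?l) * (?l ^ n / fact n)" for n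
  proof -
    have e: "(exp (- (norm f)\<^sup>2 / (4 * h)))\<^sup>2 = exp (- ?l)"
      unfolding power2_eq_square mult_exp_exp
      by (rule arg_cong[where f = exp]) (use h in \<open>simp add: field_simps\<close>)
    have p: "((2 * h) powr (real n / 2))\<^sup>2 = (2 * h) ^ n"
      unfolding power2_eq_square powr_add[symmetric] using h by (simp add: powr_realpow)
    have q: "norm f ^ (2 * n) / (2 * h) ^ n = ?l ^ n"
      by (simp only: power_divide power_mult)
    have "(c n)\<^sup>2 = exp (- ?l) / ((2 * h) ^ n * fact n)"
      unfolding c_def nf power_divide power_mult_distrib[of "(2 * h) powr _"] e p by simp
    then show ?thesis unfolding q[symmetric] by simp
  qed
  have "summable (\<lambda>n. exp (- ?l) * (?l ^ n / fact n))"
    using summable_mult[OF summable_exp[of ?l], of "exp (- ?l)"]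
    by (simp only: divide_inverse mult.commute[of "inverse (fact _)"])
  then have "summable (\<lambda>n. (c n)\<^sup>2 * norm f ^ (2 * n))" by (simp only: c2)
  then obtain \<xi> where \<xi>: "(\<lambda>n. c n *\<^sub>R tensor_power n f) sums \<xi>"
      "\<And>n. sector_sq n \<xi> = (c n)\<^sup>2 * norm f ^ (2 * n)"
    using tensor_series by blast
  have "coherent h f = \<xi>"
    unfolding coherent_def c_def[symmetric] using \<xi>(1) by (rule sums_unique[symmetric])
  note eq = this
  show "\<exists>c. (\<lambda>n. c n *\<^sub>R tensor_power n f) sums coherent h f"
    unfolding eq by (rule exI[of _ c], rule \<xi>(1))
  show "sector_sq n (coherent h f) = exp (- ?l) * (?l ^ n / fact n)"
    unfolding eq \<xi>(2) by (rule c2)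
qed

section \<open>Change of representative and scaling for the field\<close>

lemma AE_annihilation_cong:
  assumes ae: "AE z in modes (Suc n). \<psi> (Suc n) z = \<phi> (Suc n) z"
    and m: "\<psi> (Suc n) \<in> borel_measurable (modes (Suc n))" "\<phi> (Suc n) \<in> borel_measurable (modes (Suc n))"
  shows "AE z in modes n. annihilation_raw f \<psi> n z = annihilation_raw f \<phi> n z"
  using AE_modes_Suc[OF ae] AE_space
proof eventually_elim
  case (elim z)
  have u: "(\<lambda>w. z(n := w)) \<in> measurable mode_measure (modes (Suc n))"
    using measurable_compose[OF measurable_Pair1'[OF elim(2)] measurable_modes_upd] by simp
  have "(\<integral>w. cnj (wave f w) * \<psi> (Suc n) (z(n := w)) \<partial>mode_measure)
      = (\<integral>w. cnj (wave f w) * \<phi> (Suc n) (z(n := w)) \<partial>mode_measure)"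
  proof (rule integral_cong_AE)
    show "AE w in mode_measure. cnj (wave f w) * \<psi> (Suc n) (z(n := w)) = cnj (wave f w) * \<phi> (Suc n) (z(n := w))"
      using elim(1) by eventually_elim simp
  qed (intro borel_measurable_times borel_measurable_cnj wave_measurable;
       rule measurable_compose[OF u m(1)] measurable_compose[OF u m(2)])+
  then show ?case by (simp add: annihilation_raw_def)
qed

text \<open>Deleting a variable pulls null sets back to null sets, and only finitely many positions
  occur.\<close>

lemma AE_creation_cong:
  assumes "AE z in modes (n - 1). \<psi> (n - 1) z = \<phi> (n - 1) z"
  shows "AE z in modes n. creation_raw f \<psi> n z = creation_raw f \<phi> n z"
proof (cases n)
  case (Suc m)
  have "AE z in modes m. \<psi> m z = \<phi> m z" using assms unfolding Suc diff_Suc_1 .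
  then have "AE z in modes (Suc m). \<forall>i\<in>{..<Suc m}. \<psi> m (drop_var i z) = \<phi> m (drop_var i z)"
    by (intro AE_finite_allI AE_drop_var) auto
  then show ?thesis
    unfolding Suc by eventually_elim (simp add: creation_raw_Suc del: sum.lessThan_Suc)
qed (simp add: creation_raw_def)

text \<open>Acting on wave functions rather than on classes lets a convenient representative, such
  as a pure product, take the place of the one chosen by \<open>rep_fock\<close>.\<close>

definition segal_raw :: "photon \<times> photon \<Rightarrow> fock_raw \<Rightarrow> fock_raw" where
  "segal_raw f \<psi> n z = (annihilation_raw f \<psi> n z + creation_raw f \<psi> n z) / of_real (sqrt 2)"

lemma segal_iff: "(\<psi>, \<zeta>) \<in> segal f \<longleftrightarrow> (\<forall>n. AE z in modes n. rep_fock \<zeta> n z = segal_raw f (rep_fock \<psi>) n z)"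
  by (simp add: segal_def fock_op_def segal_raw_def)

lemma AE_segal_cong:
  assumes "\<And>n. AE z in modes n. \<psi> n z = \<phi> n z"
    and "\<And>n. \<psi> n \<in> borel_measurable (modes n)" "\<And>n. \<phi> n \<in> borel_measurable (modes n)"
  shows "AE z in modes n. segal_raw f \<psi> n z = segal_raw f \<phi> n z"
proof -
  have "AE z in modes n. annihilation_raw f \<psi> n z = annihilation_raw f \<phi> n z"
    by (rule AE_annihilation_cong) (rule assms)+
  moreover have "AE z in modes n. creation_raw f \<psi> n z = creation_raw f \<phi> n z"
    by (rule AE_creation_cong) (rule assms)
  ultimately show ?thesis
    by eventually_elim (simp add: segal_raw_def)
qed

text \<open>The spin components of a product state are scalar multiples of one Fock vector; this
  brings all of them into the domain together.\<close>

lemma segal_cscale: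
  assumes "(\<psi>, \<zeta>) \<in> segal f"
  shows "(cscale c \<psi>, cscale c \<zeta>) \<in> segal f"
  unfolding segal_iff
proof
  fix n
  have lin: "segal_raw f (\<lambda>n z. c * rep_fock \<psi> n z) n z = c * segal_raw f (rep_fock \<psi>) n z" for z
  proof -
    have "(\<integral>w. cnj (wave f w) * (c * rep_fock \<psi> (n + 1) (z(n := w))) \<partial>mode_measure)
        = (\<integral>w. c * (cnj (wave f w) * rep_fock \<psi> (n + 1) (z(n := w))) \<partial>mode_measure)"
      by (rule Bochner_Integration.integral_cong[OF refl], rule mult.left_commute)
    also have "\<dots> = c * (\<integral>w. cnj (wave f w) * rep_fock \<psi> (n + 1) (z(n := w)) \<partial>mode_measure)"
      by (rule Bochner_Integration.integral_mult_right_zero)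
    finally have "annihilation_raw f (\<lambda>n z. c * rep_fock \<psi> n z) n z = c * annihilation_raw f (rep_fock \<psi>) n z"
      unfolding annihilation_raw_def by (simp only:) (rule mult.left_commute)
    moreover have "creation_raw f (\<lambda>n z. c * rep_fock \<psi> n z) n z = c * creation_raw f (rep_fock \<psi>) n z"
    proof -
      have "(\<Sum>i<n. wave f (z i) * (c * rep_fock \<psi> (n - 1) (\<lambda>j. if j < i then z j else z (Suc j))))
          = c * (\<Sum>i<n. wave f (z i) * rep_fock \<psi> (n - 1) (\<lambda>j. if j < i then z j else z (Suc j)))"
        unfolding sum_distrib_left by (rule sum.cong[OF refl]) (rule mult.left_commute)
      then show ?thesis unfolding creation_raw_def by (simp only: times_divide_eq_right)
    qed
    ultimately show ?thesis by (simp add: segal_raw_def distrib_left)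
  qed
  have "AE z in modes n. segal_raw f (rep_fock (cscale c \<psi>)) n z = segal_raw f (\<lambda>n z. c * rep_fock \<psi> n z) n z"
  proof (rule AE_segal_cong)
    show "AE z in modes n. rep_fock (cscale c \<psi>) n z = c * rep_fock \<psi> n z" for n
      by (rule AE_rep_cscale)
  qed simp_all
  moreover have "AE z in modes n. rep_fock \<zeta> n z = segal_raw f (rep_fock \<psi>) n z"
    using assms by (simp add: segal_iff)
  moreover note AE_rep_cscale[of c \<zeta> n]
  ultimately show "AE z in modes n. rep_fock (cscale c \<zeta>) n z = segal_raw f (rep_fock (cscale c \<psi>)) n z"
    by eventually_elim (simp add: lin)
qed

lemma dGamma_cscale:
  assumes "(\<psi>, \<eta>) \<in> dGamma m"
  shows "(cscale c \<psi>, cscale c \<eta>) \<in> dGamma m"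
  unfolding dGamma_def fock_op_def mem_Collect_eq prod.case
proof
  fix n
  have "AE z in modes n. rep_fock \<eta> n z = of_real (\<Sum>i<n. m (fst (z i))) * rep_fock \<psi> n z"
    using assms by (simp add: dGamma_def fock_op_def)
  with AE_rep_cscale[of c \<eta> n] AE_rep_cscale[of c \<psi> n]
  show "AE z in modes n. rep_fock (cscale c \<eta>) n z = of_real (\<Sum>i<n. m (fst (z i))) * rep_fock (cscale c \<psi>) n z"
    by eventually_elim simp
qed

section \<open>Coherent states and the domain of the Hamiltonian\<close>

lemma measurable_modes_fst: "i < n \<Longrightarrow> (\<lambda>z. fst (z i)) \<in> borel_measurable (modes n)"
  using measurable_compose[OF measurable_modes_component[of i n], of fst borel]
  by (simp add: mode_measure_def)

text \<open>If \<open>g\<close> lives on momenta of size at most \<open>R\<close>, the total energy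
  is bounded wherever the tensor power is nonzero.\<close>

lemma Domain_dGamma_norm:
  assumes supp: "AE w in mode_measure. R < norm (fst w) \<longrightarrow> wave g w = 0"
  shows "tensor_power n g \<in> Domain (dGamma norm)"
proof -
  define \<psi> where "\<psi> = rep_fock (tensor_power n g)"
  \<comment> \<open>Truncating every momentum gives a bounded multiplier, which preserves square
    integrability and still agrees with the energy almost everywhere on the support of
    \<open>\<psi>\<close>. The absolute value keeps the bound nonnegative for every
    \<open>R\<close>.\<close>
  define K :: "nat \<Rightarrow> (nat \<Rightarrow> (real^3) \<times> 3) \<Rightarrow> real" where "K m z = (\<Sum>i<m. min \<bar>R\<bar> (norm (fst (z i))))" for m z
  have \<psi>: "sq_integrable (modes m) (\<psi> m)" "symmetric_fun m (\<psi> m)" "transversal_fun m (\<psi> m)" for m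
    using fock_fun_rep[of "tensor_power n g"] by (auto simp: \<psi>_def fock_fun_def)
  have \<psi>_AE: "AE z in modes m. \<psi> m z = (if m = n then \<Prod>i<n. wave g (z i) else 0)" for m
    unfolding \<psi>_def by (rule AE_rep_tensor_power)
  have K_bound: "\<bar>K m z\<bar> \<le> real m * \<bar>R\<bar>" for m z
  proof -
    have "\<bar>K m z\<bar> \<le> (\<Sum>i<m. \<bar>R\<bar>)"
      unfolding K_def by (intro order_trans[OF sum_abs] sum_mono) (auto simp: abs_of_nonneg)
    then show ?thesis by simp
  qed
  have K_measurable: "K m \<in> borel_measurable (modes m)" for m
    unfolding K_def[abs_def]
    by (intro borel_measurable_sum borel_measurable_min borel_measurable_const
        measurable_compose[OF measurable_modes_fst borel_measurable_norm]) simp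
  have "sq_integrable (modes m) (\<lambda>z. of_real (K m z) * \<psi> m z)" for m
    using sq_integrable_scaleR_bounded[OF \<psi>(1) K_measurable K_bound] by (simp add: scaleR_conv_of_real)
  moreover have "symmetric_fun m (\<lambda>z. of_real (K m z) * \<psi> m z)" for m
    unfolding symmetric_fun_def
  proof (intro allI impI)
    fix \<pi> assume \<pi>: "\<pi> permutes {..<m}"
    have "K m (z \<circ> \<pi>) = K m z" for z
      unfolding K_def using sum.permute[OF \<pi>, of "\<lambda>i. min \<bar>R\<bar> (norm (fst (z i)))"] by (simp add: o_def)
    moreover have "AE z in modes m. \<psi> m (z \<circ> \<pi>) = \<psi> m z"
      using \<psi>(2) \<pi> by (simp add: symmetric_fun_def)
    ultimately show "AE z in modes m. of_real (K m (z \<circ> \<pi>)) * \<psi> m (z \<circ> \<pi>) = of_real (K m z) * \<psi> m z"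
      by (auto elim!: eventually_mono)
  qed
  moreover have "transversal_fun m (\<lambda>z. of_real (K m z) * \<psi> m z)" for m
    unfolding transversal_fun_def
  proof (intro allI impI)
    fix i assume i: "i < m"
    have "AE z in modes m. (\<Sum>j\<in>UNIV. of_real (fst (z i) $ j) * \<psi> m (z(i := (fst (z i), j)))) = 0"
      using \<psi>(3) i by (simp add: transversal_fun_def)
    then show "AE z in modes m. (\<Sum>j\<in>UNIV. of_real (fst (z i) $ j) *
        (of_real (K m (z(i := (fst (z i), j)))) * \<psi> m (z(i := (fst (z i), j))))) = 0"
    proof eventually_elim
      case (elim z)
      have K: "K m (z(i := (fst (z i), j))) = K m z" for j
        unfolding K_def by (rule sum.cong) auto
      have "(\<Sum>j\<in>UNIV. of_real (fst (z i) $ j) * (of_real (K m z) * \<psi> m (z(i := (fst (z i), j)))))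
          = of_real (K m z) * (\<Sum>j\<in>UNIV. of_real (fst (z i) $ j) * \<psi> m (z(i := (fst (z i), j))))"
        unfolding sum_distrib_left by (rule sum.cong[OF refl]) (rule mult.left_commute)
      then show ?case by (simp only: K elim mult_zero_right)
    qed
  qed
  moreover have "summable (\<lambda>m. \<integral>z. (cmod (of_real (K m z) * \<psi> m z))\<^sup>2 \<partial>modes m)"
  proof (rule summable_finite[of "{n}"])
    fix m assume "m \<notin> {n}"
    then have "AE z in modes m. (cmod (of_real (K m z) * \<psi> m z))\<^sup>2 = 0"
      using \<psi>_AE[of m] by (auto elim!: eventually_mono)
    then show "(\<integral>z. (cmod (of_real (K m z) * \<psi> m z))\<^sup>2 \<partial>modes m) = 0"
      by (rule integral_eq_zero_AE)
  qed simp
  ultimately have ff: "fock_fun (\<lambda>m z. of_real (K m z) * \<psi> m z)"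
    by (simp add: fock_fun_def)
  have "(tensor_power n g, abs_fock (\<lambda>m z. of_real (K m z) * \<psi> m z)) \<in> dGamma norm"
    unfolding dGamma_def fock_op_def mem_Collect_eq prod.case \<psi>_def[symmetric]
  proof
    fix m
    have "AE z in modes m. \<forall>i\<in>{..<m}. R < norm (fst (z i)) \<longrightarrow> wave g (z i) = 0"
      by (intro AE_finite_allI AE_modes[OF supp]) auto
    with AE_rep_abs[OF ff, of m] \<psi>_AE[of m]
    show "AE z in modes m. rep_fock (abs_fock (\<lambda>m z. of_real (K m z) * \<psi> m z)) m z
        = of_real (\<Sum>i<m. norm (fst (z i))) * \<psi> m z"
    proof eventually_elim
      case (elim z)
      have "\<psi> m z = 0 \<or> K m z = (\<Sum>i<m. norm (fst (z i)))"
      proof (cases "m = n \<and> (\<forall>i<n. wave g (z i) \<noteq> 0)")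
        case True
        then have "norm (fst (z i)) \<le> \<bar>R\<bar>" if "i < m" for i
          using elim(3) that by (metis abs_ge_self lessThan_iff linorder_not_less order_trans)
        then show ?thesis unfolding K_def by (auto intro!: sum.cong)
      next
        case False
        then show ?thesis using elim(2) by auto
      qed
      then show ?case using elim(1) by auto
    qed
  qed
  then show ?thesis by blast
qed

text \<open>For \<open>N = n + 1\<close> and up to the factor \<open>1 / sqrt (n + 1)\<close>, this
  is the creation operator of \<open>f\<close> applied to the \<open>n\<close>-th tensor power of
  \<open>g\<close>.\<close>

definition mixed_prod :: "photon \<times> photon \<Rightarrow> photon \<times> photon \<Rightarrow> nat \<Rightarrow> (nat \<Rightarrow> (real^3) \<times> 3) \<Rightarrow> complex" where
  "mixed_prod f g N z = (\<Sum>i<N. wave f (z i) * (\<Prod>j\<in>{..<N} - {i}. wave g (z j)))"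

lemma mixed_prod_symmetric: "symmetric_fun N (mixed_prod f g N)"
  unfolding symmetric_fun_def
proof (intro allI impI always_eventually)
  fix \<pi> z assume \<pi>: "\<pi> permutes {..<N}"
  have "(\<Prod>j\<in>{..<N} - {i}. wave g (z (\<pi> j))) = (\<Prod>j\<in>{..<N} - {\<pi> i}. wave g (z j))" if "i < N" for i
  proof (rule prod.reindex_bij_betw[of \<pi> "{..<N} - {i}" "{..<N} - {\<pi> i}" "\<lambda>j. wave g (z j)"])
    show "bij_betw \<pi> ({..<N} - {i}) ({..<N} - {\<pi> i})"
      using permutes_imp_bij[OF \<pi>] permutes_in_image[OF \<pi>, of i] that by (intro bij_betw_DiffI bij_betw_singletonI) auto
  qed
  then have "mixed_prod f g N (z \<circ> \<pi>) = (\<Sum>i<N. wave f (z (\<pi> i)) * (\<Prod>j\<in>{..<N} - {\<pi> i}. wave g (z j)))"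
    unfolding mixed_prod_def o_def by (intro sum.cong) auto
  also have "\<dots> = mixed_prod f g N z"
    unfolding mixed_prod_def
    using sum.permute[OF \<pi>, of "\<lambda>i. wave f (z i) * (\<Prod>j\<in>{..<N} - {i}. wave g (z j))"] by (simp add: o_def)
  finally show "mixed_prod f g N (z \<circ> \<pi>) = mixed_prod f g N z" .
qed

text \<open>Term by term: the varied variable carries either the factor \<open>f\<close> or one of
  the factors \<open>g\<close>, and transversality of that factor makes the sum vanish.\<close>

lemma mixed_prod_transversal: "transversal_fun N (mixed_prod f g N)"
  unfolding transversal_fun_def
proof (intro allI impI)
  fix l assume l: "l < N"
  from AE_modes[OF wave_transversal[of f] l] AE_modes[OF wave_transversal[of g] l]
  show "AE z in modes N. (\<Sum>j\<in>UNIV. of_real (fst (z l) $ j) * mixed_prod f g N (z(l := (fst (z l), j)))) = 0"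
  proof eventually_elim
    case (elim z)
    let ?z = "\<lambda>j. z(l := (fst (z l), j))"
    have "(\<Sum>j\<in>UNIV. of_real (fst (z l) $ j) * (wave f (?z j i) * (\<Prod>m\<in>{..<N} - {i}. wave g (?z j m)))) = 0"
      if i: "i < N" for i
    proof (cases "i = l")
      case True
      have "(\<Prod>m\<in>{..<N} - {i}. wave g (?z j m)) = (\<Prod>m\<in>{..<N} - {i}. wave g (z m))" for j
        using True by (intro prod.cong) auto
      then have "(\<Sum>j\<in>UNIV. of_real (fst (z l) $ j) * (wave f (?z j i) * (\<Prod>m\<in>{..<N} - {i}. wave g (?z j m))))
        = (\<Sum>j\<in>UNIV. of_real (fst (z l) $ j) * wave f (fst (z l), j)) * (\<Prod>m\<in>{..<N} - {i}. wave g (z m))"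
        using True by (simp add: sum_distrib_right mult.assoc)
      then show ?thesis using elim(1) by simp
    next
      case False
      have "(\<Prod>m\<in>{..<N} - {i}. wave g (?z j m))
          = wave g (fst (z l), j) * (\<Prod>m\<in>{..<N} - {i} - {l}. wave g (z m))" for j
        using l False by (subst prod.remove[of _ l]) (auto intro!: prod.cong)
      then have "(\<Sum>j\<in>UNIV. of_real (fst (z l) $ j) * (wave f (?z j i) * (\<Prod>m\<in>{..<N} - {i}. wave g (?z j m))))
        = (\<Sum>j\<in>UNIV. (of_real (fst (z l) $ j) * wave g (fst (z l), j))
            * (wave f (z i) * (\<Prod>m\<in>{..<N} - {i} - {l}. wave g (z m))))"
        using False by (intro sum.cong) (auto simp: mult_ac)
      also have "\<dots> = 0" by (simp only: sum_distrib_right[symmetric] elim(2) mult_zero_left)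
      finally show ?thesis .
    qed
    then have "(\<Sum>i<N. \<Sum>j\<in>UNIV. of_real (fst (z l) $ j) * (wave f (?z j i) * (\<Prod>m\<in>{..<N} - {i}. wave g (?z j m)))) = 0"
      by (intro sum.neutral) auto
    then show ?case
      unfolding mixed_prod_def sum_distrib_left by (subst sum.swap)
  qed
qed

lemma drop_var_prod:
  assumes "i \<le> n"
  shows "(\<Prod>j<n. wave g (drop_var i z j)) = (\<Prod>j\<in>{..<Suc n} - {i}. wave g (z j))"
proof (rule prod.reindex_bij_witness[of _ "\<lambda>j. if j < i then j else j - 1" "\<lambda>j. if j < i then j else Suc j"])
qed (use assms in \<open>auto simp: drop_var_def\<close>)

lemma fock_fun_mixed_prod: "fock_fun (\<lambda>m z. if m = Suc n then mixed_prod f g (Suc n) z else 0)"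
proof -
  let ?t = "\<lambda>m z. if m = n then \<Prod>i<n. wave g (z i) else 0"
  have t: "sq_integrable (modes n) (?t n)"
    using fock_fun_tensor_power[of n g] unfolding fock_fun_def by blast
  have "sq_integrable (modes (Suc n)) (creation_raw f ?t (Suc n))"
    by (rule sq_integrable_creation) (use t in simp)
  from sq_integrable_mult[OF this, of "of_real (sqrt (Suc n))"]
  have "sq_integrable (modes (Suc n)) (\<lambda>z. \<Sum>i<Suc n. wave f (z i) * (\<Prod>j<n. wave g (drop_var i z j)))"
    by (simp add: creation_raw_Suc del: sum.lessThan_Suc)
  also have "(\<lambda>z. \<Sum>i<Suc n. wave f (z i) * (\<Prod>j<n. wave g (drop_var i z j))) = mixed_prod f g (Suc n)"
    unfolding mixed_prod_def fun_eq_iff by (intro allI sum.cong) (auto simp only: drop_var_prod lessThan_iff less_Suc_eq_le)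
  finally have sq: "sq_integrable (modes (Suc n)) (mixed_prod f g (Suc n))" .
  show ?thesis
    unfolding fock_fun_def
  proof (intro conjI allI)
    fix m
    show "sq_integrable (modes m) (\<lambda>z. if m = Suc n then mixed_prod f g (Suc n) z else 0)"
      "symmetric_fun m (\<lambda>z. if m = Suc n then mixed_prod f g (Suc n) z else 0)"
      "transversal_fun m (\<lambda>z. if m = Suc n then mixed_prod f g (Suc n) z else 0)"
      using sq mixed_prod_symmetric[of "Suc n" f g] mixed_prod_transversal[of "Suc n" f g]
        sq_integrable_zero[of "modes m"]
      by (cases "m = Suc n"; simp add: symmetric_fun_def transversal_fun_def)+
    show "summable (\<lambda>m. \<integral>z. (cmod (if m = Suc n then mixed_prod f g (Suc n) z else 0))\<^sup>2 \<partial>modes m)"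
      by (rule summable_finite[of "{Suc n}"]) auto
  qed
qed

text \<open>The image is explicit: annihilation contracts one factor \<open>g\<close> with
  \<open>f\<close> and leaves \<open>c\<close> times the tensor power of order \<open>n - 1\<close>,
  creation yields a \<open>mixed_prod\<close>.\<close>

lemma Domain_segal: "tensor_power n g \<in> Domain (segal f)"
proof -
  let ?t = "\<lambda>m z. if m = n then \<Prod>i<n. wave g (z i) else 0"
  define c where "c = of_real (sqrt (real n)) * (\<integral>w. cnj (wave f w) * wave g w \<partial>mode_measure)"
  define A :: fock_raw where "A m z = (if n = 0 then 0 else c * (if m = n - 1 then \<Prod>i<n - 1. wave g (z i) else 0))" for m z
  define K :: fock_raw where "K m z = (1 / of_real (sqrt (Suc n))) * (if m = Suc n then mixed_prod f g (Suc n) z else 0)" for m z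
  define \<phi> :: fock_raw where "\<phi> m z = (1 / of_real (sqrt 2)) * (A m z + K m z)" for m z
  have "fock_fun A"
  proof (cases "n = 0")
    case True
    then show ?thesis unfolding A_def[abs_def] by (simp add: fock_fun_zero)
  next
    case False
    then show ?thesis
      unfolding A_def[abs_def] by (simp only: if_False) (intro fock_fun_scale fock_fun_tensor_power)
  qed
  moreover have "fock_fun K"
    unfolding K_def[abs_def] by (intro fock_fun_scale fock_fun_mixed_prod)
  ultimately have \<phi>: "fock_fun \<phi>"
    unfolding \<phi>_def[abs_def] by (intro fock_fun_scale fock_fun_add)
  have a: "annihilation_raw f ?t m z = A m z" if z: "z \<in> space (modes m)" for m z
  proof (cases "m + 1 = n")
    case True
    have "?t (m + 1) (z(m := w)) = wave g w * (\<Prod>i<m. wave g (z i))" for w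
      using True by (auto simp: lessThan_Suc mult.commute intro!: prod.cong)
    then have "annihilation_raw f ?t m z
        = of_real (sqrt (real n)) * (\<integral>w. (cnj (wave f w) * wave g w) * (\<Prod>i<m. wave g (z i)) \<partial>mode_measure)"
      unfolding annihilation_raw_def True by (simp only: True mult.assoc)
    also have "\<dots> = c * (\<Prod>i<m. wave g (z i))"
      unfolding c_def Bochner_Integration.integral_mult_left_zero by (rule mult.assoc[symmetric])
    also have "\<dots> = A m z" using True by (auto simp: A_def)
    finally show ?thesis .
  next
    case False
    then have "annihilation_raw f ?t m z = 0" by (simp add: annihilation_raw_def)
    then show ?thesis using False by (auto simp: A_def)
  qed
  have k: "creation_raw f ?t m z = K m z" for m z
  proof (cases m)
    case 0
    then show ?thesis by (simp add: creation_raw_def K_def)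
  next
    case (Suc l)
    show ?thesis
    proof (cases "l = n")
      case True
      have "(\<Sum>i<Suc n. wave f (z i) * (\<Prod>j<n. wave g (drop_var i z j))) = mixed_prod f g (Suc n) z"
        unfolding mixed_prod_def by (intro sum.cong) (auto simp only: drop_var_prod lessThan_iff less_Suc_eq_le)
      then show ?thesis
        using Suc True by (simp add: creation_raw_Suc K_def del: sum.lessThan_Suc)
    next
      case False
      then show ?thesis using Suc by (simp add: creation_raw_Suc K_def del: sum.lessThan_Suc)
    qed
  qed
  have "(tensor_power n g, abs_fock \<phi>) \<in> segal f"
    unfolding segal_iff
  proof
    fix m
    have "AE z in modes m. segal_raw f (rep_fock (tensor_power n g)) m z = segal_raw f ?t m z"
    proof (rule AE_segal_cong)
      show "AE z in modes m. rep_fock (tensor_power n g) m z = ?t m z" for m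
        by (rule AE_rep_tensor_power)
      show "?t m \<in> borel_measurable (modes m)" for m
        using fock_fun_tensor_power[of n g] unfolding fock_fun_def sq_integrable_def by blast
    qed simp
    moreover have "AE z in modes m. segal_raw f ?t m z = \<phi> m z"
      by (rule AE_I2) (simp add: segal_raw_def a k \<phi>_def)
    moreover note AE_rep_abs[OF \<phi>, of m]
    ultimately show "AE z in modes m. rep_fock (abs_fock \<phi>) m z = segal_raw f (rep_fock (tensor_power n g)) m z"
      by eventually_elim simp
  qed
  then show ?thesis by blast
qed

lemma Domain_op_plus: "u \<in> Domain A \<Longrightarrow> u \<in> Domain B \<Longrightarrow> u \<in> Domain (op_plus A B)"
  unfolding op_plus_def by blast

lemma Domain_op_scale: "u \<in> Domain A \<Longrightarrow> u \<in> Domain (op_scale c A)"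
  unfolding op_scale_def by blast

lemma Domain_op_sum:
  assumes "\<And>i. u \<in> Domain (A i)"
  shows "u \<in> Domain (op_sum A)"
proof -
  have "\<forall>i. \<exists>v. (u, v) \<in> A i" using assms by blast
  then obtain v where "\<forall>i. (u, v i) \<in> A i" by metis
  then show ?thesis unfolding op_sum_def by blast
qed

lemma Domain_op_tensor:
  assumes "\<And>r. \<Psi> $ r \<in> Domain A"
  shows "\<Psi> \<in> Domain (op_tensor A S)"
proof -
  have "\<forall>r. \<exists>\<eta>. (\<Psi> $ r, \<eta>) \<in> A" using assms by blast
  then obtain \<eta> where "\<forall>r. (\<Psi> $ r, \<eta> r) \<in> A" by metis
  then have "\<forall>r. (\<Psi> $ r, (\<chi> r. \<eta> r) $ r) \<in> A" by simp
  then show ?thesis unfolding op_tensor_def by blast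
qed

lemma Domain_hamiltonian:
  assumes "\<psi> \<in> Domain (dGamma norm)" "\<And>f. \<psi> \<in> Domain (segal f)"
  shows "product_state \<psi> a \<in> Domain (hamiltonian chi \<beta> x h)"
proof -
  have "cscale c \<psi> \<in> Domain (dGamma norm)" "cscale c \<psi> \<in> Domain (segal f)" for c f
    using assms dGamma_cscale segal_cscale by blast+
  then show ?thesis
    unfolding hamiltonian_def free_field_def B_quantum_def
    by (intro Domain_op_plus Domain_op_scale Domain_op_sum Domain_op_tensor) (auto simp: product_state_def)
qed

section \<open>Momentum cutoffs and approximation of coherent states\<close>

lemma AE_rep_photon_abs:
  assumes "photon_fun f"
  shows "AE k in lborel. rep_photon (abs_photon f) k = f k"
proof -
  have "photon_rel (rep_photon (abs_photon f)) f"
    using Quotient3_rep_abs[OF Quotient3_photon, of f] assms by (simp add: photon_rel_def)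
  then show ?thesis by (simp add: photon_rel_def)
qed

lemma photon_fun_cut: "photon_fun f \<Longrightarrow> photon_fun (\<lambda>k. indicator (cball 0 R) k *\<^sub>R f k)"
  by (rule photon_fun_scaleR[of f _ 1]) (auto simp: indicator_def)

lift_definition photon_cut :: "real \<Rightarrow> photon \<Rightarrow> photon" is "\<lambda>R f k. indicator (cball 0 R) k *\<^sub>R f k"
  unfolding photon_rel_def
  by (elim conjE, intro conjI photon_fun_cut, assumption+, rule AE_cong_unary)

definition wave_cut :: "real \<Rightarrow> photon \<times> photon \<Rightarrow> photon \<times> photon" where
  "wave_cut R f = (photon_cut R (fst f), photon_cut R (snd f))"

lemma AE_rep_photon_cut: "AE k in lborel. rep_photon (photon_cut R f) k = indicator (cball 0 R) k *\<^sub>R rep_photon f k"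
  unfolding photon_cut_def map_fun_def comp_def id_def
  by (rule AE_rep_photon_abs[OF photon_fun_cut[OF photon_fun_rep]])

lemma AE_wave_cut: "AE w in mode_measure. wave (wave_cut R f) w = indicator (cball 0 R) (fst w) * wave f w"
proof -
  have "AE k in lborel. rep_photon (photon_cut R (fst f)) k = indicator (cball 0 R) k *\<^sub>R rep_photon (fst f) k \<and>
     rep_photon (photon_cut R (snd f)) k = indicator (cball 0 R) k *\<^sub>R rep_photon (snd f) k"
    using AE_rep_photon_cut[of R "fst f"] AE_rep_photon_cut[of R "snd f"] by eventually_elim simp
  from AE_mode_measure[OF this] show ?thesis
    by eventually_elim (simp add: wave_def wave_cut_def complex_eq_iff indicator_def)
qed

lemma cut_measurable [measurable]:
  "(\<lambda>w. indicator (cball 0 R) (fst w) :: real) \<in> borel_measurable mode_measure"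
  "(\<lambda>w. indicator (cball 0 R) (fst w) :: complex) \<in> borel_measurable mode_measure"
  unfolding mode_measure_def
  by (intro measurable_compose[OF measurable_fst borel_measurable_indicator]; simp)+

lemma norm_wave_cut: "(\<integral>w. indicator (cball 0 R) (fst w) * (cmod (wave f w))\<^sup>2 \<partial>mode_measure) = (norm (wave_cut R f))\<^sup>2"
  unfolding integral_wave_norm[symmetric]
proof (rule integral_cong_AE)
  show "AE w in mode_measure. indicator (cball 0 R) (fst w) * (cmod (wave f w))\<^sup>2 = (cmod (wave (wave_cut R f) w))\<^sup>2"
    using AE_wave_cut[of R f] by eventually_elim (simp add: norm_mult indicator_def)
qed measurable

lemma norm_wave_cut_tendsto: "(\<lambda>i. (norm (wave_cut (real i) f))\<^sup>2) \<longlonglongrightarrow> (norm f)\<^sup>2"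
  unfolding norm_wave_cut[symmetric]
  unfolding integral_wave_norm[symmetric]
proof (rule integral_dominated_convergence[where w = "\<lambda>w. (cmod (wave f w))\<^sup>2"])
  show "integrable mode_measure (\<lambda>w. (cmod (wave f w))\<^sup>2)"
    using wave_sq_integrable[of f] by (simp add: sq_integrable_def)
  show "AE w in mode_measure. (\<lambda>i. indicator (cball 0 (real i)) (fst w) * (cmod (wave f w))\<^sup>2) \<longlonglongrightarrow> (cmod (wave f w))\<^sup>2"
  proof (rule AE_I2)
    fix w :: "(real^3) \<times> 3"
    have "\<forall>\<^sub>F i in sequentially. indicator (cball 0 (real i)) (fst w) * (cmod (wave f w))\<^sup>2 = (cmod (wave f w))\<^sup>2"
      using eventually_ge_at_top[of "nat \<lceil>norm (fst w)\<rceil>"]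
      by eventually_elim (auto simp: indicator_def)
    then show "(\<lambda>i. indicator (cball 0 (real i)) (fst w) * (cmod (wave f w))\<^sup>2) \<longlonglongrightarrow> (cmod (wave f w))\<^sup>2"
      by (rule tendsto_eventually)
  qed
  show "(\<lambda>w. indicator (cball 0 (real i)) (fst w) * (cmod (wave f w))\<^sup>2) \<in> borel_measurable mode_measure" for i
    by (intro borel_measurable_times cut_measurable borel_measurable_power
        measurable_compose[OF wave_measurable borel_measurable_norm])
qed (auto simp: indicator_def)

lemma integral_wave_cut: "(\<integral>w. wave f w * cnj (wave (wave_cut R f) w) \<partial>mode_measure) = of_real ((norm (wave_cut R f))\<^sup>2)"
  unfolding integral_wave_self[symmetric]
proof (rule integral_cong_AE)
  show "AE w in mode_measure. wave f w * cnj (wave (wave_cut R f) w)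
      = wave (wave_cut R f) w * cnj (wave (wave_cut R f) w)"
    using AE_wave_cut[of R f] by eventually_elim (simp add: indicator_def)
qed measurable

text \<open>The cutoff is an orthogonal projection, so the inner product of \<open>f\<close> with
  its cutoff is the squared norm of the cutoff. As inner products of tensor powers are powers of
  inner products, the squared distance is a difference of two powers of squared norms.\<close>

lemma tensor_power_cut_tendsto: "(\<lambda>i. tensor_power n (wave_cut (real i) f)) \<longlonglongrightarrow> tensor_power n f"
proof -
  have eq: "(norm (tensor_power n f - tensor_power n (wave_cut R f)))\<^sup>2 = ((norm f)\<^sup>2) ^ n - ((norm (wave_cut R f))\<^sup>2) ^ n" for R
  proof -
    have "tensor_power n f \<bullet> tensor_power n f = ((norm f)\<^sup>2) ^ n"
      "tensor_power n (wave_cut R f) \<bullet> tensor_power n (wave_cut R f) = ((norm (wave_cut R f))\<^sup>2) ^ n"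
      "tensor_power n f \<bullet> tensor_power n (wave_cut R f) = ((norm (wave_cut R f))\<^sup>2) ^ n"
      unfolding inner_fock_def cinner_tensor_power integral_wave_self integral_wave_cut
      by (simp_all flip: of_real_power)
    then show ?thesis
      by (simp add: power2_norm_eq_inner inner_diff_left inner_diff_right inner_commute)
  qed
  have "(\<lambda>i. ((norm f)\<^sup>2) ^ n - ((norm (wave_cut (real i) f))\<^sup>2) ^ n) \<longlonglongrightarrow> ((norm f)\<^sup>2) ^ n - ((norm f)\<^sup>2) ^ n"
    by (intro tendsto_diff tendsto_const tendsto_power norm_wave_cut_tendsto)
  then have "(\<lambda>i. (norm (tensor_power n f - tensor_power n (wave_cut (real i) f)))\<^sup>2) \<longlonglongrightarrow> 0"
    by (simp only: eq diff_self)
  then have "(\<lambda>i. sqrt ((norm (tensor_power n f - tensor_power n (wave_cut (real i) f)))\<^sup>2)) \<longlonglongrightarrow> sqrt 0"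
    by (rule tendsto_real_sqrt)
  then have "(\<lambda>i. norm (tensor_power n (wave_cut (real i) f) - tensor_power n f)) \<longlonglongrightarrow> 0"
    by (simp add: norm_minus_commute)
  then show ?thesis by (rule LIM_zero_cancel[OF tendsto_norm_zero_cancel])
qed

lemma bounded_linear_product_state: "bounded_linear (\<lambda>\<psi>. product_state \<psi> a)"
  unfolding product_state_def
proof (rule bounded_linear_intro)
  show "norm (\<chi> s. cscale (a $ s) \<psi>) \<le> norm \<psi> * norm a" for \<psi>
    unfolding norm_vec_def[of "vec_lambda _"] norm_vec_def[of a]
    by (simp add: norm_cscale L2_set_right_distrib mult.commute)
qed (simp_all add: vec_eq_iff cscale_add cscale_scaleR)

lemma closure_subspace_add:
  fixes S :: "'a::real_normed_vector set"
  assumes "subspace S" "u \<in> closure S" "v \<in> closure S"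
  shows "u + v \<in> closure S"
  using assms unfolding closure_sequential subspace_def by (metis (no_types, lifting) tendsto_add)

lemma closure_subspace_scaleR:
  fixes S :: "'a::real_normed_vector set"
  assumes "subspace S" "u \<in> closure S"
  shows "c *\<^sub>R u \<in> closure S"
  using assms unfolding closure_sequential subspace_def
  by (metis (no_types, lifting) tendsto_scaleR[OF tendsto_const])

text \<open>Multiplied by the modulus of the momentum, \<open>f\<close> may cease to be square
  integrable, so the coherent state itself can lie outside the domain. Tensor powers of cutoffs lie
  inside; their limits, linear combinations of these and finally the whole series stay in the
  closure.\<close>

lemma coherent_in_closure_Domain:
  assumes U: "unitary_group (hamiltonian chi \<beta> x h) U" and h: "0 < h"
  shows "product_state (coherent h f) a \<in> closure (Domain (hamiltonian chi \<beta> x h))"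
proof -
  interpret unitary_evolution "hamiltonian chi \<beta> x h" U by standard (rule U)
  let ?D = "Domain (hamiltonian chi \<beta> x h)"
  let ?p = "\<lambda>\<psi>. product_state \<psi> a"
  interpret p: bounded_linear ?p by (rule bounded_linear_product_state)
  note sub = subspace_Domain
  have cut: "?p (tensor_power n (wave_cut R f)) \<in> ?D" for n R
  proof (intro Domain_hamiltonian Domain_dGamma_norm[where R = R] Domain_segal)
    show "AE w in mode_measure. R < norm (fst w) \<longrightarrow> wave (wave_cut R f) w = 0"
      using AE_wave_cut[of R f] by eventually_elim (simp add: indicator_def)
  qed
  have T: "?p (tensor_power n f) \<in> closure ?D" for n
  proof -
    have lim: "(\<lambda>i. ?p (tensor_power n (wave_cut (real i) f))) \<longlonglongrightarrow> ?p (tensor_power n f)"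
      by (rule p.tendsto[OF tensor_power_cut_tendsto])
    with cut have "\<forall>i. ?p (tensor_power n (wave_cut (real i) f)) \<in> ?D" by blast
    with lim show ?thesis
      unfolding closure_sequential
      by (intro exI[of _ "\<lambda>i. ?p (tensor_power n (wave_cut (real i) f))"] conjI)
  qed
  obtain c where c: "(\<lambda>n. c n *\<^sub>R tensor_power n f) sums coherent h f"
    using coherent_sums(1)[OF h] by blast
  have "?p (\<Sum>n<m. c n *\<^sub>R tensor_power n f) \<in> closure ?D" for m
  proof (induction m)
    case 0
    have "0 \<in> closure ?D"
      by (rule subsetD[OF closure_subset]) (rule subspace_0[OF sub])
    then show ?case
      unfolding lessThan_0 sum.empty p.zero .
  next
    case (Suc m)
    then show ?case
      unfolding sum.lessThan_Suc p.add p.scaleR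
      by (rule closure_subspace_add[OF sub _ closure_subspace_scaleR[OF sub T]])
  qed
  moreover have "(\<lambda>m. ?p (\<Sum>n<m. c n *\<^sub>R tensor_power n f)) \<longlonglongrightarrow> ?p (coherent h f)"
    by (rule p.tendsto) (use c in \<open>simp only: sums_def\<close>)
  ultimately show ?thesis
    by (rule closed_sequentially[OF closed_closure])
qed

section \<open>The classical system\<close>

lemma AE_rep_photon_add: "AE k in lborel. rep_photon (f + g) k = rep_photon f k + rep_photon g k"
  unfolding plus_photon_def map_fun_def comp_def id_def
  by (rule AE_rep_photon_abs[OF photon_fun_add[OF photon_fun_rep photon_fun_rep]])

lemma AE_rep_photon_scaleR: "AE k in lborel. rep_photon (r *\<^sub>R f) k = r *\<^sub>R rep_photon f k"
  unfolding scaleR_photon_def map_fun_def comp_def id_def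
  by (rule AE_rep_photon_abs[OF photon_fun_scale[OF photon_fun_rep]])

lemma AE_rep_photon_cos: "AE k in lborel. rep_photon (photon_cos t f) k = cos (t * norm k) *\<^sub>R rep_photon f k"
  unfolding photon_cos_def map_fun_def comp_def id_def
  by (rule AE_rep_photon_abs[OF photon_fun_cos[OF photon_fun_rep]])

lemma AE_rep_photon_sin: "AE k in lborel. rep_photon (photon_sin t f) k = sin (t * norm k) *\<^sub>R rep_photon f k"
  unfolding photon_sin_def map_fun_def comp_def id_def
  by (rule AE_rep_photon_abs[OF photon_fun_sin[OF photon_fun_rep]])

text \<open>In complex notation the free flow multiplies \<open>q + ip\<close> by a phase.\<close>

lemma norm_free_flow: "norm (free_flow t X) = norm X"
proof -
  obtain q p where X: "X = (q, p)" by (cases X)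
  let ?Y = "free_flow t (q, p)"
  have "AE k in lborel. rep_photon (fst ?Y) k = cos (t * norm k) *\<^sub>R rep_photon q k + sin (t * norm k) *\<^sub>R rep_photon p k"
    using AE_rep_photon_add[of "photon_cos t q" "photon_sin t p"] AE_rep_photon_cos[of t q] AE_rep_photon_sin[of t p]
    by eventually_elim simp
  moreover have "AE k in lborel. rep_photon (snd ?Y) k = - sin (t * norm k) *\<^sub>R rep_photon q k + cos (t * norm k) *\<^sub>R rep_photon p k"
    using AE_rep_photon_add[of "(-1) *\<^sub>R photon_sin t q" "photon_cos t p"] AE_rep_photon_scaleR[of "-1" "photon_sin t q"]
      AE_rep_photon_cos[of t p] AE_rep_photon_sin[of t q]
    by eventually_elim simp
  ultimately have "AE k in lborel.
      rep_photon (fst ?Y) k = cos (t * norm k) *\<^sub>R rep_photon q k + sin (t * norm k) *\<^sub>R rep_photon p k \<and>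
      rep_photon (snd ?Y) k = - sin (t * norm k) *\<^sub>R rep_photon q k + cos (t * norm k) *\<^sub>R rep_photon p k"
    by eventually_elim simp
  from AE_mode_measure[OF this]
  have "AE w in mode_measure. (cmod (wave ?Y w))\<^sup>2 = (cmod (wave (q, p) w))\<^sup>2"
  proof eventually_elim
    case (elim w)
    let ?q = "rep_photon q (fst w) $ snd w" and ?p = "rep_photon p (fst w) $ snd w"
    have "wave ?Y w = cis (- (t * norm (fst w))) * wave (q, p) w"
      using elim by (simp add: wave_def complex_eq_iff)
    then show ?case by (simp add: norm_mult)
  qed
  then have "(\<integral>w. (cmod (wave ?Y w))\<^sup>2 \<partial>mode_measure) = (\<integral>w. (cmod (wave (q, p) w))\<^sup>2 \<partial>mode_measure)"
    by (intro integral_cong_AE) measurable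
  then show ?thesis unfolding X by (simp only: integral_wave_norm norm_ge_zero power2_eq_iff_nonneg)
qed

text \<open>The integral of a function that is not integrable is \<open>0\<close> by convention, so
  a pointwise bound suffices. The application is to the photon-valued source term of the Duhamel
  formula.\<close>

lemma norm_time_integral_le:
  assumes B: "0 \<le> B" "\<And>s. norm (f s) \<le> B"
  shows "norm (time_integral f t) \<le> B * \<bar>t\<bar>"
proof -
  have "norm (integral {a..b} f) \<le> B * (b - a)" if "a \<le> b" for a b
  proof (cases "f integrable_on {a..b}")
    case True
    have "norm (integral {a..b} f) \<le> B * measure lborel (cbox a b)"
      by (rule has_integral_bound[OF B(1)]) (use integrable_integral[OF True] B in auto)
    then show ?thesis using that by simp
  next
    case False
    then show ?thesis using B that by (simp add: not_integrable_integral)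
  qed
  from this[of 0 t] this[of t 0] show ?thesis
    by (auto simp: time_integral_def)
qed

lemma time_integral_derivative:
  fixes f :: "real \<Rightarrow> real"
  assumes f: "continuous_on UNIV f"
  shows "(time_integral f has_real_derivative f t) (at t)"
proof -
  \<comment> \<open>With \<open>t\<close> and \<open>0\<close> both inside the interval from
    \<open>- c\<close> to \<open>c\<close>, integration from \<open>- c\<close> treats both signs of
    time at once.\<close>
  define c where "c = \<bar>t\<bar> + 1"
  have c: "0 \<le> c" by (simp add: c_def)
  have int: "f integrable_on {a..b}" for a b
    by (rule integrable_continuous_real) (rule continuous_on_subset[OF f], simp)
  have eq: "time_integral f u = integral {- c..u} f - integral {- c..0} f" if "u \<in> {- c..c}" for u
  proof (cases "0 \<le> u")
    case True
    have "integral {- c..0} f + integral {0..u} f = integral {- c..u} f"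
      by (rule Henstock_Kurzweil_Integration.integral_combine) (use True c int in auto)
    then show ?thesis using True by (simp add: time_integral_def)
  next
    case False
    have "integral {- c..u} f + integral {u..0} f = integral {- c..0} f"
      by (rule Henstock_Kurzweil_Integration.integral_combine) (use False that int in auto)
    then show ?thesis using False by (simp add: time_integral_def)
  qed
  have t: "t \<in> {- c<..<c}" by (auto simp: c_def)
  have "((\<lambda>u. integral {- c..u} f - integral {- c..0} f) has_real_derivative f t) (at t within {- c..c})"
    using integral_has_real_derivative[of "- c" c f t] continuous_on_subset[OF f] t
    by (auto intro!: derivative_eq_intros)
  then have "((\<lambda>u. integral {- c..u} f - integral {- c..0} f) has_real_derivative f t) (at t)"
    using t by (simp add: at_within_Icc_at)
  moreover have "\<forall>\<^sub>F u in nhds t. u \<in> {- c<..<c}"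
    by (rule eventually_nhds_in_open) (use t in auto)
  then have "\<forall>\<^sub>F u in nhds t. time_integral f u = integral {- c..u} f - integral {- c..0} f"
    by eventually_elim (rule eq, simp)
  ultimately show ?thesis
    by (subst DERIV_cong_ev[OF refl _ refl])
qed

lemma inner_complex_matrix: "inner A B = Re (trace (A ** cadjoint B))"
  by (simp add: inner_vec_def trace_def matrix_matrix_mult_def cadjoint_def inner_complex_def)

text \<open>The adjoint action is skew for the real trace inner product, by cyclicity of the trace.
  This invariance is what places coadjoint orbits on spheres.\<close>

lemma bracket_antisymmetric:
  "inner (matrix_of (bracket X Y)) (matrix_of Z) = - inner (matrix_of Y) (matrix_of (bracket X Z))"
proof -
  let ?X = "matrix_of X" and ?Y = "matrix_of Y" and ?Z = "matrix_of Z"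
  have ah: "cadjoint (matrix_of W) = - matrix_of W" for W
    using matrix_of[of W] by simp
  have neg: "trace (A ** - B) = - trace (A ** B)" for A B :: "complex ^ 'a ^ 'a"
    by (simp add: trace_def matrix_matrix_mult_def sum_negf)
  have diff: "trace ((A - B) ** C) = trace (A ** C) - trace (B ** C)"
    "trace (C ** (A - B)) = trace (C ** A) - trace (C ** B)" for A B C :: "complex ^ 'a ^ 'a"
    by (simp_all add: trace_def matrix_matrix_mult_def sum_subtractf left_diff_distrib right_diff_distrib)
  have "trace (?X ** ?Y ** ?Z) = trace (?Y ** (?Z ** ?X))"
    by (metis matrix_mul_assoc trace_mul_sym)
  moreover have "trace (?Y ** ?X ** ?Z) = trace (?Y ** (?X ** ?Z))"
    by (simp add: matrix_mul_assoc)
  ultimately show ?thesis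
    by (simp add: inner_complex_matrix ah ah[of "bracket X Z", unfolded bracket.rep_eq] neg bracket.rep_eq diff)
qed

text \<open>The type \<open>su\<close> carries only a norm, so the basis is taken in the space of
  matrices, whose inner product induces that norm, and transported back.\<close>

lemma su_orthonormal_basis:
  obtains B :: "'d::finite su set" where "finite B" "\<And>b. b \<in> B \<Longrightarrow> norm b = 1"
    "\<And>Y. Y = (\<Sum>b\<in>B. inner (matrix_of Y) (matrix_of b) *\<^sub>R b)"
proof -
  let ?S = "{A :: complex ^ 'd ^ 'd. cadjoint A = - A \<and> trace A = 0}"
  have S: "subspace ?S"
    by (auto simp: subspace_def cadjoint_def trace_def vec_eq_iff sum.distrib simp flip: scaleR_sum_right)
  obtain B where B: "B \<subseteq> ?S" "pairwise orthogonal B" "\<And>x. x \<in> B \<Longrightarrow> norm x = 1" "independent B"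
    "card B = dim ?S" "span B = ?S"
    by (rule orthonormal_basis_subspace[OF S]) (rule that, assumption+)
  have fin: "finite B" using B(4) by (rule independent_imp_finite)
  have m: "matrix_of (su_of b) = b" if "b \<in> B" for b
    by (rule su_of_inverse, rule subsetD[OF B(1) that])
  have inj: "inj_on su_of B" using m by (metis inj_onI)
  have sum: "matrix_of (\<Sum>i\<in>I. f i) = (\<Sum>i\<in>I. matrix_of (f i))" for f :: "'i \<Rightarrow> 'd su" and I
    by (induction I rule: infinite_finite_induct) (simp_all add: zero_su.rep_eq plus_su.rep_eq)
  show thesis
  proof (rule that[of "su_of ` B"])
    show "norm b = 1" if "b \<in> su_of ` B" for b
      using that B(3) m by (auto simp: norm_su.rep_eq)
    show "Y = (\<Sum>b\<in>su_of ` B. inner (matrix_of Y) (matrix_of b) *\<^sub>R b)" for Y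
    proof -
      have "(\<Sum>b\<in>B. inner (matrix_of Y) b *\<^sub>R b) = matrix_of Y"
      proof (rule orthonormal_basis_expand[OF B(2) _ _ fin])
        show "matrix_of Y \<in> span B" unfolding B(6) by (rule matrix_of)
      qed (rule B(3))
      then have "matrix_of Y = (\<Sum>b\<in>B. inner (matrix_of Y) b *\<^sub>R b)"
        by (rule sym)
      also have "\<dots> = matrix_of (\<Sum>b\<in>su_of ` B. inner (matrix_of Y) (matrix_of b) *\<^sub>R b)"
        unfolding sum.reindex[OF inj] sum by (simp add: m scaleR_su.rep_eq)
      finally show ?thesis by (simp only: matrix_of_inject)
    qed
  qed (use fin in simp)
qed

text \<open>In an orthonormal basis of the Lie algebra the coordinates of \<open>\<omega>\<close>
  have a conserved sum of squares \<open>W\<close>. It is fixed by \<open>\<omega>0\<close>, so the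
  resulting constant is the same for all \<open>h\<close>, all photon trajectories and all
  times.\<close>

lemma weak_solution_spin_bound:
  fixes \<omega>0 :: "('n::finite \<Rightarrow> 2) su \<Rightarrow>\<^sub>L real" and x :: "'n \<Rightarrow> real^3"
  shows "\<exists>K\<ge>0. \<forall>h q p \<omega> t Y. weak_solution chi \<beta> x h q p \<omega> \<longrightarrow> \<omega> 0 = \<omega>0 \<longrightarrow>
    \<bar>blinfun_apply (\<omega> t) Y\<bar> \<le> K * norm Y"
proof -
  obtain B :: "('n \<Rightarrow> 2) su set" where B: "finite B" "\<And>b. b \<in> B \<Longrightarrow> norm b = 1"
    "\<And>Y. Y = (\<Sum>b\<in>B. inner (matrix_of Y) (matrix_of b) *\<^sub>R b)"
    using su_orthonormal_basis by blast
  define W where "W = (\<Sum>b\<in>B. (blinfun_apply \<omega>0 b)\<^sup>2)"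
  have W: "0 \<le> W" by (auto simp: W_def intro: sum_nonneg)
  have "\<bar>blinfun_apply (\<omega> t) Y\<bar> \<le> (card B * sqrt W) * norm Y"
    if ws: "weak_solution chi \<beta> x h q p \<omega>" and \<omega>0: "\<omega> 0 = \<omega>0" for h q p \<omega> t Y
  proof -
    let ?c = "\<lambda>l m s. \<beta> $ m + B_classical chi m (x l) (q s) (p s)"
    let ?g = "\<lambda>Y s. \<Sum>l\<in>UNIV. \<Sum>m\<in>UNIV. ?c l m s * blinfun_apply (\<omega> s) (bracket (i_sigma l m) Y)"
    have cont: "continuous_on UNIV (\<lambda>t. (q t, p t, \<omega> t))"
      and int: "\<And>t Y. blinfun_apply (\<omega> t) Y = blinfun_apply (\<omega> 0) Y + time_integral (?g Y) t"
      using ws unfolding weak_solution_def by blast+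
    have cq: "continuous_on UNIV q" and cp: "continuous_on UNIV p" and c\<omega>: "continuous_on UNIV \<omega>"
      using continuous_on_fst[OF cont] continuous_on_fst[OF continuous_on_snd[OF cont]]
        continuous_on_snd[OF continuous_on_snd[OF cont]] by simp_all
    have "continuous_on UNIV (?g Y)" for Y
      unfolding B_classical_def
      by (intro continuous_on_sum continuous_on_mult continuous_on_add continuous_on_const
          continuous_on_inner cq cp blinfun.continuous_on c\<omega>)
    then have "((\<lambda>t. blinfun_apply (\<omega> 0) Y + time_integral (?g Y) t) has_real_derivative 0 + ?g Y t) (at t)" for Y t
      by (intro DERIV_add DERIV_const time_integral_derivative)
    then have d: "((\<lambda>t. blinfun_apply (\<omega> t) Y) has_real_derivative ?g Y t) (at t)" for Y t
      by (simp only: int[symmetric] add_0_left)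
    have expand: "blinfun_apply (\<omega> s) (bracket Z b) = (\<Sum>b'\<in>B. inner (matrix_of (bracket Z b)) (matrix_of b') * blinfun_apply (\<omega> s) b')" for s Z b
      using arg_cong[OF B(3)[of "bracket Z b"], of "blinfun_apply (\<omega> s)"]
      by (simp only: blinfun.sum_right blinfun.scaleR_right real_scaleR_def)
    \<comment> \<open>The matrix of an adjoint action in an orthonormal basis is antisymmetric, and
      here it is contracted with the symmetric products of the coordinates.\<close>
    have zero: "(\<Sum>b\<in>B. blinfun_apply (\<omega> s) b * blinfun_apply (\<omega> s) (bracket Z b)) = 0" for s Z
    proof -
      let ?M = "\<lambda>b b'. blinfun_apply (\<omega> s) b * (inner (matrix_of (bracket Z b)) (matrix_of b') * blinfun_apply (\<omega> s) b')"
      have "(\<Sum>b\<in>B. \<Sum>b'\<in>B. ?M b b') = (\<Sum>b\<in>B. \<Sum>b'\<in>B. ?M b' b)"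
        by (rule sum.swap)
      also have "\<dots> = (\<Sum>b\<in>B. \<Sum>b'\<in>B. - ?M b b')"
      proof (intro sum.cong refl)
        fix b b'
        have "inner (matrix_of (bracket Z b')) (matrix_of b) = - inner (matrix_of (bracket Z b)) (matrix_of b')"
          unfolding bracket_antisymmetric[of Z b' b] by (rule arg_cong[OF inner_commute])
        then show "?M b' b = - ?M b b'" by (simp only: mult_minus_left mult_minus_right mult.assoc mult.commute mult.left_commute)
      qed
      finally have "(\<Sum>b\<in>B. \<Sum>b'\<in>B. ?M b b') = - (\<Sum>b\<in>B. \<Sum>b'\<in>B. ?M b b')"
        by (simp only: sum_negf)
      then have "(\<Sum>b\<in>B. \<Sum>b'\<in>B. ?M b b') = 0" by linarith
      then show ?thesis unfolding expand sum_distrib_left .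
    qed
    have "((\<lambda>t. \<Sum>b\<in>B. (blinfun_apply (\<omega> t) b)\<^sup>2) has_real_derivative 0) (at s)" for s
    proof -
      have "((\<lambda>t. \<Sum>b\<in>B. (blinfun_apply (\<omega> t) b)\<^sup>2) has_real_derivative
          (\<Sum>b\<in>B. 2 * (blinfun_apply (\<omega> s) b * ?g b s))) (at s)"
      proof (rule DERIV_sum)
        fix b
        have "x * y + x * y = 2 * (y * x)" for x y :: real by simp
        then show "((\<lambda>t. (blinfun_apply (\<omega> t) b)\<^sup>2) has_real_derivative 2 * (blinfun_apply (\<omega> s) b * ?g b s)) (at s)"
          unfolding power2_eq_square by (rule DERIV_cong[OF DERIV_mult[OF d d]])
      qed
      moreover have "(\<Sum>b\<in>B. 2 * (blinfun_apply (\<omega> s) b * ?g b s))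
        = (\<Sum>b\<in>B. \<Sum>l\<in>UNIV. \<Sum>m\<in>UNIV. 2 * ?c l m s * (blinfun_apply (\<omega> s) b * blinfun_apply (\<omega> s) (bracket (i_sigma l m) b)))"
        unfolding sum_distrib_left by (intro sum.cong refl) simp
      moreover have "\<dots> = (\<Sum>l\<in>UNIV. \<Sum>m\<in>UNIV. 2 * ?c l m s *
          (\<Sum>b\<in>B. blinfun_apply (\<omega> s) b * blinfun_apply (\<omega> s) (bracket (i_sigma l m) b)))"
        unfolding sum_distrib_left by (subst sum.swap, rule sum.cong[OF refl], rule sum.swap)
      ultimately show ?thesis by (simp only: zero mult_zero_right sum.neutral_const)
    qed
    then have "(\<Sum>b\<in>B. (blinfun_apply (\<omega> t) b)\<^sup>2) = (\<Sum>b\<in>B. (blinfun_apply (\<omega> 0) b)\<^sup>2)"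
      by (intro DERIV_isconst_all) blast
    then have cons: "(\<Sum>b\<in>B. (blinfun_apply (\<omega> t) b)\<^sup>2) = W" by (simp only: W_def \<omega>0)
    have comp: "\<bar>blinfun_apply (\<omega> t) b\<bar> \<le> sqrt W" if "b \<in> B" for b
    proof (rule real_le_rsqrt)
      show "\<bar>blinfun_apply (\<omega> t) b\<bar>\<^sup>2 \<le> W"
        unfolding cons[symmetric] using member_le_sum[OF that, of "\<lambda>b. (blinfun_apply (\<omega> t) b)\<^sup>2"] B(1) by simp
    qed
    have "blinfun_apply (\<omega> t) Y = (\<Sum>b\<in>B. inner (matrix_of Y) (matrix_of b) * blinfun_apply (\<omega> t) b)"
      using arg_cong[OF B(3)[of Y], of "blinfun_apply (\<omega> t)"]
      by (simp only: blinfun.sum_right blinfun.scaleR_right real_scaleR_def)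
    then have "\<bar>blinfun_apply (\<omega> t) Y\<bar> \<le> (\<Sum>b\<in>B. \<bar>inner (matrix_of Y) (matrix_of b)\<bar> * \<bar>blinfun_apply (\<omega> t) b\<bar>)"
      by (simp only: abs_mult[symmetric] sum_abs)
    also have "\<dots> \<le> (\<Sum>b\<in>B. norm Y * sqrt W)"
    proof (intro sum_mono mult_mono comp)
      fix b assume "b \<in> B"
      then show "\<bar>inner (matrix_of Y) (matrix_of b)\<bar> \<le> norm Y"
        using Cauchy_Schwarz_ineq2[of "matrix_of Y" "matrix_of b"] B(2) by (simp add: norm_su.rep_eq)
    qed auto
    finally show ?thesis by (simp add: mult_ac)
  qed
  then show ?thesis using W by (intro exI[of _ "card B * sqrt W"]) auto
qed

text \<open>\<open>K\<close> precedes \<open>h\<close> among the quantifiers, as the uniform spin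
  bound permits; only then does the factor \<open>h\<close> on the right express smallness.\<close>

lemma weak_solution_photon_bound:
  fixes x :: "'n::finite \<Rightarrow> real^3" and \<omega>0 :: "('n \<Rightarrow> 2) su \<Rightarrow>\<^sub>L real"
  shows "\<exists>K\<ge>0. \<forall>h q p \<omega> t. 0 < h \<longrightarrow> weak_solution chi \<beta> x h q p \<omega> \<longrightarrow> \<omega> 0 = \<omega>0 \<longrightarrow>
    \<bar>norm (q t, p t) - norm (q 0, p 0)\<bar> \<le> h * K * \<bar>t\<bar>"
proof -
  obtain K0 where K0: "0 \<le> K0" and \<omega>_le: "\<And>h q p \<omega> t Y. weak_solution chi \<beta> x h q p \<omega> \<Longrightarrow> \<omega> 0 = \<omega>0 \<Longrightarrow>
    \<bar>blinfun_apply (\<omega> t) Y\<bar> \<le> K0 * norm Y"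
    using weak_solution_spin_bound[of chi \<beta> x \<omega>0] by blast
  define K where "K = (\<Sum>l\<in>UNIV. \<Sum>m\<in>UNIV. K0 * norm (i_sigma l m) * norm (b_field chi m (x l)))
    + (\<Sum>l\<in>UNIV. \<Sum>m\<in>UNIV. K0 * norm (i_sigma l m) * norm (a_field chi m (x l)))"
  have K: "0 \<le> K" unfolding K_def using K0 by (intro add_nonneg_nonneg sum_nonneg) auto
  have "\<bar>norm (q t, p t) - norm (q 0, p 0)\<bar> \<le> h * K * \<bar>t\<bar>"
    if h: "0 < h" and ws: "weak_solution chi \<beta> x h q p \<omega>" and \<omega>0: "\<omega> 0 = \<omega>0" for h q p \<omega> t
  proof -
    let ?F = "\<lambda>s. free_flow (t - s) (Q_source chi x h (\<omega> s), P_source chi x h (\<omega> s))"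
    note \<omega>_le = \<omega>_le[OF ws \<omega>0]
    have sum_le: "norm (\<Sum>l\<in>UNIV. \<Sum>m\<in>UNIV. blinfun_apply (\<omega> s) (i_sigma l m) *\<^sub>R f l m)
      \<le> (\<Sum>l\<in>UNIV. \<Sum>m\<in>UNIV. K0 * norm (i_sigma l m) * norm (f l m))" for s and f :: "'n \<Rightarrow> 3 \<Rightarrow> photon"
      by (intro sum_norm_le) (auto intro!: sum_norm_le mult_right_mono \<omega>_le)
    have "norm (?F s) \<le> h * K" for s
    proof -
      have "norm (?F s) \<le> norm (Q_source chi x h (\<omega> s)) + norm (P_source chi x h (\<omega> s))"
        by (rule ord_eq_le_trans[OF norm_free_flow]) (simp add: norm_prod_def sqrt_sum_squares_le_sum)
      also have "\<dots> \<le> h * K"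
        unfolding Q_source_def P_source_def K_def norm_minus_cancel norm_scaleR distrib_left
        using h by (intro add_mono mult_mono sum_le) auto
      finally show ?thesis .
    qed
    then have I: "norm (time_integral ?F t) \<le> h * K * \<bar>t\<bar>"
      using h K by (intro norm_time_integral_le) auto
    have "(q t, p t) = free_flow t (q 0, p 0) + time_integral ?F t"
      using ws unfolding weak_solution_def by blast
    then have "norm ((q t, p t) - free_flow t (q 0, p 0)) \<le> h * K * \<bar>t\<bar>" using I by simp
    then show ?thesis
      using norm_triangle_ineq3[of "(q t, p t)" "free_flow t (q 0, p 0)"] unfolding norm_free_flow by linarith
  qed
  then show ?thesis using K by blast
qed

section \<open>Moments of the number operator\<close>

text \<open>For a unit vector these numbers are the probabilities of finding \<open>k\<close>
  photons, whatever the spins.\<close>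

definition state_sq :: "nat \<Rightarrow> 'n::finite state \<Rightarrow> real" where
  "state_sq k \<Psi> = (\<Sum>s\<in>UNIV. sector_sq k (\<Psi> $ s))"

lemma state_sq_nonneg [simp]: "0 \<le> state_sq k \<Psi>"
  by (simp add: state_sq_def sum_nonneg)

lemma state_weight_sums:
  assumes "bounded_weight w B"
  shows "(\<lambda>k. w k * state_sq k \<Psi>) sums (state_weight w \<Psi> \<bullet> \<Psi>)"
  unfolding state_sq_def sum_distrib_left inner_vec_def state_weight_def
  using sums_sum[of UNIV "\<lambda>s k. w k * sector_sq k (\<Psi> $ s)" "\<lambda>s. weight_op w (\<Psi> $ s) \<bullet> \<Psi> $ s"]
    bounded_weight.inner_weight_self_sums[OF assms] by simp

lemma state_sq_sums: "(\<lambda>k. state_sq k \<Psi>) sums (norm \<Psi>)\<^sup>2"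
  unfolding state_sq_def power2_norm_eq_inner inner_vec_def
  using sums_sum[of UNIV "\<lambda>s k. sector_sq k (\<Psi> $ s)" "\<lambda>s. (norm (\<Psi> $ s))\<^sup>2"] norm_fock_sums
  by (simp add: power2_norm_eq_inner)

lemma bounded_weight_min:
  fixes W :: "nat \<Rightarrow> real"
  assumes "\<And>n. 0 \<le> W n" "mono W"
  shows "bounded_weight (\<lambda>n. W (min n L)) (W L)"
proof
  show "\<bar>W (min n L)\<bar> \<le> W L" for n
    using assms(1)[of "min n L"] monoD[OF assms(2), of "min n L" L] by simp
qed

lemma truncated_le:
  fixes W :: "nat \<Rightarrow> real" and \<Psi> :: "'n::finite state"
  assumes W: "\<And>n. 0 \<le> W n" "mono W" and s: "summable (\<lambda>k. W k * state_sq k \<Psi>)"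
  shows "state_weight (\<lambda>n. W (min n L)) \<Psi> \<bullet> \<Psi> \<le> (\<Sum>k. W k * state_sq k \<Psi>)"
  by (rule sums_le[OF _ state_weight_sums[OF bounded_weight_min[OF W]] summable_sums[OF s]])
     (intro mult_right_mono monoD[OF W(2)], auto)

text \<open>Monotone convergence: below \<open>m\<close> the weight truncated at \<open>m\<close> is
  the full weight, so the partial sums of the moment are dominated by truncated moments.\<close>

lemma truncated_bound:
  fixes W :: "nat \<Rightarrow> real" and \<Psi> :: "'n::finite state"
  assumes W: "\<And>n. 0 \<le> W n" "mono W"
    and b: "\<And>L. state_weight (\<lambda>n. W (min n L)) \<Psi> \<bullet> \<Psi> \<le> M"
  shows "summable (\<lambda>k. W k * state_sq k \<Psi>)" and "(\<Sum>k. W k * state_sq k \<Psi>) \<le> M"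
proof -
  have part: "(\<Sum>k<m. W k * state_sq k \<Psi>) \<le> M" for m
  proof -
    have "(\<Sum>k<m. W k * state_sq k \<Psi>) = (\<Sum>k<m. W (min k m) * state_sq k \<Psi>)"
      by (intro sum.cong) auto
    also have "\<dots> \<le> state_weight (\<lambda>n. W (min n m)) \<Psi> \<bullet> \<Psi>"
      using sum_le_suminf[of "\<lambda>k. W (min k m) * state_sq k \<Psi>" "{..<m}"]
        state_weight_sums[OF bounded_weight_min[OF W, of m], of \<Psi>] W(1)
      by (simp add: sums_iff)
    also have "\<dots> \<le> M" by (rule b)
    finally show ?thesis .
  qed
  show s: "summable (\<lambda>k. W k * state_sq k \<Psi>)"
    by (rule summableI_nonneg_bounded[where x = M]) (use part W(1) in auto)
  show "(\<Sum>k. W k * state_sq k \<Psi>) \<le> M"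
    using s part by (rule suminf_le_const)
qed

lemma field_bound_nonneg: "0 \<le> field_bound chi x"
  unfolding field_bound_def by (intro sum_nonneg) auto

text \<open>Truncation at \<open>L\<close> keeps the increment condition with the same
  \<open>C\<close>, as increments beyond \<open>L\<close> vanish; the bounds are therefore uniform
  in \<open>L\<close>. The backward estimate comes last because it presupposes that the moment at
  time \<open>t / h\<close> is finite.\<close>

lemma moment_evolution:
  fixes W :: "nat \<Rightarrow> real" and \<Psi> :: "'n::finite state" and t :: real
  assumes U: "unitary_group (hamiltonian chi \<beta> x h) U" and h: "0 < h"
    and \<Psi>: "\<Psi> \<in> closure (Domain (hamiltonian chi \<beta> x h))"
    and W: "\<And>n. 0 \<le> W n" "mono W" and C: "0 \<le> C"
    and increment: "\<And>n a b. 0 \<le> a \<Longrightarrow> 0 \<le> b \<Longrightarrow>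
      sqrt h * (W (Suc n) - W n) * sqrt (Suc n) * (a * b) \<le> C * (W n * a\<^sup>2 + W (Suc n) * b\<^sup>2)"
    and s: "summable (\<lambda>k. W k * state_sq k \<Psi>)"
  defines "E \<equiv> exp (2 * (field_bound chi x * C) * \<bar>t\<bar>)"
  shows "summable (\<lambda>k. W k * state_sq k (U (t / h) \<Psi>))"
    and "(\<Sum>k. W k * state_sq k (U (t / h) \<Psi>)) \<le> (\<Sum>k. W k * state_sq k \<Psi>) * E"
    and "(\<Sum>k. W k * state_sq k \<Psi>) \<le> (\<Sum>k. W k * state_sq k (U (t / h) \<Psi>)) * E"
proof -
  interpret unitary_evolution "hamiltonian chi \<beta> x h" U by standard (rule U)
  let ?w = "\<lambda>L n. W (min n L)" and ?u = "U (t / h) \<Psi>"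
  let ?k = "h * (field_bound chi x * C)"
  \<comment> \<open>The factor \<open>h\<close> of the commutator bound cancels against the time
    \<open>t / h\<close>.\<close>
  have E: "E = exp (2 * ?k * \<bar>t / h\<bar>)" "0 \<le> E"
    using h by (simp_all add: E_def abs_divide)
  have comm: "\<bar>Im (cinner_state (state_weight (\<lambda>n. ?w L n - ?w L L) \<Psi>) \<Phi>)\<bar> \<le> ?k * (state_weight (?w L) \<Psi> \<bullet> \<Psi>)"
    if "(\<Psi>, \<Phi>) \<in> hamiltonian chi \<beta> x h" for \<Psi> \<Phi> L
  proof (rule hamiltonian_weight_commutator[OF that h, where w = "?w L"])
    show "bounded_weight (?w L) (W L)" by (rule bounded_weight_min[OF W])
    show "sqrt h * \<bar>?w L (Suc n) - ?w L n\<bar> * sqrt (Suc n) * (a * b) \<le> C * (?w L n * a\<^sup>2 + ?w L (Suc n) * b\<^sup>2)"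
      if "0 \<le> a" "0 \<le> b" for n a b
    proof (cases "n < L")
      case True
      then have "min n L = n" "min (Suc n) L = Suc n" by auto
      then show ?thesis
        using increment[OF that, of n] monoD[OF W(2), of n "Suc n"] by simp
    next
      case False
      then have "min n L = L" "min (Suc n) L = L" by auto
      then show ?thesis using C W(1)[of L] by simp
    qed
  qed (use W C in auto)
  have ev: "state_weight (?w L) ?u \<bullet> ?u \<le> (state_weight (?w L) \<Psi> \<bullet> \<Psi>) * E" for L
    unfolding E(1) by (rule weight_evolution(1)[OF bounded_weight_min[OF W] comm \<Psi>])
  have ev': "state_weight (?w L) \<Psi> \<bullet> \<Psi> \<le> (state_weight (?w L) ?u \<bullet> ?u) * E" for L
    unfolding E(1) by (rule weight_evolution(2)[OF bounded_weight_min[OF W] comm \<Psi>])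
  have b1: "state_weight (?w L) ?u \<bullet> ?u \<le> (\<Sum>k. W k * state_sq k \<Psi>) * E" for L
    using ev[of L] mult_right_mono[OF truncated_le[OF W s, of L] E(2)] by linarith
  show s': "summable (\<lambda>k. W k * state_sq k ?u)"
    and "(\<Sum>k. W k * state_sq k ?u) \<le> (\<Sum>k. W k * state_sq k \<Psi>) * E"
    by (rule truncated_bound[OF W b1])+
  have b2: "state_weight (?w L) \<Psi> \<bullet> \<Psi> \<le> (\<Sum>k. W k * state_sq k ?u) * E" for L
    using ev'[of L] mult_right_mono[OF truncated_le[OF W s', of L] E(2)] by linarith
  show "(\<Sum>k. W k * state_sq k \<Psi>) \<le> (\<Sum>k. W k * state_sq k ?u) * E"
    by (rule truncated_bound(2)[OF W b2])
qed

text \<open>Attaching the factor \<open>sqrt h * sqrt (Suc n)\<close> to \<open>b\<close> balances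
  it against the weight \<open>1 + h * Suc n\<close>. That the constant is \<open>h\<close>, and not
  a fixed number, is the source of the smallness of the quantum error.\<close>

lemma linear_increment:
  assumes h: "0 < h" "h < 1" and a: "0 \<le> a" "0 \<le> (b::real)"
  shows "sqrt h * ((1 + h * real (Suc n)) - (1 + h * real n)) * sqrt (Suc n) * (a * b)
    \<le> h * ((1 + h * real n) * a\<^sup>2 + (1 + h * real (Suc n)) * b\<^sup>2)"
proof -
  let ?y = "sqrt h * sqrt (real (Suc n)) * b"
  have "a * ?y \<le> a\<^sup>2 + ?y\<^sup>2"
    using norm_mult_le_sq[of a ?y] by (simp only: real_norm_def power2_abs abs_mult[symmetric])
  also have "?y\<^sup>2 = h * real (Suc n) * b\<^sup>2"
    using h by (simp add: power_mult_distrib)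
  also have "a\<^sup>2 + h * real (Suc n) * b\<^sup>2 \<le> (1 + h * real n) * a\<^sup>2 + (1 + h * real (Suc n)) * b\<^sup>2"
    using h by (simp add: distrib_right)
  finally have "h * (a * ?y) \<le> h * ((1 + h * real n) * a\<^sup>2 + (1 + h * real (Suc n)) * b\<^sup>2)"
    using h by (intro mult_left_mono) auto
  moreover have "sqrt h * ((1 + h * real (Suc n)) - (1 + h * real n)) * sqrt (Suc n) * (a * b) = h * (a * ?y)"
    by (simp add: algebra_simps)
  ultimately show ?thesis by (simp only:)
qed

text \<open>The increment \<open>2 * n + 1\<close> times \<open>sqrt (n + 1)\<close> is at most of
  the order of the weight. Any finite constant would serve: this weight is there to place the
  evolved state in the domain of the number operator.\<close>

lemma quadratic_increment:
  assumes h: "0 < h" "h < 1" and a: "0 \<le> a" "0 \<le> (b::real)"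
  shows "sqrt h * ((1 + (real (Suc n))\<^sup>2) - (1 + (real n)\<^sup>2)) * sqrt (Suc n) * (a * b)
    \<le> 2 * ((1 + (real n)\<^sup>2) * a\<^sup>2 + (1 + (real (Suc n))\<^sup>2) * b\<^sup>2)"
proof -
  let ?m = "real n + 1"
  have m: "1 \<le> ?m" by simp
  have "sqrt h \<le> 1" using h by simp
  moreover have "sqrt ?m \<le> ?m"
    using m by (intro real_le_lsqrt) (auto simp: power2_eq_square)
  ultimately have "sqrt h * sqrt ?m \<le> 1 * ?m"
    using h by (intro mult_mono) auto
  then have "(2 * real n + 1) * (sqrt h * sqrt ?m) \<le> (2 * ?m) * ?m"
    using h by (intro mult_mono) auto
  then have X: "(2 * real n + 1) * (sqrt h * sqrt ?m) \<le> 2 * ?m\<^sup>2"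
    by (simp only: power2_eq_square mult.assoc)
  have "(2 * real n + 1) * (sqrt h * sqrt ?m) * (a * b) \<le> 2 * ?m\<^sup>2 * ((a\<^sup>2 + b\<^sup>2) / 2)"
    by (rule mult_mono[OF X]) (use a sum_squares_bound[of a b] in auto)
  also have "\<dots> = ?m\<^sup>2 * a\<^sup>2 + ?m\<^sup>2 * b\<^sup>2" by (simp add: algebra_simps)
  also have "\<dots> \<le> (2 * (1 + (real n)\<^sup>2)) * a\<^sup>2 + (2 * (1 + ?m\<^sup>2)) * b\<^sup>2"
  proof (intro add_mono mult_right_mono)
    show "?m\<^sup>2 \<le> 2 * (1 + (real n)\<^sup>2)"
      using sum_squares_bound[of "real n" 1] by (simp add: power2_sum)
  qed auto
  also have "\<dots> = 2 * ((1 + (real n)\<^sup>2) * a\<^sup>2 + (1 + ?m\<^sup>2) * b\<^sup>2)"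
    by (simp add: algebra_simps)
  finally have "(2 * real n + 1) * (sqrt h * sqrt ?m) * (a * b)
      \<le> 2 * ((1 + (real n)\<^sup>2) * a\<^sup>2 + (1 + ?m\<^sup>2) * b\<^sup>2)" .
  moreover have "sqrt h * ((1 + ?m\<^sup>2) - (1 + (real n)\<^sup>2)) * sqrt ?m * (a * b)
      = (2 * real n + 1) * (sqrt h * sqrt ?m) * (a * b)"
    by (simp add: power2_eq_square algebra_simps)
  moreover have "real (Suc n) = ?m" by simp
  ultimately show ?thesis by (simp only:)
qed

text \<open>The moments rest on the recursion \<open>(k + 1) * g (k + 1) = l * g k\<close>, which
  trades one power of \<open>k\<close> for a shift of the index.\<close>

lemma poisson_sums:
  fixes l :: real
  defines "g \<equiv> \<lambda>k. exp (- l) * (l ^ k / fact k)"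
  shows "g sums 1" and "(\<lambda>k. real k * g k) sums l" and "summable (\<lambda>k. (real k)\<^sup>2 * g k)"
proof -
  have "(\<lambda>k. exp (- l) * (l ^ k /\<^sub>R fact k)) sums (exp (- l) * exp l)"
    by (intro sums_mult exp_converges)
  then show g: "g sums 1"
    by (simp add: g_def divide_inverse mult.commute exp_minus_inverse)
  have step: "real (Suc k) * g (Suc k) = l * g k" for k
    by (simp add: g_def field_simps del: of_nat_Suc)
  have "(\<lambda>k. real (Suc k) * g (Suc k)) sums l"
    unfolding step using sums_mult[OF g, of l] by simp
  then show n: "(\<lambda>k. real k * g k) sums l"
    by (subst (asm) sums_Suc_iff) simp
  have "summable (\<lambda>k. l * (real k * g k + g k))"
    using n g by (intro summable_mult summable_add) (auto simp: sums_iff)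
  also have "(\<lambda>k. l * (real k * g k + g k)) = (\<lambda>k. (real (Suc k))\<^sup>2 * g (Suc k))"
  proof
    fix k
    have "(real (Suc k))\<^sup>2 * g (Suc k) = real (Suc k) * (l * g k)"
      unfolding step[symmetric] by (simp only: power2_eq_square mult.assoc)
    then show "l * (real k * g k + g k) = (real (Suc k))\<^sup>2 * g (Suc k)"
      by (simp add: algebra_simps)
  qed
  finally show "summable (\<lambda>k. (real k)\<^sup>2 * g k)"
    by (subst (asm) summable_Suc_iff)
qed

lemma state_sq_product:
  assumes "norm a = 1"
  shows "state_sq k (product_state \<psi> a) = sector_sq k \<psi>"
proof -
  have "sector_sq k (cscale c \<psi>) = (cmod c)\<^sup>2 * sector_sq k \<psi>" for c
    by (rule sector_sq_eqI[OF AE_rep_cscale])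
  then have "state_sq k (product_state \<psi> a) = (\<Sum>s\<in>UNIV. (norm (a $ s))\<^sup>2) * sector_sq k \<psi>"
    by (simp add: state_sq_def product_state_def sum_distrib_right)
  also have "(\<Sum>s\<in>UNIV. (norm (a $ s))\<^sup>2) = (norm a)\<^sup>2"
    by (simp add: norm_vec_def L2_set_def sum_nonneg)
  finally show ?thesis using assms by simp
qed

lemma number_op_functional: "(\<psi>, \<phi>) \<in> number_op \<Longrightarrow> (\<psi>, \<phi>') \<in> number_op \<Longrightarrow> \<phi> = \<phi>'"
proof (rule fock_eqI)
  fix n assume "(\<psi>, \<phi>) \<in> number_op" "(\<psi>, \<phi>') \<in> number_op"
  then have "AE z in modes n. rep_fock \<phi> n z = of_real (\<Sum>i<n. 1) * rep_fock \<psi> n z"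
    "AE z in modes n. rep_fock \<phi>' n z = of_real (\<Sum>i<n. 1) * rep_fock \<psi> n z"
    unfolding number_op_def dGamma_def fock_op_def by blast+
  then show "AE z in modes n. rep_fock \<phi> n z = rep_fock \<phi>' n z"
    by eventually_elim simp
qed

lemma number_op_weight:
  assumes "summable (\<lambda>n. (real n)\<^sup>2 * sector_sq n \<psi>)"
  shows "(\<psi>, weight_op real \<psi>) \<in> number_op"
    and "(\<lambda>n. complex_of_real (real n * sector_sq n \<psi>)) sums cinner (weight_op real \<psi>) \<psi>"
proof -
  have ae: "AE z in modes n. rep_fock (weight_op real \<psi>) n z = of_real (real n) * rep_fock \<psi> n z" for n
    unfolding weight_op_def by (rule AE_rep_abs[OF fock_fun_weight[OF assms]])
  then show "(\<psi>, weight_op real \<psi>) \<in> number_op"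
    by (simp add: number_op_def dGamma_def fock_op_def)
  have "sector n (weight_op real \<psi>) \<psi> = of_real (real n * sector_sq n \<psi>)" for n
  proof -
    have "sector n (weight_op real \<psi>) \<psi>
        = (\<integral>z. of_real (real n) * (rep_fock \<psi> n z * cnj (rep_fock \<psi> n z)) \<partial>modes n)"
      unfolding sector_def
    proof (rule integral_cong_AE)
      show "AE z in modes n. rep_fock (weight_op real \<psi>) n z * cnj (rep_fock \<psi> n z)
          = of_real (real n) * (rep_fock \<psi> n z * cnj (rep_fock \<psi> n z))"
        using ae[of n] by eventually_elim simp
    qed measurable
    also have "\<dots> = of_real (real n) * sector n \<psi> \<psi>"
      unfolding sector_def by (rule Bochner_Integration.integral_mult_right_zero)
    finally show ?thesis by (simp add: sector_self)
  qed
  then show "(\<lambda>n. complex_of_real (real n * sector_sq n \<psi>)) sums cinner (weight_op real \<psi>) \<psi>"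
    using cinner_sums[of "weight_op real \<psi>" \<psi>] by simp
qed

text \<open>The second moment is the squared norm of the image under the number operator, so its
  finiteness puts \<open>u\<close> into the domain. \<open>op_apply\<close> is a definite
  description and calls for a unique image, which \<open>number_op_functional\<close>
  supplies.\<close>

lemma number_expectation:
  fixes u :: "'n::finite state"
  assumes s: "summable (\<lambda>k. (real k)\<^sup>2 * state_sq k u)"
  shows "u \<in> Domain (op_tensor number_op (mat 1))"
    and "(\<lambda>k. real k * state_sq k u) sums (\<Sum>k. real k * state_sq k u)"
    and "cinner_state (op_apply (op_scale c (op_tensor number_op (mat 1))) u) u
      = of_real (c * (\<Sum>k. real k * state_sq k u))"
proof -
  have le: "sector_sq k (u $ s) \<le> state_sq k u" for k s
    unfolding state_sq_def by (rule member_le_sum) auto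
  have s': "summable (\<lambda>k. (real k)\<^sup>2 * sector_sq k (u $ r))" for r
    by (rule summable_comparison_test[OF _ s]) (auto intro!: exI[of _ 0] mult_left_mono le)
  let ?v = "\<chi> s. weight_op real (u $ s)"
  have v: "(u, ?v) \<in> op_tensor number_op (mat 1)"
    unfolding op_tensor_identity using number_op_weight(1)[OF s'] by simp
  then show "u \<in> Domain (op_tensor number_op (mat 1))" by blast
  have "op_apply (op_scale c (op_tensor number_op (mat 1))) u = c *\<^sub>R ?v"
    unfolding op_apply_def
  proof (rule the_equality)
    show "(u, c *\<^sub>R ?v) \<in> op_scale c (op_tensor number_op (mat 1))"
      unfolding op_scale_def using v by blast
    fix v' assume "(u, v') \<in> op_scale c (op_tensor number_op (mat 1))"
    then obtain v'' where v'': "v' = c *\<^sub>R v''" "(u, v'') \<in> op_tensor number_op (mat 1)"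
      unfolding op_scale_def by blast
    have "v'' = ?v"
      using v''(2) v number_op_functional unfolding op_tensor_identity vec_eq_iff by blast
    then show "v' = c *\<^sub>R ?v" using v''(1) by simp
  qed
  then have 1: "cinner_state (op_apply (op_scale c (op_tensor number_op (mat 1))) u) u
      = of_real c * (\<Sum>r\<in>UNIV. cinner (weight_op real (u $ r)) (u $ r))"
    by (simp add: cinner_state_def scaleR_fock_def cinner_scale_left sum_distrib_left)
  have "(\<lambda>k. \<Sum>r\<in>UNIV. complex_of_real (real k * sector_sq k (u $ r))) sums
      (\<Sum>r\<in>UNIV. cinner (weight_op real (u $ r)) (u $ r))"
    by (intro sums_sum number_op_weight(2) s')
  then have c: "(\<lambda>k. complex_of_real (real k * state_sq k u)) sums
      (\<Sum>r\<in>UNIV. cinner (weight_op real (u $ r)) (u $ r))"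
    by (simp only: state_sq_def sum_distrib_left of_real_sum)
  from sums_Re[OF this] show R: "(\<lambda>k. real k * state_sq k u) sums (\<Sum>k. real k * state_sq k u)"
    by (simp only: Re_complex_of_real sums_iff)
  have "(\<Sum>r\<in>UNIV. cinner (weight_op real (u $ r)) (u $ r)) = of_real (\<Sum>k. real k * state_sq k u)"
    using c R unfolding sums_of_real_iff[symmetric, where 'a = complex] by (rule sums_unique2)
  then show "cinner_state (op_apply (op_scale c (op_tensor number_op (mat 1))) u) u
      = of_real (c * (\<Sum>k. real k * state_sq k u))"
    unfolding 1 by simp
qed

lemma number_evolution:
  fixes a :: "'n::finite spin" and f :: "photon \<times> photon" and t :: real
  assumes U: "unitary_group (hamiltonian chi \<beta> x h) U" and h: "0 < h" "h < 1" and a: "norm a = 1"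
  defines "u \<equiv> U (t / h) (product_state (coherent h f) a)" and "y \<equiv> 2 * field_bound chi x * \<bar>t\<bar>"
  shows "u \<in> Domain (op_tensor number_op (mat 1))"
    and "cmod (cinner_state (op_apply (op_scale (2 * h) (op_tensor number_op (mat 1))) u) u - of_real ((norm f)\<^sup>2))
      \<le> h * ((2 + (norm f)\<^sup>2) * (y * exp y))"
proof -
  interpret unitary_evolution "hamiltonian chi \<beta> x h" U by standard (rule U)
  let ?\<Psi> = "product_state (coherent h f) a"
  define l where "l = (norm f)\<^sup>2 / (2 * h)"
  have \<Psi>: "?\<Psi> \<in> closure (Domain (hamiltonian chi \<beta> x h))"
    by (rule coherent_in_closure_Domain[OF U h(1)])
  have sq: "state_sq k ?\<Psi> = exp (- l) * (l ^ k / fact k)" for k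
    unfolding state_sq_product[OF a] l_def by (rule coherent_sums(2)[OF h(1)])
  note poisson = poisson_sums[of l, folded sq]
  have u1: "(\<lambda>k. state_sq k u) sums 1"
    using state_sq_sums[of u] sums_unique2[OF state_sq_sums[of ?\<Psi>] poisson(1)] by (simp add: u_def)
  \<comment> \<open>The quadratic weight is followed for its finiteness at fixed \<open>h\<close>;
    the error bound comes from the linear weight below.\<close>
  have "summable (\<lambda>k. (1 + (real k)\<^sup>2) * state_sq k u)"
    unfolding u_def
  proof (rule moment_evolution(1)[OF U h(1) \<Psi>, where C = 2])
    show "mono (\<lambda>k. 1 + (real k)\<^sup>2)" by (auto intro!: monoI power_mono)
    show "summable (\<lambda>k. (1 + (real k)\<^sup>2) * state_sq k ?\<Psi>)"
      using poisson by (auto simp: distrib_right sums_iff intro!: summable_add)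
  qed (use quadratic_increment[OF h] in auto)
  then have "summable (\<lambda>k. (1 + (real k)\<^sup>2) * state_sq k u - state_sq k u)"
    using u1 by (intro summable_diff) (auto simp: sums_iff)
  then have s2: "summable (\<lambda>k. (real k)\<^sup>2 * state_sq k u)" by (simp add: distrib_right)
  note num = number_expectation[OF s2]
  show "u \<in> Domain (op_tensor number_op (mat 1))" by (rule num(1))
  define N where "N = (\<Sum>k. real k * state_sq k u)"
  have total: "(\<lambda>k. (1 + h * real k) * state_sq k \<Phi>) sums (1 + h * M)"
    if "(\<lambda>k. state_sq k \<Phi>) sums 1" "(\<lambda>k. real k * state_sq k \<Phi>) sums M" for \<Phi> :: "'n state" and M
    using sums_add[OF that(1) sums_mult[OF that(2), of h]] by (simp add: distrib_right mult.assoc)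
  have T0: "(\<lambda>k. (1 + h * real k) * state_sq k ?\<Psi>) sums (1 + h * l)"
    by (rule total[OF poisson(1,2)])
  have T: "(\<lambda>k. (1 + h * real k) * state_sq k u) sums (1 + h * N)"
    unfolding N_def by (rule total[OF u1 num(2)])
  \<comment> \<open>The growth factor for the linear weight, whose constant is \<open>C = h\<close>;
    in terms of \<open>y\<close>, which does not involve \<open>h\<close>, it is
    \<open>exp (h * y)\<close>.\<close>
  define E where "E = exp (2 * (field_bound chi x * h) * \<bar>t\<bar>)"
  have "(\<Sum>k. (1 + h * real k) * state_sq k u) \<le> (\<Sum>k. (1 + h * real k) * state_sq k ?\<Psi>) * E"
    "(\<Sum>k. (1 + h * real k) * state_sq k ?\<Psi>) \<le> (\<Sum>k. (1 + h * real k) * state_sq k u) * E"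
    unfolding u_def E_def
    by (rule moment_evolution(2,3)[OF U h(1) \<Psi>, where C = h and W = "\<lambda>k. 1 + h * real k"];
        use h linear_increment[OF h] sums_summable[OF T0] in \<open>auto intro!: monoI mult_left_mono\<close>)+
  then have ev: "1 + h * N \<le> (1 + h * l) * E" "1 + h * l \<le> (1 + h * N) * E"
    by (simp_all only: sums_unique[OF T0, symmetric] sums_unique[OF T, symmetric])
  have y: "0 \<le> y" by (simp add: y_def field_bound_nonneg)
  have E_eq: "E = exp (h * y)" by (simp add: E_def y_def)
  \<comment> \<open>The rescaled Poisson mean no longer depends on \<open>h\<close>; doubled, it is
    the initial classical quantity.\<close>
  have hl: "h * l = (norm f)\<^sup>2 / 2" using h by (simp add: l_def)
  have hl0: "0 \<le> h * l" unfolding hl by simp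
  have N: "0 \<le> h * N"
    unfolding N_def using h num(2) by (intro mult_nonneg_nonneg suminf_nonneg) (auto simp: sums_iff)
  \<comment> \<open>Multiply \<open>1 - h * y \<le> exp (- (h * y))\<close> by \<open>E\<close>; the
    remaining factor \<open>exp (h * y)\<close> is at most \<open>exp y\<close> since
    \<open>h < 1\<close>.\<close>
  have "E - 1 \<le> h * (y * exp y)"
  proof -
    have "1 - h * y \<le> exp (- (h * y))" using exp_ge_add_one_self[of "- (h * y)"] by simp
    then have "(1 - h * y) * E \<le> exp (- (h * y)) * E" unfolding E_eq by (intro mult_right_mono) auto
    also have "\<dots> = 1" by (simp add: E_eq flip: exp_add)
    finally have "E - 1 \<le> h * y * E" by (simp add: algebra_simps)
    also have "\<dots> \<le> h * y * exp y"
      using h y mult_right_mono[of h 1 y] by (intro mult_left_mono) (auto simp: E_eq)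
    finally show ?thesis by (simp add: mult.assoc)
  qed
  \<comment> \<open>The backward estimate bounds a decrease by \<open>(1 + h * N) * (E - 1)\<close>.
    If there is a decrease, \<open>h * N\<close> is below \<open>h * l\<close>, and the bound takes
    the same form as for an increase.\<close>
  moreover have "\<bar>h * N - h * l\<bar> \<le> (1 + h * l) * (E - 1)"
  proof -
    have "1 \<le> E" using h y by (simp add: E_eq)
    have "h * N - h * l \<le> (1 + h * l) * (E - 1)" using ev(1) by (simp add: algebra_simps)
    moreover have "h * l - h * N \<le> (1 + h * l) * (E - 1)"
    proof (cases "h * l \<le> h * N")
      case True
      have "0 \<le> (1 + h * l) * (E - 1)" using \<open>1 \<le> E\<close> hl0 by (intro mult_nonneg_nonneg) auto
      then show ?thesis using True by linarith
    next
      case False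
      have "h * l - h * N \<le> (1 + h * N) * (E - 1)" using ev(2) by (simp add: algebra_simps)
      also have "\<dots> \<le> (1 + h * l) * (E - 1)" using False \<open>1 \<le> E\<close> by (intro mult_right_mono) auto
      finally show ?thesis .
    qed
    ultimately show ?thesis by linarith
  qed
  moreover have "(1 + h * l) * (E - 1) \<le> (1 + h * l) * (h * (y * exp y))"
    using calculation(1) hl0 by (intro mult_left_mono) auto
  ultimately have "\<bar>h * N - h * l\<bar> \<le> (1 + h * l) * (h * (y * exp y))" by (metis order_trans)
  then have "2 * \<bar>h * N - h * l\<bar> \<le> 2 * ((1 + h * l) * (h * (y * exp y)))" by (rule mult_left_mono) simp
  also have "\<dots> = h * ((2 + (norm f)\<^sup>2) * (y * exp y))" unfolding hl by (simp add: algebra_simps)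
  finally have "\<bar>2 * h * N - (norm f)\<^sup>2\<bar> \<le> h * ((2 + (norm f)\<^sup>2) * (y * exp y))"
    unfolding hl by (simp add: abs_if split: if_splits)
  then show "cmod (cinner_state (op_apply (op_scale (2 * h) (op_tensor number_op (mat 1))) u) u - of_real ((norm f)\<^sup>2))
      \<le> h * ((2 + (norm f)\<^sup>2) * (y * exp y))"
    unfolding num(3) N_def[symmetric] of_real_diff[symmetric] norm_of_real .
qed

theorem theorem4p1:
  fixes chi :: "real \<Rightarrow> real" and \<beta> :: "real^3" and x :: "'n::finite \<Rightarrow> real^3"
    and q0 p0 :: photon and a0 :: "'n spin"
  assumes "schwartz chi" and "\<forall>\<^sub>F r in nhds 0. chi r = 0" and "norm a0 = 1"
  shows "\<exists>C :: real \<Rightarrow> real. (\<forall>K. compact K \<longrightarrow> bounded (C ` K)) \<and>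
    (\<forall>h U q p \<omega> t.
      0 < h \<and> h < 1 \<and> unitary_group (hamiltonian chi \<beta> x h) U \<and>
      weak_solution chi \<beta> x h q p \<omega> \<and> q 0 = q0 \<and> p 0 = p0 \<and> \<omega> 0 = pi_functional a0 \<longrightarrow>
      (let u = U (t / h) (product_state (coherent h (q0, p0)) a0);
           N = op_tensor number_op (mat 1)
       in u \<in> Domain N \<and>
          cmod (cinner_state (op_apply (op_scale (2 * h) N) u) u
                - of_real ((norm (q t))\<^sup>2 + (norm (p t))\<^sup>2)) \<le> C t * h powr (1/2)))"
proof -
  obtain K where K: "0 \<le> K" and classical: "\<And>h q p \<omega> t. 0 < h \<Longrightarrow> weak_solution chi \<beta> x h q p \<omega> \<Longrightarrow>
      \<omega> 0 = pi_functional a0 \<Longrightarrow> \<bar>norm (q t, p t) - norm (q 0, p 0)\<bar> \<le> h * K * \<bar>t\<bar>"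
    using weak_solution_photon_bound[of chi \<beta> x "pi_functional a0"] by blast
  define r where "r = norm (q0, p0)"
  define y where "y t = 2 * field_bound chi x * \<bar>t\<bar>" for t
  \<comment> \<open>The first summand is the quantum error. The second comes from factoring the
    difference of squares \<open>R\<^sup>2 - r\<^sup>2\<close>, with \<open>R\<close> at most
    \<open>r + K * \<bar>t\<bar>\<close>. In both a factor \<open>h\<close> has been taken
    out.\<close>
  define C where "C t = (2 + r\<^sup>2) * (y t * exp (y t)) + K * \<bar>t\<bar> * (2 * r + K * \<bar>t\<bar>)" for t
  have r: "0 \<le> r" by (simp add: r_def)
  have y: "0 \<le> y t" for t by (simp add: y_def field_bound_nonneg)
  have C: "0 \<le> C t" for t
    unfolding C_def using r K y[of t] by (intro add_nonneg_nonneg mult_nonneg_nonneg) auto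
  have "continuous_on S C" for S
    unfolding C_def y_def by (intro continuous_intros)
  then have "compact S \<Longrightarrow> bounded (C ` S)" for S
    by (intro compact_imp_bounded compact_continuous_image)
  moreover have "U (t / h) (product_state (coherent h (q0, p0)) a0) \<in> Domain (op_tensor number_op (mat 1)) \<and>
      cmod (cinner_state (op_apply (op_scale (2 * h) (op_tensor number_op (mat 1)))
          (U (t / h) (product_state (coherent h (q0, p0)) a0)))
          (U (t / h) (product_state (coherent h (q0, p0)) a0))
        - of_real ((norm (q t))\<^sup>2 + (norm (p t))\<^sup>2)) \<le> C t * h powr (1/2)"
    if h: "0 < h" "h < 1" and U: "unitary_group (hamiltonian chi \<beta> x h) U"
      and ws: "weak_solution chi \<beta> x h q p \<omega>" and init: "q 0 = q0" "p 0 = p0" "\<omega> 0 = pi_functional a0"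
    for h U q p \<omega> t
  proof
    let ?u = "U (t / h) (product_state (coherent h (q0, p0)) a0)"
    let ?v = "cinner_state (op_apply (op_scale (2 * h) (op_tensor number_op (mat 1))) ?u) ?u"
    note quantum = number_evolution[OF U h assms(3), where t = t and f = "(q0, p0)", folded r_def y_def]
    show "?u \<in> Domain (op_tensor number_op (mat 1))" by (rule quantum(1))
    define R where "R = norm (q t, p t)"
    have R: "(norm (q t))\<^sup>2 + (norm (p t))\<^sup>2 = R\<^sup>2" by (simp add: R_def norm_prod_def)
    have d: "\<bar>R - r\<bar> \<le> h * (K * \<bar>t\<bar>)"
      using classical[OF h(1) ws init(3), of t] by (simp add: R_def r_def init mult.assoc)
    have d': "h * (K * \<bar>t\<bar>) \<le> K * \<bar>t\<bar>"
      using h K mult_right_mono[of h 1 "K * \<bar>t\<bar>"] by simp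
    have "\<bar>R\<^sup>2 - r\<^sup>2\<bar> = \<bar>R - r\<bar> * \<bar>R + r\<bar>"
      by (simp add: power2_eq_square algebra_simps flip: abs_mult)
    also have "\<dots> \<le> h * (K * \<bar>t\<bar>) * (2 * r + K * \<bar>t\<bar>)"
      using d d' r R_def K h by (intro mult_mono d) auto
    finally have cl: "\<bar>R\<^sup>2 - r\<^sup>2\<bar> \<le> h * (K * \<bar>t\<bar> * (2 * r + K * \<bar>t\<bar>))" by (simp add: mult.assoc)
    have "cmod (?v - of_real (R\<^sup>2)) \<le> cmod (?v - of_real (r\<^sup>2)) + cmod (of_real (R\<^sup>2) - of_real (r\<^sup>2))"
      using norm_triangle_ineq4[of "?v - of_real (r\<^sup>2)" "of_real (R\<^sup>2) - of_real (r\<^sup>2)"] by simp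
    also have "cmod (of_real (R\<^sup>2) - of_real (r\<^sup>2)) = \<bar>R\<^sup>2 - r\<^sup>2\<bar>"
      by (simp only: of_real_diff[symmetric] norm_of_real)
    finally have "cmod (?v - of_real (R\<^sup>2)) \<le> h * C t"
      using quantum(2) cl unfolding C_def distrib_left by linarith
    \<comment> \<open>The error obtained is of order \<open>h\<close>; the stated rate is weaker
      because \<open>h < 1\<close>.\<close>
    also have "\<dots> \<le> C t * h powr (1/2)"
    proof -
      have "h \<le> h powr (1/2)"
        using powr_mono'[of "1/2" 1 h] h by simp
      then have "C t * h \<le> C t * h powr (1/2)" using C by (rule mult_left_mono)
      then show ?thesis by (simp add: mult.commute)
    qed
    finally show "cmod (?v - of_real ((norm (q t))\<^sup>2 + (norm (p t))\<^sup>2)) \<le> C t * h powr (1/2)"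
      unfolding R .
  qed
  ultimately show ?thesis
    unfolding Let_def by (intro exI[of _ C]) blast
qed

end
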